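(* Assume $1\le p<\infty$. Let $f\in L^p(\mathbb{R}^n)$ and suppose that $$\liminf_{t\to0^+}\frac{1}{t^{p/2}}\int_{\mathbb{R}^n}P_t\big(|f-f(x)|^p\big)(x)\,dx<\infty.$$ If $p>1$, then $f\in W^{1,p}(\mathbb{R}^n)$ and $$\lim_{t\to0^+}\frac{1}{t^{p/2}}\int_{\mathbb{R}^n}P_t\big(|f-f(x)|^p\big)(x)\,dx=\frac{2\,\Gamma(p)}{\Gamma(p/2)}\int_{\mathbb{R}^n}|\nabla f(x)|^p\,dx.$$ If instead $p=1$, then $f\in BV(\mathbb{R}^n)$ and $$\lim_{t\to0^+}\frac{1}{\sqrt t}\int_{\mathbb{R}^n}P_t\big(|f-f(x)|\big)(x)\,dx=\frac{2}{\sqrt\pi}\operatorname{Var}(f).$$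
   Context: $P_tf(x)=(4\pi t)^{-n/2}\int_{\mathbb{R}^n}e^{-\frac{|x-y|^2}{4t}}f(y)\,dy$ is the heat semigroup in $\mathbb{R}^n$, so $P_t(|f-f(x)|^p)(x)=(4\pi t)^{-n/2}\int_{\mathbb{R}^n}e^{-\frac{|x-y|^2}{4t}}|f(y)-f(x)|^p\,dy$. $\operatorname{Var}(f)$ is the total variation of $f$ in the sense of De Giorgi, and $BV(\mathbb{R}^n)$ is the space of $f\in L^1(\mathbb{R}^n)$ with $\operatorname{Var}(f)<\infty$. *)

theory Defs
  imports "HOL-Analysis.Analysis"
begin

(* Elements of Lp p are Lebesgue measurable functions, not equivalence classes; all notions below
   are invariant under modification of the function on a Lebesgue null set. *)
definition Lp :: "real \<Rightarrow> ('a::euclidean_space \<Rightarrow> 'b::euclidean_space) set" where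
  "Lp p = {f \<in> borel_measurable lebesgue. integrable lebesgue (\<lambda>x. norm (f x) powr p)}"

definition locally_integrable :: "('a::euclidean_space \<Rightarrow> 'b::euclidean_space) \<Rightarrow> bool" where
  "locally_integrable f \<longleftrightarrow> (\<forall>K. compact K \<longrightarrow> f absolutely_integrable_on K)"

(* The heat semigroup on nonnegative functions, with values in [0, \<infinity>]. *)
definition heat_semigroup ::
  "real \<Rightarrow> ('a::euclidean_space \<Rightarrow> ennreal) \<Rightarrow> 'a \<Rightarrow> ennreal" where
  "heat_semigroup t g x =
     ennreal ((4 * pi * t) powr (- (real DIM('a) / 2))) *
       (\<integral>\<^sup>+y. ennreal (exp (- (norm (x - y))\<^sup>2 / (4 * t))) * g y \<partial>lebesgue)"

definition heat_energy :: "real \<Rightarrow> ('a::euclidean_space \<Rightarrow> real) \<Rightarrow> real \<Rightarrow> ennreal" where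
  "heat_energy p f t =
     (\<integral>\<^sup>+x. heat_semigroup t (\<lambda>y. ennreal (\<bar>f y - f x\<bar> powr p)) x \<partial>lebesgue)"

(* The test space of continuously differentiable, compactly supported maps.  In finite dimension,
   continuity of the derivative in operator norm is the same as continuity of every directional
   derivative. *)
definition C1c :: "('a::euclidean_space \<Rightarrow> 'b::euclidean_space) set" where
  "C1c = {\<phi>. (\<forall>x. \<phi> differentiable (at x)) \<and>
              (\<forall>v. continuous_on UNIV (\<lambda>x. frechet_derivative \<phi> (at x) v)) \<and>
              compact (closure {x. \<phi> x \<noteq> 0})}"

definition has_weak_gradient :: "('a::euclidean_space \<Rightarrow> real) \<Rightarrow> ('a \<Rightarrow> 'a) \<Rightarrow> bool" where
  "has_weak_gradient f G \<longleftrightarrow>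
     locally_integrable f \<and> locally_integrable G \<and>
     (\<forall>\<phi>\<in>C1c. \<forall>b\<in>Basis.
        (\<integral>x. f x * frechet_derivative \<phi> (at x) b \<partial>lebesgue) =
        - (\<integral>x. (G x \<bullet> b) * \<phi> x \<partial>lebesgue))"

(* A weak gradient is unique up to a Lebesgue null set, so the choice is immaterial. *)
definition weak_gradient :: "('a::euclidean_space \<Rightarrow> real) \<Rightarrow> 'a \<Rightarrow> 'a" where
  "weak_gradient f = (SOME G. has_weak_gradient f G)"

definition W1p :: "real \<Rightarrow> ('a::euclidean_space \<Rightarrow> real) set" where
  "W1p p = {f \<in> Lp p. \<exists>G\<in>Lp p. has_weak_gradient f G}"

definition div_field :: "('a::euclidean_space \<Rightarrow> 'a) \<Rightarrow> 'a \<Rightarrow> real" where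
  "div_field \<phi> x = (\<Sum>b\<in>Basis. frechet_derivative \<phi> (at x) b \<bullet> b)"

(* The coercion to ennreal truncates negative integrals to 0; this does not change the supremum,
   since the zero field is admissible. *)
definition Var :: "('a::euclidean_space \<Rightarrow> real) \<Rightarrow> ennreal" where
  "Var f = (SUP \<phi>\<in>{\<phi> \<in> C1c. \<forall>x. norm (\<phi> x) \<le> 1}.
              ennreal (\<integral>x. f x * div_field \<phi> x \<partial>lebesgue))"

definition BV :: "('a::euclidean_space \<Rightarrow> real) set" where
  "BV = {f \<in> Lp 1. Var f < \<infinity>}"

end

theory Submission
  imports Defs "HOL-Probability.Distributions"
begin

text \<open>
  Substituting \<open>y = x + sqrt t *\<^sub>R z\<close> turns the heat energy into a Gaussian average over \<open>z\<close> of
  \<open>W (sqrt t *\<^sub>R z)\<close>, where \<open>W h\<close> is the integral of \<open>\<bar>f (x + h) - f x\<bar> powr p\<close> over \<open>x\<close>.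
  Convexity gives \<open>W (m *\<^sub>R h) \<le> m powr p * W h\<close> and \<open>W\<close> is continuous at \<open>0\<close>, so by a Fekete-type
  argument \<open>W (s *\<^sub>R z) / s powr p\<close> tends, as \<open>s\<close> decreases to \<open>0\<close>, to its supremum over \<open>s > 0\<close>.
  Hence the rescaled energy always converges. Its limit \<open>\<Lambda> f\<close> is lower semicontinuous in \<open>L\<^sup>p\<close>, does not
  increase under mollification, and equals \<open>C\<close> times the integral of \<open>\<bar>\<nabla>v\<bar> powr p\<close> for continuously
  differentiable \<open>v\<close>, where \<open>C\<close> is an absolute moment of a Gaussian. So the integrals of
  \<open>\<bar>\<nabla>f\<^sub>k\<bar> powr p\<close> tend to \<open>\<Lambda> f / C\<close> for mollifications \<open>f\<^sub>k\<close> of \<open>f\<close>.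

  For \<open>p > 1\<close>, lower semicontinuity along \<open>(f\<^sub>k + f\<^sub>l) / 2\<close> and uniform convexity of \<open>L\<^sup>p\<close> make \<open>\<nabla>f\<^sub>k\<close>
  a Cauchy sequence, whose limit is the weak gradient. For \<open>p = 1\<close>, the supremum of the integrals of
  \<open>\<bar>\<nabla>f\<^sub>k\<bar>\<close> is the total variation of \<open>f\<close> by duality.
\<close>

section \<open>Convexity and the integral of a \<open>p\<close>-th power\<close>

text \<open>The hypothesis bounds only a lower limit while the conclusion asserts a limit. This is
  consistent because the limit exists in [0, \<infinity>] for every L^p function, so the lower limit
  already equals \<open>Lam\<close>. Working with p-th powers of norms in \<open>ennreal\<close>
  makes Tonelli and Fatou available before anything is known to be finite, at the price of the
  triangle inequality. Its replacement is |a + b|^p \<le> l^(1-p) |a|^p + (1-l)^(1-p) |b|^p for 0 <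
  l < 1: linear in the p-th powers, hence integrable, sharp when l is tuned to the two norms, and
  good for limits by sending l to 1 once the error term has vanished. The constant: if Z has the
  heat kernel at time 1 as density, a \<bullet> Z is normal with variance 2 |a|^2, and its absolute
  moment 2^p Gamma((p+1)/2) / sqrt pi * |a|^p takes the stated form by Legendre's duplication
  formula. For p > 1 uniform convexity stands in for weak compactness: all gradients have energy at
  most \<open>M\<close>, their midpoints almost \<open>M\<close>. For p = 1 this strictness is lost
  and the gradients need not converge in L^1, so a dual field is used instead.\<close>

lemma convex_on_powr_nonneg:
  assumes "1 \<le> p"
  shows "convex_on {0..} (\<lambda>x::real. x powr p)"
proof (rule convex_onI)
  fix t x y :: real
  assume t: "0 < t" "t < 1" and xy: "x \<in> {0..}" "y \<in> {0..}"
  \<comment> \<open>If one endpoint is 0, the convexity inequality reduces to t^p \<le> t on the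
    unit interval; positive endpoints are covered by \<open>powr_convex\<close>.\<close>
  have pw: "s powr p \<le> s" if "0 < s" "s < 1" for s :: real
    using powr_mono'[of 1 p s] that assms by simp
  show "((1 - t) *\<^sub>R x + t *\<^sub>R y) powr p \<le> (1 - t) * x powr p + t * y powr p"
  proof (cases "x = 0 \<or> y = 0")
    case True
    then show ?thesis
      using t xy pw[of t] pw[of "1 - t"] by (auto simp: powr_mult intro!: mult_right_mono)
  next
    case False
    then show ?thesis
      using convex_onD[OF powr_convex[OF assms], of t x y] t xy by auto
  qed
qed auto

text \<open>Convexity of the p-th power at the points |a|/l and |b|/(1-l). The infimum of the
  right-hand side over l is (|a| + |b|)^p, approached with l proportional to |a|, so the whole
  family carries the strength of the triangle inequality.\<close>

lemma norm_add_powr_le: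
  fixes a b :: "'a::real_normed_vector"
  assumes p: "1 \<le> p" and l: "0 < l" "l < 1"
  shows "norm (a + b) powr p \<le> l powr (1 - p) * norm a powr p + (1 - l) powr (1 - p) * norm b powr p"
proof -
  have sc: "r * (x / r) powr p = r powr (1 - p) * x powr p" if "r > 0" "x \<ge> 0" for r x :: real
    using that by (simp add: powr_divide powr_diff field_simps)
  have "norm (a + b) powr p \<le> (norm a + norm b) powr p"
    using p by (intro powr_mono2 norm_triangle_ineq) auto
  also have "\<dots> = (l * (norm a / l) + (1 - l) * (norm b / (1 - l))) powr p"
    using l by simp
  also have "\<dots> \<le> l * (norm a / l) powr p + (1 - l) * (norm b / (1 - l)) powr p"
    using convex_onD[OF convex_on_powr_nonneg[OF p], of "1 - l" "norm a / l" "norm b / (1 - l)"] l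
    by simp
  finally show ?thesis using l by (simp add: sc)
qed

lemma norm_add_powr_le2:
  fixes a b :: "'a::real_normed_vector"
  assumes p: "1 \<le> p"
  shows "norm (a + b) powr p \<le> 2 powr p * (norm a powr p + norm b powr p)"
proof -
  have "norm (a + b) powr p \<le> (1/2) powr (1 - p) * norm a powr p + (1/2) powr (1 - p) * norm b powr p"
    using norm_add_powr_le[OF p, of "1/2" a b] by simp
  also have "(1/2) powr (1 - p) = (2::real) powr (p - 1)"
    by (simp add: powr_divide powr_minus_divide powr_diff)
  also have "2 powr (p - 1) * norm a powr p + 2 powr (p - 1) * norm b powr p
      \<le> 2 powr p * norm a powr p + 2 powr p * norm b powr p"
    by (intro add_mono mult_right_mono powr_mono) auto
  finally show ?thesis by (simp add: algebra_simps)
qed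

section \<open>Jensen's inequality for p-th powers\<close>

lemma powr_tangent_le:
  fixes r m p :: real
  assumes p: "1 \<le> p" and "0 \<le> r" "0 < m"
  shows "m powr p + p * m powr (p - 1) * (r - m) \<le> r powr p"
proof -
  define s where "s = r / m"
  have s: "s \<ge> 0" "r = s * m" using assms by (auto simp: s_def)
  \<comment> \<open>After division by \<open>m powr p\<close> the tangent bound is Bernoulli's
    inequality, the tangent at 1.\<close>
  have "1 + p * (s - 1) \<le> s powr p"
  proof (cases "s = 0")
    case False
    have d: "((\<lambda>x. x powr p) has_real_derivative p * 1 powr (p - 1)) (at 1 within {0<..})"
      using has_real_derivative_powr[of 1 p] by (simp add: has_field_derivative_at_within)
    have "s powr p - 1 powr p \<ge> (p * 1 powr (p - 1)) * (s - 1)"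
      by (rule convex_on_imp_above_tangent[OF powr_convex[OF p] _ _ _ d])
         (use s(1) False in \<open>auto simp: interior_open\<close>)
    then show ?thesis by (simp add: algebra_simps)
  qed (use p in auto)
  then have "m powr p * (1 + p * (s - 1)) \<le> m powr p * s powr p"
    by (rule mult_left_mono) auto
  moreover have "m powr p = m powr (p - 1) * m"
    using assms by (simp add: powr_diff)
  ultimately show ?thesis
    using assms s by (simp add: powr_mult algebra_simps)
qed

lemma le_one_plus_powr:
  fixes r p :: real
  assumes "1 \<le> p" "0 \<le> r"
  shows "r \<le> 1 + r powr p"
proof (cases "r \<le> 1")
  case False
  then show ?thesis using powr_mono[of 1 p r] assms by simp
qed (smt (verit) powr_ge_zero)

text \<open>Integrate the tangent line at the mean \<open>m\<close> of the norm. If the right-hand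
  side is finite, r \<le> 1 + r^p makes the norm integrable because the total mass is 1.\<close>

lemma (in prob_space) norm_integral_powr_le:
  fixes u :: "'a \<Rightarrow> 'b::{banach, second_countable_topology}"
  assumes p: "1 \<le> p" and u: "u \<in> borel_measurable M"
  shows "ennreal (norm (\<integral>y. u y \<partial>M) powr p) \<le> (\<integral>\<^sup>+y. ennreal (norm (u y) powr p) \<partial>M)"
proof (cases "(\<integral>\<^sup>+y. ennreal (norm (u y) powr p) \<partial>M) = \<infinity>")
  case False
  have ip: "integrable M (\<lambda>y. norm (u y) powr p)"
    using False u by (intro integrableI_bounded) (auto simp: top.not_eq_extremum)
  have i: "integrable M (\<lambda>y. norm (u y))"
  proof (rule Bochner_Integration.integrable_bound)
    show "integrable M (\<lambda>y. 1 + norm (u y) powr p)" using ip by simp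
    show "(\<lambda>y. norm (u y)) \<in> borel_measurable M" using u by simp
    show "AE y in M. norm (norm (u y)) \<le> norm (1 + norm (u y) powr p)"
    proof (rule AE_I2)
      fix y
      show "norm (norm (u y)) \<le> norm (1 + norm (u y) powr p)"
        using le_one_plus_powr[OF p, of "norm (u y)"] by simp
    qed
  qed
  define m where "m = (\<integral>y. norm (u y) \<partial>M)"
  have m0: "m \<ge> 0" by (simp add: m_def)
  have le: "norm (\<integral>y. u y \<partial>M) \<le> m" unfolding m_def by (rule integral_norm_bound)
  have "m powr p \<le> (\<integral>y. norm (u y) powr p \<partial>M)"
  proof (cases "m = 0")
    case False
    then have "m > 0" using m0 by simp
    have "(\<integral>y. m powr p + p * m powr (p - 1) * (norm (u y) - m) \<partial>M) \<le> (\<integral>y. norm (u y) powr p \<partial>M)"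
      using i ip \<open>m > 0\<close> p by (intro integral_mono) (auto intro!: powr_tangent_le)
    also have "(\<integral>y. m powr p + p * m powr (p - 1) * (norm (u y) - m) \<partial>M) = m powr p"
      using i by (simp add: prob_space m_def)
    finally show ?thesis .
  qed simp
  moreover have "norm (\<integral>y. u y \<partial>M) powr p \<le> m powr p"
    using le p by (intro powr_mono2) auto
  ultimately have "norm (\<integral>y. u y \<partial>M) powr p \<le> (\<integral>y. norm (u y) powr p \<partial>M)" by linarith
  then show ?thesis
    using ip by (simp add: nn_integral_eq_integral ennreal_leI)
qed simp

text \<open>The p-th power of the L^p norm rather than the norm itself: it is additive under
  integration and commutes with Tonelli's theorem, and \<infinity> is an admissible value.\<close>

definition Ip :: "real \<Rightarrow> ('a::euclidean_space \<Rightarrow> 'b::euclidean_space) \<Rightarrow> ennreal" where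
  "Ip p u = (\<integral>\<^sup>+x. ennreal (norm (u x) powr p) \<partial>lborel)"

lemma Ip_add_le:
  fixes u v :: "'a::euclidean_space \<Rightarrow> 'b::euclidean_space"
  assumes p: "1 \<le> p" and l: "0 < l" "l < 1"
    and [measurable]: "u \<in> borel_measurable borel" "v \<in> borel_measurable borel"
  shows "Ip p (\<lambda>x. u x + v x) \<le> ennreal (l powr (1 - p)) * Ip p u + ennreal ((1 - l) powr (1 - p)) * Ip p v"
proof -
  have "Ip p (\<lambda>x. u x + v x) \<le> (\<integral>\<^sup>+x. ennreal (l powr (1 - p)) * ennreal (norm (u x) powr p) +
      ennreal ((1 - l) powr (1 - p)) * ennreal (norm (v x) powr p) \<partial>lborel)"
    unfolding Ip_def
    by (intro nn_integral_mono)
       (auto simp: ennreal_mult[symmetric] ennreal_plus[symmetric] simp del: ennreal_plus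
          intro!: ennreal_leI norm_add_powr_le[OF p l])
  also have "\<dots> = ennreal (l powr (1 - p)) * Ip p u + ennreal ((1 - l) powr (1 - p)) * Ip p v"
    unfolding Ip_def by (simp add: nn_integral_add nn_integral_cmult)
  finally show ?thesis .
qed

lemma Ip_add_le2:
  fixes u v :: "'a::euclidean_space \<Rightarrow> 'b::euclidean_space"
  assumes p: "1 \<le> p"
    and [measurable]: "u \<in> borel_measurable borel" "v \<in> borel_measurable borel"
  shows "Ip p (\<lambda>x. u x + v x) \<le> ennreal (2 powr p) * (Ip p u + Ip p v)"
proof -
  have "Ip p (\<lambda>x. u x + v x) \<le> (\<integral>\<^sup>+x. ennreal (2 powr p) * (ennreal (norm (u x) powr p) +
      ennreal (norm (v x) powr p)) \<partial>lborel)"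
    unfolding Ip_def
    by (intro nn_integral_mono)
       (auto simp: ennreal_mult[symmetric] ennreal_plus[symmetric] simp del: ennreal_plus
          intro!: ennreal_leI norm_add_powr_le2[OF p])
  also have "\<dots> = ennreal (2 powr p) * (Ip p u + Ip p v)"
    unfolding Ip_def by (simp add: nn_integral_add nn_integral_cmult)
  finally show ?thesis .
qed

lemma Ip_scaleR:
  fixes u :: "'a::euclidean_space \<Rightarrow> 'b::euclidean_space"
  assumes [measurable]: "u \<in> borel_measurable borel"
  shows "Ip p (\<lambda>x. c *\<^sub>R u x) = ennreal (\<bar>c\<bar> powr p) * Ip p u"
  unfolding Ip_def by (simp add: powr_mult ennreal_mult nn_integral_cmult)

lemma Ip_minus: "Ip p (\<lambda>x. - u x) = Ip p u"
  by (simp add: Ip_def)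

lemma Ip_minus_commute: "Ip p (\<lambda>x. u x - v x) = Ip p (\<lambda>x. v x - u x)"
  by (simp add: Ip_def norm_minus_commute)

section \<open>Translations and averages of translates\<close>

lemma nn_integral_translate:
  fixes g :: "'a::euclidean_space \<Rightarrow> ennreal"
  assumes "g \<in> borel_measurable borel"
  shows "(\<integral>\<^sup>+x. g (x + h) \<partial>lborel) = (\<integral>\<^sup>+x. g x \<partial>lborel)"
proof -
  have "(\<integral>\<^sup>+x. g x \<partial>lborel) = (\<integral>\<^sup>+x. g x \<partial>distr lborel borel ((+) h))"
    by (simp add: lborel_distr_plus)
  also have "\<dots> = (\<integral>\<^sup>+x. g (h + x) \<partial>lborel)"
    by (subst nn_integral_distr) (use assms in auto)
  finally show ?thesis by (simp add: add.commute)
qed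

lemma Ip_translate:
  assumes "u \<in> borel_measurable borel"
  shows "Ip p (\<lambda>x. u (x + h)) = Ip p u"
  unfolding Ip_def
  by (rule nn_integral_translate[of "\<lambda>x. ennreal (norm (u x) powr p)"]) (use assms in measurable)

text \<open>Jensen's inequality for each \<open>x\<close>, then Tonelli's theorem: Minkowski's
  integral inequality in p-th power form for a probability measure.\<close>

lemma Ip_integral_le:
  fixes F :: "'a::euclidean_space \<Rightarrow> 'c \<Rightarrow> 'b::euclidean_space"
  assumes p: "1 \<le> p" and M: "prob_space M"
    and [measurable]: "(\<lambda>(x, y). F x y) \<in> borel_measurable (borel \<Otimes>\<^sub>M M)"
  shows "Ip p (\<lambda>x. \<integral>y. F x y \<partial>M) \<le> (\<integral>\<^sup>+y. Ip p (\<lambda>x. F x y) \<partial>M)"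
proof -
  interpret prob_space M by fact
  interpret pair_sigma_finite lborel M ..
  have "Ip p (\<lambda>x. \<integral>y. F x y \<partial>M) \<le> (\<integral>\<^sup>+x. \<integral>\<^sup>+y. ennreal (norm (F x y) powr p) \<partial>M \<partial>lborel)"
    unfolding Ip_def by (intro nn_integral_mono norm_integral_powr_le p) measurable
  also have "\<dots> = (\<integral>\<^sup>+y. \<integral>\<^sup>+x. ennreal (norm (F x y) powr p) \<partial>lborel \<partial>M)"
    by (rule Fubini'[symmetric]) measurable
  finally show ?thesis by (simp add: Ip_def)
qed

text \<open>Mollifications, and increments of a C^1 function as averages of its derivative along a
  segment, both have this shape; hence neither can increase the energy.\<close>

lemma Ip_average_translate_le:
  fixes u :: "'a::euclidean_space \<Rightarrow> 'b::euclidean_space"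
  assumes p: "1 \<le> p" and M: "prob_space M"
    and [measurable]: "u \<in> borel_measurable borel" "\<theta> \<in> borel_measurable M"
  shows "Ip p (\<lambda>x. \<integral>y. u (x + \<theta> y) \<partial>M) \<le> Ip p u"
proof -
  interpret prob_space M by fact
  have "Ip p (\<lambda>x. \<integral>y. u (x + \<theta> y) \<partial>M) \<le> (\<integral>\<^sup>+y. Ip p (\<lambda>x. u (x + \<theta> y)) \<partial>M)"
    by (rule Ip_integral_le[OF p M]) measurable
  also have "\<dots> = Ip p u"
    by (simp add: Ip_translate emeasure_space_1)
  finally show ?thesis .
qed

text \<open>A substitute for Minkowski's inequality in the passage to the limit: let \<open>l\<close> tend to 1.\<close>

lemma powr_weight_tendsto:
  "((\<lambda>l::real. l powr (1 - p)) \<longlongrightarrow> 1) (at_left 1)"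
proof -
  have "((\<lambda>l::real. l powr (1 - p)) \<longlongrightarrow> 1 powr (1 - p)) (at_left 1)"
    by (intro tendsto_intros) auto
  then show ?thesis by simp
qed

lemma le_of_powr_weight_le:
  fixes a b :: ennreal
  assumes "\<And>l. 0 < l \<Longrightarrow> l < 1 \<Longrightarrow> a \<le> ennreal (l powr (1 - p)) * b"
  shows "a \<le> b"
proof -
  have *: "((\<lambda>l. ennreal (l powr (1 - p)) * b) \<longlongrightarrow> ennreal 1 * b) (at_left 1)"
    by (intro tendsto_intros powr_weight_tendsto) auto
  have "\<forall>\<^sub>F l in at_left (1::real). a \<le> ennreal (l powr (1 - p)) * b"
    using eventually_at_left_real[of 0 "1::real"] by (rule eventually_mono) (use assms in auto)
  from tendsto_lowerbound[OF * this] show ?thesis by simp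
qed

section \<open>Continuity of translations\<close>

definition Wp :: "real \<Rightarrow> ('a::euclidean_space \<Rightarrow> real) \<Rightarrow> 'a \<Rightarrow> ennreal" where
  "Wp p f h = Ip p (\<lambda>x. f (x + h) - f x)"

lemma Wp_le:
  assumes p: "1 \<le> p" and [measurable]: "f \<in> borel_measurable borel"
  shows "Wp p f h \<le> ennreal (2 powr p) * (2 * Ip p f)"
proof -
  have "Wp p f h = Ip p (\<lambda>x. f (x + h) + - f x)" by (simp add: Wp_def)
  also have "\<dots> \<le> ennreal (2 powr p) * (Ip p (\<lambda>x. f (x + h)) + Ip p (\<lambda>x. - f x))"
    by (rule Ip_add_le2[OF p]) measurable
  finally show ?thesis by (simp add: Ip_translate Ip_minus mult_2)
qed

lemma Wp_add_le2:
  assumes p: "1 \<le> p" and [measurable]: "f \<in> borel_measurable borel" "g \<in> borel_measurable borel"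
  shows "Wp p (\<lambda>x. f x + g x) h \<le> ennreal (2 powr p) * (Wp p f h + Wp p g h)"
proof -
  have "Wp p (\<lambda>x. f x + g x) h = Ip p (\<lambda>x. (f (x + h) - f x) + (g (x + h) - g x))"
    by (simp add: Wp_def algebra_simps)
  also have "\<dots> \<le> ennreal (2 powr p) * (Wp p f h + Wp p g h)"
    unfolding Wp_def by (rule Ip_add_le2[OF p]) measurable
  finally show ?thesis .
qed

text \<open>The approximation step used for indicators and for L^1 limits: \<open>g\<close> is the
  error of an approximant \<open>f\<close> whose translations are already controlled. The estimate
  yields 16 c; the callers take c = e / 32.\<close>

lemma Wp_1_add_small:
  fixes c :: ennreal
  assumes "f \<in> borel_measurable borel" "g \<in> borel_measurable borel"
    and "Wp 1 f h \<le> 4 * c" "Ip 1 g \<le> c"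
  shows "Wp 1 (\<lambda>x. f x + g x) h \<le> 32 * c"
proof -
  have "Wp 1 (\<lambda>x. f x + g x) h \<le> ennreal (2 powr 1) * (Wp 1 f h + Wp 1 g h)"
    using assms by (intro Wp_add_le2) auto
  also have "\<dots> \<le> ennreal (2 powr 1) * (4 * c + ennreal (2 powr 1) * (2 * c))"
    using assms by (intro mult_mono add_mono order_trans[OF Wp_le[of 1 g]]) auto
  also have "\<dots> = 16 * c"
    by (simp add: distrib_left mult.assoc[symmetric] flip: distrib_right)
  also have "\<dots> \<le> 32 * c" by (intro mult_right_mono) auto
  finally show ?thesis .
qed

lemma tendsto_0_ennrealI:
  fixes f :: "'a \<Rightarrow> ennreal"
  assumes "\<And>e. e > 0 \<Longrightarrow> \<forall>\<^sub>F x in F. f x \<le> ennreal e"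
  shows "(f \<longlongrightarrow> 0) F"
proof (rule order_tendstoI)
  fix a :: ennreal assume "0 < a"
  then obtain r where r: "0 < ennreal r" "ennreal r < a"
    using dense[of 0 a] by (metis less_top_ennreal order.strict_trans top.not_eq_extremum ennreal_cases less_irrefl order_less_imp_le not_le top_greatest)
  then have "r > 0" by (simp add: ennreal_less_zero_iff)
  from assms[OF this] show "\<forall>\<^sub>F x in F. f x < a"
    by eventually_elim (use r in auto)
qed simp

lemma tendsto_0_ennreal_le:
  fixes f g :: "'a \<Rightarrow> ennreal"
  assumes "\<And>x. f x \<le> g x" "(g \<longlongrightarrow> 0) F"
  shows "(f \<longlongrightarrow> 0) F"
  by (rule tendsto_sandwich[OF _ _ tendsto_const assms(2)]) (use assms(1) in auto)

lemma tendsto_0_ennrealD: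
  fixes f :: "'a \<Rightarrow> ennreal"
  assumes "(f \<longlongrightarrow> 0) F" "e > 0"
  shows "\<forall>\<^sub>F x in F. f x \<le> ennreal e"
proof -
  have "\<forall>\<^sub>F x in F. f x < ennreal e"
    using assms by (intro order_tendstoD(2)) auto
  then show ?thesis by eventually_elim auto
qed

section \<open>Continuity of translations in L^1\<close>

lemma translate_open_set_tendsto:
  fixes T :: "'a::euclidean_space set"
  assumes "open T" and fin: "emeasure lborel T < \<infinity>" and X: "X \<longlonglongrightarrow> 0"
  shows "(\<lambda>k. \<integral>\<^sup>+x. (if x \<in> T \<and> x + X k \<notin> T then 1 else 0) \<partial>lborel) \<longlonglongrightarrow> 0"
proof -
  have [measurable]: "T \<in> sets borel" using assms by simp
  have "(\<lambda>k. \<integral>\<^sup>+x. (if x \<in> T \<and> x + X k \<notin> T then 1 else 0) \<partial>lborel) \<longlonglongrightarrow> (\<integral>\<^sup>+x. 0 \<partial>(lborel :: 'a measure))"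
  proof (rule nn_integral_dominated_convergence[where w="indicator T"])
    show "AE x in lborel. (\<lambda>k. if x \<in> T \<and> x + X k \<notin> T then 1 else 0) \<longlonglongrightarrow> (0::ennreal)"
    proof (rule AE_I2)
      fix x
      have "\<forall>\<^sub>F k in sequentially. x \<in> T \<longrightarrow> x + X k \<in> T"
      proof (cases "x \<in> T")
        case True
        have "(\<lambda>k. x + X k) \<longlonglongrightarrow> x" using tendsto_add[OF tendsto_const X, of x] by simp
        from topological_tendstoD[OF this \<open>open T\<close> True] show ?thesis by eventually_elim auto
      qed auto
      then have "\<forall>\<^sub>F k in sequentially. (if x \<in> T \<and> x + X k \<notin> T then 1 else 0) = (0::ennreal)"
        by eventually_elim auto
      then show "(\<lambda>k. if x \<in> T \<and> x + X k \<notin> T then 1 else 0) \<longlonglongrightarrow> (0::ennreal)"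
        by (rule tendsto_eventually)
    qed
    show "(\<integral>\<^sup>+x. indicator T x \<partial>lborel) < \<infinity>" using fin by simp
  qed (auto simp: indicator_def)
  then show ?thesis by simp
qed

text \<open>The increment of the indicator counts the points that leave \<open>T\<close> under
  \<open>h\<close> and, seen from x + h, those that leave \<open>T\<close> under -h. For open
  \<open>T\<close> a point stays inside under small translations, so dominated convergence treats
  both terms.\<close>

lemma Wp_1_open_tendsto:
  fixes T :: "'a::euclidean_space set"
  assumes "open T" and fin: "emeasure lborel T < \<infinity>" and X: "X \<longlonglongrightarrow> 0"
  shows "(\<lambda>k. Wp 1 (indicator T) (X k)) \<longlonglongrightarrow> 0"
proof -
  have [measurable]: "T \<in> sets borel" using assms by simp
  let ?S = "\<lambda>h. \<integral>\<^sup>+x. (if x \<in> T \<and> x + h \<notin> T then 1 else 0) \<partial>lborel"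
  have eq: "Wp 1 (indicator T) h = ?S h + ?S (- h)" for h
  proof -
    have "Wp 1 (indicator T) h = (\<integral>\<^sup>+x. (if x \<in> T \<and> x + h \<notin> T then 1 else 0) +
        (if x + h \<in> T \<and> x + h + (- h) \<notin> T then 1 else 0) \<partial>lborel)"
      unfolding Wp_def Ip_def by (intro nn_integral_cong) (auto simp: indicator_def)
    also have "\<dots> = ?S h + (\<integral>\<^sup>+x. (if x + h \<in> T \<and> x + h + (- h) \<notin> T then 1 else 0) \<partial>lborel)"
      by (rule nn_integral_add) auto
    also have "(\<integral>\<^sup>+x. (if x + h \<in> T \<and> x + h + (- h) \<notin> T then 1 else 0) \<partial>lborel) = ?S (- h)"
      by (rule nn_integral_translate[of "\<lambda>x. if x \<in> T \<and> x + (- h) \<notin> T then 1 else 0"]) measurable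
    finally show ?thesis .
  qed
  have "(\<lambda>k. ?S (X k) + ?S (- X k)) \<longlonglongrightarrow> 0 + 0"
    using tendsto_minus[OF X] by (intro tendsto_add translate_open_set_tendsto assms) auto
  then show ?thesis unfolding eq by simp
qed

text \<open>Outer regularity replaces \<open>A\<close> by an open superset at an L^1 cost below e /
  32.\<close>

lemma Wp_1_indicator_tendsto:
  fixes A :: "'a::euclidean_space set"
  assumes A[measurable]: "A \<in> sets borel" and fin: "emeasure lborel A < \<infinity>" and X: "X \<longlonglongrightarrow> 0"
  shows "(\<lambda>k. Wp 1 (indicator A) (X k)) \<longlonglongrightarrow> 0"
proof (rule tendsto_0_ennrealI)
  fix e :: real assume "e > 0"
  obtain T where T: "open T" "A \<subseteq> T" "emeasure lebesgue (T - A) < ennreal (e / 32)"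
    using sets_lebesgue_outer_open[of A "e / 32"] A \<open>e > 0\<close> by auto
  have [measurable]: "T \<in> sets borel" using T by simp
  have TA: "emeasure lborel (T - A) < ennreal (e / 32)"
    using T(3) by (simp add: emeasure_completion)
  have "emeasure lborel T \<le> emeasure lborel A + emeasure lborel (T - A)"
    using emeasure_subadditive[of A lborel "T - A"] T(2) by (simp add: Un_absorb1)
  also have "\<dots> < \<infinity>" using fin TA by (auto simp: top.not_eq_extremum[symmetric])
  finally have Tfin: "emeasure lborel T < \<infinity>" .
  have e32: "32 * ennreal (e / 32) = ennreal e" "4 * ennreal (e / 32) = ennreal (e / 8)"
      using ennreal_mult'[of 32 "e / 32"] ennreal_mult'[of 4 "e / 32"] by simp_all
  have "\<forall>\<^sub>F k in sequentially. Wp 1 (indicator T) (X k) \<le> 4 * ennreal (e / 32)"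
    using tendsto_0_ennrealD[OF Wp_1_open_tendsto[OF T(1) Tfin X], of "e / 8"] \<open>e > 0\<close> by (simp add: e32)
  then show "\<forall>\<^sub>F k in sequentially. Wp 1 (indicator A) (X k) \<le> ennreal e"
  proof eventually_elim
    case (elim k)
    let ?d = "\<lambda>x. - indicator (T - A) x :: real"
    have Id: "Ip 1 ?d \<le> ennreal (e / 32)"
    proof -
      have "Ip 1 ?d = (\<integral>\<^sup>+x. indicator (T - A) x \<partial>lborel)"
        unfolding Ip_def by (intro nn_integral_cong) (auto simp: indicator_def)
      also have "\<dots> = emeasure lborel (T - A)" by simp
      finally show ?thesis using TA by simp
    qed
    have "(indicator A :: 'a \<Rightarrow> real) = (\<lambda>x. indicator T x + ?d x)"
      using T(2) by (auto simp: indicator_def fun_eq_iff)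
    then have "Wp 1 (indicator A) (X k) \<le> 32 * ennreal (e / 32)"
      using Wp_1_add_small[of "indicator T" ?d "X k" "ennreal (e / 32)"] Id elim by simp
    then show ?case by (simp add: e32)
  qed
qed

lemma Wp_1_tendsto:
  fixes g :: "'a::euclidean_space \<Rightarrow> real"
  assumes "integrable lborel g" and X: "X \<longlonglongrightarrow> 0"
  shows "(\<lambda>k. Wp 1 g (X k)) \<longlonglongrightarrow> 0"
  using assms(1)
proof (induction rule: integrable_induct)
  case (base A c)
  have [measurable]: "A \<in> sets borel" using base by simp
  have "Wp 1 (\<lambda>x. indicator A x *\<^sub>R c) h = ennreal \<bar>c\<bar> * Wp 1 (indicator A) h" for h
  proof -
    have "Wp 1 (\<lambda>x. indicator A x *\<^sub>R c) h = Ip 1 (\<lambda>x. c *\<^sub>R (indicat_real A (x + h) - indicat_real A x))"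
      unfolding Wp_def by (rule arg_cong[where f="Ip 1"]) (auto simp: algebra_simps)
    then show ?thesis by (subst (asm) Ip_scaleR) (auto simp: Wp_def)
  qed
  moreover have "(\<lambda>k. ennreal \<bar>c\<bar> * Wp 1 (indicator A) (X k)) \<longlonglongrightarrow> ennreal \<bar>c\<bar> * 0"
    using Wp_1_indicator_tendsto[of A X] base X by (intro ennreal_tendsto_cmult) auto
  ultimately show ?case by simp
next
  case (add f g)
  have [measurable]: "f \<in> borel_measurable borel" "g \<in> borel_measurable borel"
    using add by auto
  have "(\<lambda>k. ennreal (2 powr 1) * (Wp 1 f (X k) + Wp 1 g (X k))) \<longlonglongrightarrow> ennreal (2 powr 1) * (0 + 0)"
    by (intro ennreal_tendsto_cmult tendsto_add add) auto
  then have "(\<lambda>k. ennreal (2 powr 1) * (Wp 1 f (X k) + Wp 1 g (X k))) \<longlonglongrightarrow> 0" by simp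
  then show ?case
    by (rule tendsto_0_ennreal_le[rotated]) (use Wp_add_le2[of 1 f g] in auto)
next
  case (lim f s)
  have [measurable]: "f \<in> borel_measurable borel" "\<And>i. s i \<in> borel_measurable borel"
    using lim by auto
  have "(\<lambda>i. \<integral>\<^sup>+x. ennreal (norm (f x - s i x)) \<partial>lborel) \<longlonglongrightarrow> (\<integral>\<^sup>+x. 0 \<partial>(lborel :: 'a measure))"
  \<comment> \<open>The induction rule bounds the approximants by twice |f|, so 3 |f| dominates the
    error.\<close>
  proof (rule nn_integral_dominated_convergence[where w="\<lambda>x. ennreal (3 * norm (f x))"])
    show "(\<integral>\<^sup>+x. ennreal (3 * norm (f x)) \<partial>lborel) < \<infinity>"
      using lim(4) by (subst nn_integral_eq_integral) auto
    show "AE x in lborel. (\<lambda>i. ennreal (norm (f x - s i x))) \<longlonglongrightarrow> 0"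
    proof (rule AE_I2)
      fix x
      have "(\<lambda>i. norm (f x - s i x)) \<longlonglongrightarrow> norm (f x - f x)"
        using lim(2)[of x] by (intro tendsto_intros) auto
      then show "(\<lambda>i. ennreal (norm (f x - s i x))) \<longlonglongrightarrow> 0"
        using tendsto_ennrealI[of _ 0] by fastforce
    qed
    show "AE x in lborel. ennreal (norm (f x - s i x)) \<le> ennreal (3 * norm (f x))" for i
    proof (intro AE_I2 ennreal_leI)
      fix x show "norm (f x - s i x) \<le> 3 * norm (f x)"
        using lim(3)[of x i] norm_triangle_ineq4[of "f x" "s i x"] by simp
    qed
  qed auto
  then have I0: "(\<lambda>i. Ip 1 (\<lambda>x. f x - s i x)) \<longlonglongrightarrow> 0"
    by (simp add: Ip_def)
  show ?case
  proof (rule tendsto_0_ennrealI)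
    fix e :: real assume "e > 0"
    obtain i where i: "Ip 1 (\<lambda>x. f x - s i x) \<le> ennreal (e / 32)"
      using tendsto_0_ennrealD[OF I0, of "e / 32"] \<open>e > 0\<close> by (auto simp: eventually_sequentially)
    have e32: "32 * ennreal (e / 32) = ennreal e" "4 * ennreal (e / 32) = ennreal (e / 8)"
      using ennreal_mult'[of 32 "e / 32"] ennreal_mult'[of 4 "e / 32"] by simp_all
    have "\<forall>\<^sub>F k in sequentially. Wp 1 (s i) (X k) \<le> 4 * ennreal (e / 32)"
      using tendsto_0_ennrealD[OF lim(5), of "e / 8"] \<open>e > 0\<close> by (simp add: e32)
    then show "\<forall>\<^sub>F k in sequentially. Wp 1 f (X k) \<le> ennreal e"
    proof eventually_elim
      case (elim k)
      have "Wp 1 f (X k) \<le> 32 * ennreal (e / 32)"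
        using Wp_1_add_small[of "s i" "\<lambda>x. f x - s i x" "X k" "ennreal (e / 32)"] i elim by simp
      then show ?case by (simp add: e32)
    qed
  qed
qed

text \<open>The inverse of the signed power is Hoelder continuous of exponent 1/p. For equal signs
  this is superadditivity of the p-th power, without the factor; for opposite signs the two powers
  add up on the right and convexity costs 2^p.\<close>

lemma abs_diff_powr_le_signed:
  fixes a b p :: real
  assumes p: "1 \<le> p"
  shows "\<bar>a - b\<bar> powr p \<le> 2 powr p * \<bar>sgn a * \<bar>a\<bar> powr p - sgn b * \<bar>b\<bar> powr p\<bar>"
proof -
  have one: "(1::real) \<le> 2 powr p" using p by (simp add: ge_one_powr_ge_zero)
  \<comment> \<open>Divided by (x + y)^p this is s^p \<le> s on the unit interval, applied to the
    two fractions of the sum.\<close>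
  have super: "x powr p + y powr p \<le> (x + y) powr p" if "x \<ge> 0" "y \<ge> 0" for x y :: real
  proof (cases "x + y = 0")
    case False
    then have pos: "x + y > 0" using that by simp
    have t: "s powr p \<le> s" if "0 \<le> s" "s \<le> 1" for s :: real
      using powr_mono'[of 1 p s] that p by simp
    have "(x / (x + y)) powr p + (y / (x + y)) powr p \<le> x / (x + y) + y / (x + y)"
      using that pos by (intro add_mono t) auto
    also have "\<dots> = 1" using pos by (simp add: add_divide_distrib[symmetric])
    finally have "(x powr p + y powr p) / (x + y) powr p \<le> 1"
      using that pos by (simp add: powr_divide add_divide_distrib)
    then show ?thesis using pos by simp
  next
    case True
    then have "x = 0" "y = 0" using that by auto
    then show ?thesis by simp
  qed
  have same: "\<bar>x - y\<bar> powr p \<le> \<bar>x powr p - y powr p\<bar>" if "x \<ge> 0" "y \<ge> 0" for x y :: real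
  proof (cases "x \<le> y")
    case True
    then show ?thesis using super[of x "y - x"] that by simp
  next
    case False
    then show ?thesis using super[of y "x - y"] that by simp
  qed
  have same': "\<bar>x - y\<bar> powr p \<le> 2 powr p * \<bar>x powr p - y powr p\<bar>" if "x \<ge> 0" "y \<ge> 0" for x y :: real
    using same[OF that] mult_right_mono[OF one, of "\<bar>x powr p - y powr p\<bar>"] by simp
  have opp: "(x + y) powr p \<le> 2 powr p * (x powr p + y powr p)" if "x \<ge> 0" "y \<ge> 0" for x y :: real
    using norm_add_powr_le2[OF p, of x y] that by simp
  consider "a \<ge> 0" "b \<ge> 0" | "a < 0" "b < 0" | "a \<ge> 0" "b < 0" | "a < 0" "b \<ge> 0" by linarith
  then show ?thesis
  proof cases
    case 1
    then have "sgn a * \<bar>a\<bar> powr p = a powr p" "sgn b * \<bar>b\<bar> powr p = b powr p" by (auto simp: sgn_if)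
    then show ?thesis using same'[OF 1] by simp
  next
    case 2
    then show ?thesis using same'[of "-a" "-b"] by (simp add: abs_minus_commute)
  next
    case 3
    then have "sgn a * \<bar>a\<bar> powr p = a powr p" "sgn b * \<bar>b\<bar> powr p = - ((-b) powr p)"
      by (auto simp: sgn_if)
    moreover have "\<bar>a - b\<bar> = a + - b" using 3 by simp
    ultimately show ?thesis using opp[of a "-b"] 3 by (simp only:) simp
  next
    case 4
    then have e: "sgn b * \<bar>b\<bar> powr p = b powr p" "sgn a * \<bar>a\<bar> powr p = - ((-a) powr p)"
      by (auto simp: sgn_if)
    have "\<bar>sgn a * \<bar>a\<bar> powr p - sgn b * \<bar>b\<bar> powr p\<bar> = (-a) powr p + b powr p"
      unfolding e using powr_ge_zero[of "-a" p] powr_ge_zero[of b p] by linarith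
    moreover have "\<bar>a - b\<bar> = - a + b" using 4 by simp
    moreover have "(- a + b) powr p \<le> 2 powr p * ((- a) powr p + b powr p)"
      using 4 by (intro opp) auto
    ultimately show ?thesis by (simp only:)
  qed
qed

text \<open>Continuity of translations in \<open>L\<^sup>p\<close> follows from the case \<open>p = 1\<close>, applied to \<open>sgn f * \<bar>f\<bar> powr p\<close>.\<close>

lemma Wp_tendsto_0:
  fixes f :: "'a::euclidean_space \<Rightarrow> real"
  assumes p: "1 \<le> p" and f[measurable]: "f \<in> borel_measurable borel" and fin: "Ip p f < \<infinity>" and X: "X \<longlonglongrightarrow> 0"
  shows "(\<lambda>k. Wp p f (X k)) \<longlonglongrightarrow> 0"
proof -
  define g where "g x = sgn (f x) * \<bar>f x\<bar> powr p" for x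
  have [measurable]: "g \<in> borel_measurable borel" unfolding g_def by measurable
  have ng: "norm (g x) = norm (f x) powr p" for x
    by (auto simp: g_def abs_mult abs_sgn_eq)
  have "integrable lborel g"
    using fin by (intro integrableI_bounded) (auto simp only: ng Ip_def, measurable)
  note tg = Wp_1_tendsto[OF this X]
  have le: "Wp p f h \<le> ennreal (2 powr p) * Wp 1 g h" for h
  proof -
    have "Wp p f h \<le> (\<integral>\<^sup>+x. ennreal (2 powr p) * ennreal (norm (g (x + h) - g x) powr 1) \<partial>lborel)"
      unfolding Wp_def Ip_def
      by (intro nn_integral_mono)
         (auto simp: ennreal_mult[symmetric] g_def intro!: ennreal_leI abs_diff_powr_le_signed[OF p])
    also have "\<dots> = ennreal (2 powr p) * Wp 1 g h"
      unfolding Wp_def Ip_def by (rule nn_integral_cmult) measurable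
    finally show ?thesis .
  qed
  have "(\<lambda>k. ennreal (2 powr p) * Wp 1 g (X k)) \<longlonglongrightarrow> ennreal (2 powr p) * 0"
    by (intro ennreal_tendsto_cmult tg) auto
  then have "(\<lambda>k. ennreal (2 powr p) * Wp 1 g (X k)) \<longlonglongrightarrow> 0" by simp
  then show ?thesis
    by (rule tendsto_0_ennreal_le[rotated]) (use le in auto)
qed

section \<open>The limit of the rescaled heat energy\<close>

text \<open>Closes every limit argument based on the weighted inequality: for fixed \<open>l\<close>
  the error term vanishes along the filter, and then \<open>l\<close> tends to 1. The constant
  \<open>c\<close> may depend on \<open>l\<close>, as (1-l)^(1-p) blows up for p > 1.
  \<open>frequently\<close> is what the negation of an eventual inequality supplies.\<close>

lemma le_of_frequently_weight:
  fixes A y :: ennreal and b :: "'a \<Rightarrow> ennreal"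
  assumes b: "(b \<longlongrightarrow> 0) F"
    and fr: "\<And>l. 0 < l \<Longrightarrow> l < 1 \<Longrightarrow>
      \<exists>c. \<exists>\<^sub>F k in F. A \<le> ennreal (l powr (1 - p)) * y + ennreal c * b k"
  shows "A \<le> y"
proof (rule le_of_powr_weight_le[where p=p])
  fix l :: real assume l: "0 < l" "l < 1"
  obtain c where c: "\<exists>\<^sub>F k in F. A \<le> ennreal (l powr (1 - p)) * y + ennreal c * b k"
    using fr[OF l] by blast
  have lim: "((\<lambda>k. ennreal (l powr (1 - p)) * y + ennreal c * b k) \<longlongrightarrow> ennreal (l powr (1 - p)) * y + ennreal c * 0) F"
    by (intro tendsto_add tendsto_const ennreal_tendsto_cmult b) auto
  show "A \<le> ennreal (l powr (1 - p)) * y"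
  proof (rule ccontr)
    assume "\<not> A \<le> ennreal (l powr (1 - p)) * y"
    then have "\<forall>\<^sub>F k in F. ennreal (l powr (1 - p)) * y + ennreal c * b k < A"
      by (intro order_tendstoD(2)[OF lim]) auto
    then have "\<forall>\<^sub>F k in F. \<not> A \<le> ennreal (l powr (1 - p)) * y + ennreal c * b k"
      by eventually_elim auto
    with c show False by (simp add: frequently_def)
  qed
qed

text \<open>Continuity of the norm without a reverse triangle inequality: the weighted inequality is
  applied to v = u + (v - u) and to u = v + (u - v).\<close>

lemma Ip_tendsto:
  fixes u :: "'a::euclidean_space \<Rightarrow> 'b::euclidean_space"
  assumes p: "1 \<le> p" and [measurable]: "u \<in> borel_measurable borel" "\<And>k. v k \<in> borel_measurable borel"
    and lim: "((\<lambda>k. Ip p (\<lambda>x. v k x - u x)) \<longlongrightarrow> 0) F"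
  shows "((\<lambda>k. Ip p (v k)) \<longlongrightarrow> Ip p u) F"
proof (rule order_tendstoI)
  have up: "Ip p (v k) \<le> ennreal (l powr (1 - p)) * Ip p u + ennreal ((1 - l) powr (1 - p)) * Ip p (\<lambda>x. v k x - u x)"
    if "0 < l" "l < 1" for l k
    using Ip_add_le[OF p that, of u "\<lambda>x. v k x - u x"] by simp
  have lo: "Ip p u \<le> ennreal (l powr (1 - p)) * Ip p (v k) + ennreal ((1 - l) powr (1 - p)) * Ip p (\<lambda>x. v k x - u x)"
    if "0 < l" "l < 1" for l k
    using Ip_add_le[OF p that, of "v k" "\<lambda>x. u x - v k x"] by (simp add: Ip_minus_commute[of p u])
  fix a :: ennreal
  show "\<forall>\<^sub>F k in F. Ip p (v k) < a" if a: "Ip p u < a"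
  proof (rule ccontr)
    assume "\<not> ?thesis"
    then have fr: "\<exists>\<^sub>F k in F. a \<le> Ip p (v k)" by (simp add: not_eventually not_less)
    have "a \<le> Ip p u"
    proof (rule le_of_frequently_weight[OF lim])
      fix l :: real assume l: "0 < l" "l < 1"
      have "\<exists>\<^sub>F k in F. a \<le> ennreal (l powr (1 - p)) * Ip p u + ennreal ((1 - l) powr (1 - p)) * Ip p (\<lambda>x. v k x - u x)"
        using fr by (rule frequently_elim1) (use up[OF l] order_trans in blast)
      then show "\<exists>c. \<exists>\<^sub>F k in F. a \<le> ennreal (l powr (1 - p)) * Ip p u + ennreal c * Ip p (\<lambda>x. v k x - u x)"
        by blast
    qed
    with a show False by simp
  qed
  show "\<forall>\<^sub>F k in F. a < Ip p (v k)" if a: "a < Ip p u"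
  proof (rule ccontr)
    assume "\<not> ?thesis"
    then have fr: "\<exists>\<^sub>F k in F. Ip p (v k) \<le> a" by (simp add: not_eventually not_less)
    have "Ip p u \<le> a"
    proof (rule le_of_frequently_weight[OF lim])
      fix l :: real assume l: "0 < l" "l < 1"
      have "\<exists>\<^sub>F k in F. Ip p u \<le> ennreal (l powr (1 - p)) * a + ennreal ((1 - l) powr (1 - p)) * Ip p (\<lambda>x. v k x - u x)"
        using fr
      proof (rule frequently_elim1)
        fix k assume "Ip p (v k) \<le> a"
        then show "Ip p u \<le> ennreal (l powr (1 - p)) * a + ennreal ((1 - l) powr (1 - p)) * Ip p (\<lambda>x. v k x - u x)"
          by (intro order_trans[OF lo[OF l, of k]] add_right_mono mult_left_mono) auto
      qed
      then show "\<exists>c. \<exists>\<^sub>F k in F. Ip p u \<le> ennreal (l powr (1 - p)) * a + ennreal c * Ip p (\<lambda>x. v k x - u x)"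
        by blast
    qed
    with a show False by simp
  qed
qed

lemma Wp_add_le:
  assumes p: "1 \<le> p" and l: "0 < l" "l < 1" and [measurable]: "f \<in> borel_measurable borel"
  shows "Wp p f (h + k) \<le> ennreal (l powr (1 - p)) * Wp p f h + ennreal ((1 - l) powr (1 - p)) * Wp p f k"
proof -
  have "Wp p f (h + k) = Ip p (\<lambda>x. (f (x + k + h) - f (x + k)) + (f (x + k) - f x))"
    by (simp add: Wp_def algebra_simps)
  also have "\<dots> \<le> ennreal (l powr (1 - p)) * Ip p (\<lambda>x. f (x + k + h) - f (x + k)) +
      ennreal ((1 - l) powr (1 - p)) * Wp p f k"
    unfolding Wp_def by (intro Ip_add_le[OF p l]) measurable
  also have "Ip p (\<lambda>x. f (x + k + h) - f (x + k)) = Wp p f h"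
    unfolding Wp_def by (rule Ip_translate[of "\<lambda>x. f (x + h) - f x"]) measurable
  finally show ?thesis .
qed

lemma Wp_0 [simp]: "Wp p f 0 = 0"
  by (simp add: Wp_def Ip_def)

text \<open>Induction on the number of steps. With l = m / (m + 1) the weighted inequality loses
  nothing: m (m+1)^(p-1) + (m+1)^(p-1) = (m+1)^p.\<close>

lemma Wp_of_nat_scaleR_le:
  assumes p: "1 \<le> p" and f: "f \<in> borel_measurable borel"
  shows "Wp p f (real m *\<^sub>R h) \<le> ennreal (real m powr p) * Wp p f h"
proof (induction m)
  case (Suc m)
  show ?case
  proof (cases "m = 0")
    case False
    define l where "l = real m / real (Suc m)"
    have l: "0 < l" "l < 1" "1 - l = 1 / real (Suc m)" using False by (auto simp: l_def field_simps)
    have "Wp p f (real (Suc m) *\<^sub>R h) = Wp p f (real m *\<^sub>R h + h)"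
      by (simp add: algebra_simps)
    also have "\<dots> \<le> ennreal (l powr (1 - p)) * Wp p f (real m *\<^sub>R h) + ennreal ((1 - l) powr (1 - p)) * Wp p f h"
      by (rule Wp_add_le[OF p l(1,2) f])
    also have "\<dots> \<le> ennreal (l powr (1 - p)) * (ennreal (real m powr p) * Wp p f h) + ennreal ((1 - l) powr (1 - p)) * Wp p f h"
      by (intro add_right_mono mult_left_mono Suc) auto
    also have "\<dots> = ennreal (l powr (1 - p) * real m powr p + (1 - l) powr (1 - p)) * Wp p f h"
      by (simp add: ennreal_mult mult.assoc distrib_right)
    also have "l powr (1 - p) * real m powr p + (1 - l) powr (1 - p) = real (Suc m) powr p"
    proof -
      have "l powr (1 - p) * real m powr p = real m * real (Suc m) powr (p - 1)"
        using False by (simp add: l_def powr_divide powr_diff field_simps del: of_nat_Suc)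
      moreover have "(1 - l) powr (1 - p) = real (Suc m) powr (p - 1)"
        unfolding l(3) by (simp add: powr_divide powr_diff field_simps del: of_nat_Suc)
      moreover have "real m * real (Suc m) powr (p - 1) + real (Suc m) powr (p - 1) = real (Suc m) powr p"
      proof -
        have "real m * real (Suc m) powr (p - 1) + real (Suc m) powr (p - 1) = real (Suc m) * real (Suc m) powr (p - 1)"
          by (simp add: algebra_simps)
        also have "\<dots> = real (Suc m) powr p"
          by (simp add: powr_diff del: of_nat_Suc)
        finally show ?thesis .
      qed
      ultimately show ?thesis by simp
    qed
    finally show ?thesis .
  qed simp
qed simp

text \<open>Defined as a supremum over all scales, although it is used as the limit at scale 0:
  upper bounds and lower semicontinuity are then immediate, and it makes sense before any limit is
  known to exist.\<close>

definition Lsup :: "real \<Rightarrow> ('a::euclidean_space \<Rightarrow> real) \<Rightarrow> 'a \<Rightarrow> ennreal" where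
  "Lsup p f z = (SUP s\<in>{0<..}. ennreal (s powr - p) * Wp p f (s *\<^sub>R z))"

lemma Lsup_upper: "0 < s \<Longrightarrow> ennreal (s powr - p) * Wp p f (s *\<^sub>R z) \<le> Lsup p f z"
  unfolding Lsup_def by (rule SUP_upper) simp

text \<open>A Fekete-type argument: \<open>s\<^sub>0\<close> is a multiple of the small number \<open>t\<close> up to an error below \<open>t\<close>.\<close>

lemma Wp_quotient_tendsto:
  assumes p: "1 \<le> p" and f[measurable]: "f \<in> borel_measurable borel" and fin: "Ip p f < \<infinity>"
    and t: "t \<longlonglongrightarrow> 0" "\<And>k. 0 < t k"
  shows "(\<lambda>k::nat. ennreal (t k powr - p) * Wp p f (t k *\<^sub>R z)) \<longlonglongrightarrow> Lsup p f z"
proof (rule order_tendstoI)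
  fix a assume "Lsup p f z < a"
  then have "ennreal (t k powr - p) * Wp p f (t k *\<^sub>R z) < a" for k
    using Lsup_upper[OF t(2)[of k], of p f z] by order
  then show "\<forall>\<^sub>F k in sequentially. ennreal (t k powr - p) * Wp p f (t k *\<^sub>R z) < a"
    by simp
next
  fix a assume "a < Lsup p f z"
  then obtain s where s: "0 < s" and a: "a < ennreal (s powr - p) * Wp p f (s *\<^sub>R z)"
    unfolding Lsup_def less_SUP_iff by auto
  define m where "m k = nat \<lfloor>s / t k\<rfloor>" for k
  define r where "r k = s - real (m k) * t k" for k
  have m: "real (m k) * t k \<le> s" "s < (real (m k) + 1) * t k" for k
  proof -
    have "real (m k) = of_int \<lfloor>s / t k\<rfloor>" using s t(2)[of k] by (simp add: m_def)
    then have "real (m k) \<le> s / t k" "s / t k < real (m k) + 1" by linarith+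
    then show "real (m k) * t k \<le> s" "s < (real (m k) + 1) * t k"
      using t(2)[of k] by (auto simp: field_simps)
  qed
  have r: "0 \<le> r k" "r k \<le> t k" for k
    using m[of k] by (auto simp: r_def algebra_simps)
  have "r \<longlonglongrightarrow> 0"
    by (rule tendsto_sandwich[OF _ _ tendsto_const t(1)]) (use r in auto)
  then have "(\<lambda>k. r k *\<^sub>R z) \<longlonglongrightarrow> 0 *\<^sub>R z" by (intro tendsto_intros)
  then have Wr: "(\<lambda>k. Wp p f (r k *\<^sub>R z)) \<longlonglongrightarrow> 0"
    by (intro Wp_tendsto_0[OF p f fin]) simp
  show "\<forall>\<^sub>F k in sequentially. a < ennreal (t k powr - p) * Wp p f (t k *\<^sub>R z)"
  proof (rule ccontr)
    assume "\<not> ?thesis"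
    then have fr: "\<exists>\<^sub>F k in sequentially. ennreal (t k powr - p) * Wp p f (t k *\<^sub>R z) \<le> a"
      by (simp add: not_eventually not_less)
    have "ennreal (s powr - p) * Wp p f (s *\<^sub>R z) \<le> a"
    proof (rule le_of_frequently_weight[OF Wr])
      fix l :: real assume l: "0 < l" "l < 1"
      let ?c = "s powr - p * (1 - l) powr (1 - p)"
      have "\<exists>\<^sub>F k in sequentially. ennreal (s powr - p) * Wp p f (s *\<^sub>R z) \<le>
          ennreal (l powr (1 - p)) * a + ennreal ?c * Wp p f (r k *\<^sub>R z)"
        using fr
      proof (rule frequently_elim1)
        fix k assume k: "ennreal (t k powr - p) * Wp p f (t k *\<^sub>R z) \<le> a"
        \<comment> \<open>Raised to the power p, \<open>m k * t k \<le> s\<close> trades m^p / s^p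
          for t^(-p), which leaves the quotient at scale \<open>t k\<close>.\<close>
        have "s powr - p * real (m k) powr p \<le> t k powr - p"
        proof -
          have "real (m k) powr p * t k powr p \<le> s powr p"
            using m(1)[of k] t(2)[of k] p by (simp add: powr_mult[symmetric] powr_mono2)
          then show ?thesis
            using s t(2)[of k] by (simp add: powr_minus field_simps)
        qed
        then have mk: "ennreal (s powr - p * real (m k) powr p) * Wp p f (t k *\<^sub>R z) \<le> a"
          by (intro order_trans[OF mult_right_mono k] ennreal_leI) auto
        have "Wp p f (s *\<^sub>R z) = Wp p f (real (m k) *\<^sub>R (t k *\<^sub>R z) + r k *\<^sub>R z)"
          by (simp add: r_def algebra_simps)
        also have "\<dots> \<le> ennreal (l powr (1 - p)) * Wp p f (real (m k) *\<^sub>R (t k *\<^sub>R z)) +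
            ennreal ((1 - l) powr (1 - p)) * Wp p f (r k *\<^sub>R z)"
          by (rule Wp_add_le[OF p l f])
        also have "\<dots> \<le> ennreal (l powr (1 - p)) * (ennreal (real (m k) powr p) * Wp p f (t k *\<^sub>R z)) +
            ennreal ((1 - l) powr (1 - p)) * Wp p f (r k *\<^sub>R z)"
          by (intro add_right_mono mult_left_mono Wp_of_nat_scaleR_le[OF p f]) auto
        finally have "ennreal (s powr - p) * Wp p f (s *\<^sub>R z) \<le> ennreal (s powr - p) *
            (ennreal (l powr (1 - p)) * (ennreal (real (m k) powr p) * Wp p f (t k *\<^sub>R z)) +
            ennreal ((1 - l) powr (1 - p)) * Wp p f (r k *\<^sub>R z))"
          by (rule mult_left_mono) auto
        also have "\<dots> = ennreal (l powr (1 - p)) * (ennreal (s powr - p * real (m k) powr p) * Wp p f (t k *\<^sub>R z)) +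
            ennreal ?c * Wp p f (r k *\<^sub>R z)"
          by (simp add: ennreal_mult distrib_left mult_ac)
        also have "\<dots> \<le> ennreal (l powr (1 - p)) * a + ennreal ?c * Wp p f (r k *\<^sub>R z)"
          by (intro add_right_mono mult_left_mono mk) auto
        finally show "ennreal (s powr - p) * Wp p f (s *\<^sub>R z) \<le>
          ennreal (l powr (1 - p)) * a + ennreal ?c * Wp p f (r k *\<^sub>R z)" .
      qed
      then show "\<exists>c. \<exists>\<^sub>F k in sequentially. ennreal (s powr - p) * Wp p f (s *\<^sub>R z) \<le>
          ennreal (l powr (1 - p)) * a + ennreal c * Wp p f (r k *\<^sub>R z)"
        by blast
    qed
    with a show False by simp
  qed
qed

lemma Wp_measurable [measurable]:
  assumes [measurable]: "f \<in> borel_measurable borel"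
  shows "Wp p f \<in> borel_measurable borel"
  unfolding Wp_def Ip_def by measurable

text \<open>Measurability is not visible from an uncountable supremum; it comes from the limit along
  the scales 1 / (k + 1).\<close>

lemma Lsup_measurable:
  assumes p: "1 \<le> p" and f[measurable]: "f \<in> borel_measurable borel" and fin: "Ip p f < \<infinity>"
  shows "Lsup p f \<in> borel_measurable borel"
proof -
  have *: "(\<lambda>k. ennreal (inverse (real (Suc k)) powr - p) * Wp p f (inverse (real (Suc k)) *\<^sub>R z)) \<longlonglongrightarrow> Lsup p f z" for z
    by (rule Wp_quotient_tendsto[OF assms LIMSEQ_inverse_real_of_nat]) simp
  have "Lsup p f = (\<lambda>z. liminf (\<lambda>k. ennreal (inverse (real (Suc k)) powr - p) * Wp p f (inverse (real (Suc k)) *\<^sub>R z)))"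
    using lim_imp_Liminf[OF sequentially_bot *] by auto
  then show ?thesis by simp
qed

section \<open>Gaussian averages and the rescaled heat energy\<close>

definition gauss :: "'a::euclidean_space \<Rightarrow> real" where
  "gauss z = (4 * pi) powr (- (real DIM('a) / 2)) * exp (- (norm z)\<^sup>2 / 4)"

lemma gauss_nonneg [simp]: "0 \<le> gauss z"
  by (simp add: gauss_def)

lemma gauss_measurable [measurable]: "gauss \<in> borel_measurable borel"
  unfolding gauss_def by measurable

text \<open>At s = sqrt t this is the rescaled heat energy at time t, by
  \<open>heat_energy_eq_LamE\<close>.\<close>

definition LamE :: "real \<Rightarrow> ('a::euclidean_space \<Rightarrow> real) \<Rightarrow> real \<Rightarrow> ennreal" where
  "LamE p f s = (\<integral>\<^sup>+z. ennreal (gauss z) * (ennreal (s powr - p) * Wp p f (s *\<^sub>R z)) \<partial>lborel)"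

definition Lam :: "real \<Rightarrow> ('a::euclidean_space \<Rightarrow> real) \<Rightarrow> ennreal" where
  "Lam p f = (\<integral>\<^sup>+z. ennreal (gauss z) * Lsup p f z \<partial>lborel)"

text \<open>The integrands converge to their suprema, so they stay below the limit, which bounds the
  upper limit; Fatou's lemma bounds the lower limit. No monotonicity in the scale enters, and the
  limit may be \<infinity>.\<close>

lemma LamE_tendsto:
  assumes p: "1 \<le> p" and f[measurable]: "f \<in> borel_measurable borel" and fin: "Ip p f < \<infinity>"
    and t: "t \<longlonglongrightarrow> 0" "\<And>k::nat. 0 < t k"
  shows "(\<lambda>k. LamE p f (t k)) \<longlonglongrightarrow> Lam p f"
proof -
  have le: "LamE p f (t k) \<le> Lam p f" for k
    unfolding LamE_def Lam_def by (intro nn_integral_mono mult_left_mono Lsup_upper t) auto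
  have "Lam p f = (\<integral>\<^sup>+z. liminf (\<lambda>k. ennreal (gauss z) * (ennreal (t k powr - p) * Wp p f (t k *\<^sub>R z))) \<partial>lborel)"
    unfolding Lam_def
  proof (intro nn_integral_cong lim_imp_Liminf[symmetric] ennreal_tendsto_cmult)
    show "(\<lambda>k. ennreal (t k powr - p) * Wp p f (t k *\<^sub>R z)) \<longlonglongrightarrow> Lsup p f z" for z
      by (rule Wp_quotient_tendsto[OF assms])
  qed auto
  also have "\<dots> \<le> liminf (\<lambda>k. LamE p f (t k))"
    unfolding LamE_def by (rule nn_integral_liminf) measurable
  finally have 1: "Lam p f \<le> liminf (\<lambda>k. LamE p f (t k))" .
  have 2: "limsup (\<lambda>k. LamE p f (t k)) \<le> Lam p f"
    by (rule Limsup_bounded) (use le in auto)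
  have 3: "liminf (\<lambda>k. LamE p f (t k)) \<le> limsup (\<lambda>k. LamE p f (t k))"
    by (rule Liminf_le_Limsup) simp
  show ?thesis
    by (rule Liminf_eq_Limsup) (use 1 2 3 in \<open>auto intro: antisym order_trans\<close>)
qed

text \<open>For a fixed increment, \<open>Wp\<close> is continuous along L^p convergence; a supremum
  of such functionals is lower semicontinuous, and Fatou's lemma carries this through the Gaussian
  integral.\<close>

lemma Lam_le_liminf:
  fixes v :: "nat \<Rightarrow> 'a::euclidean_space \<Rightarrow> real"
  assumes p: "1 \<le> p" and f[measurable]: "f \<in> borel_measurable borel" "\<And>i. v i \<in> borel_measurable borel"
    and fin: "\<And>i. Ip p (v i) < \<infinity>"
    and lim: "(\<lambda>i. Ip p (\<lambda>x. v i x - f x)) \<longlonglongrightarrow> 0"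
  shows "Lam p f \<le> liminf (\<lambda>i. Lam p (v i))"
proof -
  have W: "(\<lambda>i. Wp p (v i) h) \<longlonglongrightarrow> Wp p f h" for h
    unfolding Wp_def
  proof (rule Ip_tendsto[OF p])
    have le: "Ip p (\<lambda>x. v i (x + h) - v i x - (f (x + h) - f x)) \<le> ennreal (2 powr p) * (2 * Ip p (\<lambda>x. v i x - f x))" for i
      using Wp_le[OF p, of "\<lambda>x. v i x - f x" h] by (simp add: Wp_def algebra_simps)
    have "(\<lambda>i. ennreal (2 powr p) * (2 * Ip p (\<lambda>x. v i x - f x))) \<longlonglongrightarrow> ennreal (2 powr p) * (2 * 0)"
      by (intro ennreal_tendsto_cmult lim) auto
    then have "(\<lambda>i. ennreal (2 powr p) * (2 * Ip p (\<lambda>x. v i x - f x))) \<longlonglongrightarrow> 0" by simp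
    then show "(\<lambda>i. Ip p (\<lambda>x. v i (x + h) - v i x - (f (x + h) - f x))) \<longlonglongrightarrow> 0"
      by (rule tendsto_0_ennreal_le[rotated]) (rule le)
  qed auto
  have pt: "ennreal (gauss z) * Lsup p f z \<le> liminf (\<lambda>i. ennreal (gauss z) * Lsup p (v i) z)" for z
    unfolding Lsup_def[of p f z] SUP_mult_left_ennreal
  proof (rule SUP_least)
    fix s :: real assume "s \<in> {0<..}"
    then have s: "0 < s" by simp
    have "ennreal (gauss z) * (ennreal (s powr - p) * Wp p f (s *\<^sub>R z))
        = liminf (\<lambda>i. ennreal (gauss z) * (ennreal (s powr - p) * Wp p (v i) (s *\<^sub>R z)))"
      by (rule lim_imp_Liminf[symmetric]) (auto intro!: ennreal_tendsto_cmult W)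
    also have "\<dots> \<le> liminf (\<lambda>i. ennreal (gauss z) * Lsup p (v i) z)"
      by (intro Liminf_mono always_eventually allI mult_left_mono Lsup_upper s) auto
    finally show "ennreal (gauss z) * (ennreal (s powr - p) * Wp p f (s *\<^sub>R z))
       \<le> liminf (\<lambda>i. ennreal (gauss z) * Lsup p (v i) z)" .
  qed
  have [measurable]: "Lsup p (v i) \<in> borel_measurable borel" for i
    by (rule Lsup_measurable[OF p _ fin]) simp
  have "Lam p f \<le> (\<integral>\<^sup>+z. liminf (\<lambda>i. ennreal (gauss z) * Lsup p (v i) z) \<partial>lborel)"
    unfolding Lam_def by (intro nn_integral_mono pt)
  also have "\<dots> \<le> liminf (\<lambda>i. Lam p (v i))"
    unfolding Lam_def by (rule nn_integral_liminf) measurable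
  finally show ?thesis .
qed

lemma nn_integral_rescale:
  fixes g :: "'a::euclidean_space \<Rightarrow> ennreal"
  assumes [measurable]: "g \<in> borel_measurable borel" and "0 < c"
  shows "(\<integral>\<^sup>+y. g y \<partial>lborel) = ennreal (c ^ DIM('a)) * (\<integral>\<^sup>+z. g (x + c *\<^sub>R z) \<partial>lborel)"
proof -
  have "(\<integral>\<^sup>+y. g y \<partial>lborel) = (\<integral>\<^sup>+y. g y \<partial>density (distr lborel borel (\<lambda>z. x + c *\<^sub>R z)) (\<lambda>_. \<bar>c\<bar> ^ DIM('a)))"
    using lborel_affine[of c x] \<open>0 < c\<close> by simp
  also have "\<dots> = ennreal (c ^ DIM('a)) * (\<integral>\<^sup>+z. g (x + c *\<^sub>R z) \<partial>lborel)"
    using \<open>0 < c\<close> by (simp add: nn_integral_density nn_integral_distr nn_integral_cmult)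
  finally show ?thesis .
qed

lemma heat_energy_eq_LamE:
  fixes f :: "'a::euclidean_space \<Rightarrow> real"
  assumes [measurable]: "f \<in> borel_measurable borel" and t: "0 < t"
  shows "ennreal (t powr - (p / 2)) * heat_energy p f t = LamE p f (sqrt t)"
proof -
  let ?n = "real DIM('a)"
  have pt: "ennreal (t powr - (p / 2)) * heat_semigroup t (\<lambda>y. ennreal (\<bar>f y - f x\<bar> powr p)) x =
     (\<integral>\<^sup>+z. ennreal (gauss z) * (ennreal (sqrt t powr - p) * ennreal (norm (f (x + sqrt t *\<^sub>R z) - f x) powr p)) \<partial>lborel)" for x
  proof -
    \<comment> \<open>The Jacobian of y = x + sqrt t z cancels the dependence on t of the kernel's
      normalisation.\<close>
    have c: "(4 * pi * t) powr - (?n / 2) * sqrt t ^ DIM('a) = (4 * pi) powr - (?n / 2)"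
    proof -
      have "sqrt t ^ DIM('a) = t powr (?n / 2)"
        using t by (simp add: powr_half_sqrt[symmetric] powr_powr powr_realpow[symmetric])
      then show ?thesis using t by (simp add: powr_mult powr_minus)
    qed
    have e: "exp (- (norm (x - (x + sqrt t *\<^sub>R z)))\<^sup>2 / (4 * t)) = exp (- (norm z)\<^sup>2 / 4)" for z
      using t by (simp add: power_mult_distrib)
    have q: "t powr - (p / 2) = sqrt t powr - p"
      using t by (simp add: powr_half_sqrt[symmetric] powr_powr)
    have "heat_semigroup t (\<lambda>y. ennreal (\<bar>f y - f x\<bar> powr p)) x = ennreal ((4 * pi * t) powr - (?n / 2)) *
        (\<integral>\<^sup>+y. ennreal (exp (- (norm (x - y))\<^sup>2 / (4 * t))) * ennreal (\<bar>f y - f x\<bar> powr p) \<partial>lborel)"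
      unfolding heat_semigroup_def by (simp add: nn_integral_completion)
    also have "\<dots> = ennreal ((4 * pi * t) powr - (?n / 2)) * (ennreal (sqrt t ^ DIM('a)) *
        (\<integral>\<^sup>+z. ennreal (exp (- (norm z)\<^sup>2 / 4)) * ennreal (\<bar>f (x + sqrt t *\<^sub>R z) - f x\<bar> powr p) \<partial>lborel))"
      by (subst nn_integral_rescale[of _ "sqrt t" x]) (measurable, use t in \<open>simp_all only: e real_sqrt_gt_0_iff\<close>)
    also have "\<dots> = ennreal ((4 * pi) powr - (?n / 2)) *
        (\<integral>\<^sup>+z. ennreal (exp (- (norm z)\<^sup>2 / 4)) * ennreal (\<bar>f (x + sqrt t *\<^sub>R z) - f x\<bar> powr p) \<partial>lborel)"
      unfolding c[symmetric] using t by (simp add: ennreal_mult mult.assoc)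
    finally have hs: "heat_semigroup t (\<lambda>y. ennreal (\<bar>f y - f x\<bar> powr p)) x = ennreal ((4 * pi) powr - (?n / 2)) *
        (\<integral>\<^sup>+z. ennreal (exp (- (norm z)\<^sup>2 / 4)) * ennreal (\<bar>f (x + sqrt t *\<^sub>R z) - f x\<bar> powr p) \<partial>lborel)" .
    have "ennreal (t powr - (p / 2)) * heat_semigroup t (\<lambda>y. ennreal (\<bar>f y - f x\<bar> powr p)) x =
       (\<integral>\<^sup>+z. ennreal (t powr - (p / 2)) * (ennreal ((4 * pi) powr - (?n / 2)) *
        (ennreal (exp (- (norm z)\<^sup>2 / 4)) * ennreal (\<bar>f (x + sqrt t *\<^sub>R z) - f x\<bar> powr p))) \<partial>lborel)"
      unfolding hs by (simp add: nn_integral_cmult)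
    also have "\<dots> = (\<integral>\<^sup>+z. ennreal (gauss z) * (ennreal (sqrt t powr - p) * ennreal (norm (f (x + sqrt t *\<^sub>R z) - f x) powr p)) \<partial>lborel)"
    proof (rule nn_integral_cong)
      have rearrange: "r * (ennreal a * (ennreal b * d)) = ennreal (a * b) * (r * d)" if "0 \<le> a" "0 \<le> b" for a b r d
        using that by (simp add: ennreal_mult mult_ac)
      show "ennreal (t powr - (p / 2)) * (ennreal ((4 * pi) powr - (?n / 2)) *
        (ennreal (exp (- (norm z)\<^sup>2 / 4)) * ennreal (\<bar>f (x + sqrt t *\<^sub>R z) - f x\<bar> powr p))) =
        ennreal (gauss z) * (ennreal (sqrt t powr - p) * ennreal (norm (f (x + sqrt t *\<^sub>R z) - f x) powr p))" for z
        unfolding gauss_def q real_norm_def by (rule rearrange) auto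
    qed
    finally show ?thesis .
  qed
  have meas: "(\<lambda>x. heat_semigroup t (\<lambda>y. ennreal (\<bar>f y - f x\<bar> powr p)) x) \<in> borel_measurable lborel"
    unfolding heat_semigroup_def nn_integral_completion by measurable
  have "ennreal (t powr - (p / 2)) * heat_energy p f t =
     (\<integral>\<^sup>+x. ennreal (t powr - (p / 2)) * heat_semigroup t (\<lambda>y. ennreal (\<bar>f y - f x\<bar> powr p)) x \<partial>lborel)"
    unfolding heat_energy_def nn_integral_completion by (rule nn_integral_cmult[symmetric]) (rule meas)
  also have "\<dots> = (\<integral>\<^sup>+x. \<integral>\<^sup>+z. ennreal (gauss z) * (ennreal (sqrt t powr - p) * ennreal (norm (f (x + sqrt t *\<^sub>R z) - f x) powr p)) \<partial>lborel \<partial>lborel)"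
    unfolding pt ..
  also have "\<dots> = (\<integral>\<^sup>+z. \<integral>\<^sup>+x. ennreal (gauss z) * (ennreal (sqrt t powr - p) * ennreal (norm (f (x + sqrt t *\<^sub>R z) - f x) powr p)) \<partial>lborel \<partial>lborel)"
    by (rule lborel_pair.Fubini') measurable
  also have "\<dots> = LamE p f (sqrt t)"
    unfolding LamE_def Wp_def Ip_def by (intro nn_integral_cong) (simp add: nn_integral_cmult)
  finally show ?thesis .
qed

section \<open>Absolute moments of the heat kernel\<close>

text \<open>exp(-s^2/4) is the unnormalised centred normal density of variance 2, whence the
  standard deviation sqrt 2 throughout.\<close>

lemma gauss_eq_prod:
  fixes z :: "'a::euclidean_space"
  shows "gauss z = (\<Prod>b\<in>Basis. normal_density 0 (sqrt 2) (z \<bullet> b))"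
proof -
  have "(\<Prod>b\<in>Basis. normal_density 0 (sqrt 2) (z \<bullet> b)) =
      (\<Prod>b\<in>(Basis::'a set). 1 / sqrt (4 * pi)) * (\<Prod>b\<in>Basis. exp (- (z \<bullet> b)\<^sup>2 / 4))"
    by (simp add: normal_density_def prod_dividef power_divide)
  also have "(\<Prod>b\<in>Basis. exp (- (z \<bullet> b)\<^sup>2 / 4)) = exp (\<Sum>b\<in>Basis. - (z \<bullet> b)\<^sup>2 / 4)"
    by (simp add: exp_sum)
  also have "(\<Sum>b\<in>Basis. - (z \<bullet> b)\<^sup>2 / 4) = - (norm z)\<^sup>2 / 4"
    unfolding power2_norm_eq_inner euclidean_inner[of z z]
    by (simp add: sum_divide_distrib sum_negf power2_eq_square)
  also have "(\<Prod>b\<in>(Basis::'a set). 1 / sqrt (4 * pi)) = (4 * pi) powr (- (real DIM('a) / 2))"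
    by (simp add: powr_half_sqrt[symmetric] powr_minus_divide powr_powr powr_realpow[symmetric] power_divide)
  finally show ?thesis by (simp add: gauss_def)
qed

definition gaussM :: "'a::euclidean_space measure" where
  "gaussM = density lborel (\<lambda>z. ennreal (gauss z))"

lemma space_gaussM [simp]: "space gaussM = UNIV" and sets_gaussM [simp, measurable_cong]: "sets gaussM = sets borel"
  by (simp_all add: gaussM_def)

text \<open>Total mass, coordinate laws and independence of the coordinates are all read off from
  this factorisation.\<close>

lemma emeasure_gaussM_rectangle:
  fixes A :: "'a::euclidean_space \<Rightarrow> real set"
  assumes A: "\<And>b. b \<in> Basis \<Longrightarrow> A b \<in> sets borel"
  shows "emeasure gaussM {z::'a. \<forall>b\<in>Basis. z \<bullet> b \<in> A b} =
    (\<Prod>b\<in>Basis. emeasure (density lborel (normal_density 0 (sqrt 2))) (A b))"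
proof -
  have [measurable]: "{z::'a. \<forall>b\<in>Basis. z \<bullet> b \<in> A b} \<in> sets borel"
  proof -
    have "{z::'a. \<forall>b\<in>Basis. z \<bullet> b \<in> A b} = (\<Inter>b\<in>Basis. (\<lambda>z. z \<bullet> b) -` A b)" by auto
    also have "\<dots> \<in> sets borel"
    proof (rule sets.finite_INT)
      fix b :: 'a assume "b \<in> Basis"
      then show "(\<lambda>z. z \<bullet> b) -` A b \<in> sets borel"
        using measurable_sets[of "\<lambda>z. z \<bullet> b" borel borel "A b"] A by simp
    qed auto
    finally show ?thesis .
  qed
  have "emeasure gaussM {z::'a. \<forall>b\<in>Basis. z \<bullet> b \<in> A b} =
      (\<integral>\<^sup>+z. ennreal (gauss z) * indicator {z::'a. \<forall>b\<in>Basis. z \<bullet> b \<in> A b} z \<partial>lborel)"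
    unfolding gaussM_def by (rule emeasure_density) auto
  also have "\<dots> = (\<integral>\<^sup>+z. (\<Prod>b\<in>Basis. ennreal (normal_density 0 (sqrt 2) (z \<bullet> b)) * indicator (A b) (z \<bullet> b)) \<partial>lborel)"
  proof (rule nn_integral_cong)
    fix z :: 'a
    have "(\<Prod>b\<in>Basis. indicator (A b) (z \<bullet> b)) = (indicator {z::'a. \<forall>b\<in>Basis. z \<bullet> b \<in> A b} z :: ennreal)"
      by (auto simp: indicator_def intro!: prod_zero)
    then show "ennreal (gauss z) * indicator {z::'a. \<forall>b\<in>Basis. z \<bullet> b \<in> A b} z =
        (\<Prod>b\<in>Basis. ennreal (normal_density 0 (sqrt 2) (z \<bullet> b)) * indicator (A b) (z \<bullet> b))"
      by (simp add: gauss_eq_prod prod.distrib prod_ennreal)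
  qed
  also have "\<dots> = (\<Prod>b\<in>(Basis::'a set). \<integral>\<^sup>+s. ennreal (normal_density 0 (sqrt 2) s) * indicator (A b) s \<partial>lborel)"
    by (rule nn_integral_lborel_prod) (use A in auto)
  also have "\<dots> = (\<Prod>b\<in>(Basis::'a set). emeasure (density lborel (normal_density 0 (sqrt 2))) (A b))"
    by (intro prod.cong refl emeasure_density[symmetric]) (use A in auto)
  finally show ?thesis .
qed

lemma prob_space_gaussM: "prob_space (gaussM :: 'a::euclidean_space measure)"
proof
  have "emeasure gaussM {z::'a. \<forall>b\<in>Basis. z \<bullet> b \<in> UNIV} =
    (\<Prod>b\<in>(Basis::'a set). emeasure (density lborel (normal_density 0 (sqrt 2))) UNIV)"
    by (rule emeasure_gaussM_rectangle) auto
  also have "emeasure (density lborel (normal_density 0 (sqrt 2))) UNIV = 1"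
    using prob_space.emeasure_space_1[OF prob_space_normal_density[of "sqrt 2" 0]] by simp
  finally show "emeasure gaussM (space gaussM :: 'a set) = 1" by simp
qed

lemma distr_gaussM_coordinate:
  fixes b :: "'a::euclidean_space"
  assumes b: "b \<in> Basis"
  shows "distr gaussM borel (\<lambda>z. z \<bullet> b) = density lborel (normal_density 0 (sqrt 2))"
proof (rule measure_eqI)
  fix S assume "S \<in> sets (distr gaussM borel (\<lambda>z::'a. z \<bullet> b))"
  then have S: "S \<in> sets borel" by simp
  have "emeasure (distr gaussM borel (\<lambda>z. z \<bullet> b)) S = emeasure gaussM ((\<lambda>z. z \<bullet> b) -` S)"
    by (subst emeasure_distr) (use S in auto)
  also have "(\<lambda>z. z \<bullet> b) -` S = {z. \<forall>c\<in>Basis. z \<bullet> c \<in> (if c = b then S else UNIV)}"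
    using b by auto
  also have "emeasure gaussM \<dots> =
      (\<Prod>c\<in>(Basis::'a set). emeasure (density lborel (normal_density 0 (sqrt 2))) (if c = b then S else UNIV))"
    by (rule emeasure_gaussM_rectangle) (use S in auto)
  also have "\<dots> = (\<Prod>c\<in>(Basis::'a set). if c = b then emeasure (density lborel (normal_density 0 (sqrt 2))) S else 1)"
    using prob_space.emeasure_space_1[OF prob_space_normal_density[of "sqrt 2" 0]]
    by (intro prod.cong) auto
  also have "\<dots> = emeasure (density lborel (normal_density 0 (sqrt 2))) S"
    using b by simp
  finally show "emeasure (distr gaussM borel (\<lambda>z. z \<bullet> b)) S = emeasure (density lborel (normal_density 0 (sqrt 2))) S" .
qed simp

lemma indep_vars_gaussM_coordinates:
  "prob_space.indep_vars gaussM (\<lambda>_. borel) (\<lambda>b z. z \<bullet> b) (Basis :: 'a::euclidean_space set)"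
proof -
  let ?N = "density lborel (normal_density 0 (sqrt 2)) :: real measure"
  interpret prob_space "gaussM :: 'a measure" by (rule prob_space_gaussM)
  interpret N: product_sigma_finite "\<lambda>b::'a. ?N"
    by (simp add: product_sigma_finite_def prob_space_normal_density prob_space_imp_sigma_finite)
  have [measurable]: "(\<lambda>z::'a. \<lambda>b\<in>Basis. z \<bullet> b) \<in> borel \<rightarrow>\<^sub>M (\<Pi>\<^sub>M b\<in>(Basis::'a set). borel)"
    by (rule measurable_restrict) simp
  have "distr gaussM (\<Pi>\<^sub>M b\<in>(Basis::'a set). borel) (\<lambda>z. \<lambda>b\<in>Basis. z \<bullet> b) = (\<Pi>\<^sub>M b\<in>(Basis::'a set). ?N)"
  proof (rule N.PiM_eqI)
    fix A :: "'a \<Rightarrow> real set" assume A: "\<And>b. b \<in> Basis \<Longrightarrow> A b \<in> sets ?N"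
    have "emeasure (distr gaussM (\<Pi>\<^sub>M b\<in>(Basis::'a set). borel) (\<lambda>z. \<lambda>b\<in>Basis. z \<bullet> b)) (Pi\<^sub>E Basis A) =
        emeasure gaussM ((\<lambda>z. \<lambda>b\<in>Basis. z \<bullet> b) -` Pi\<^sub>E Basis A)"
      by (subst emeasure_distr) (use A in \<open>auto intro!: sets_PiM_I_finite\<close>)
    also have "(\<lambda>z. \<lambda>b\<in>Basis. z \<bullet> b) -` Pi\<^sub>E Basis A = {z. \<forall>b\<in>Basis. z \<bullet> b \<in> A b}"
      by (auto simp: PiE_iff)
    also have "emeasure gaussM \<dots> = (\<Prod>b\<in>Basis. emeasure ?N (A b))"
      by (rule emeasure_gaussM_rectangle) (use A in auto)
    finally show "emeasure (distr gaussM (\<Pi>\<^sub>M b\<in>(Basis::'a set). borel) (\<lambda>z. \<lambda>b\<in>Basis. z \<bullet> b)) (Pi\<^sub>E Basis A) =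
        (\<Prod>b\<in>Basis. emeasure ?N (A b))" .
  qed (auto intro!: sets_PiM_cong)
  also have "\<dots> = (\<Pi>\<^sub>M b\<in>(Basis::'a set). distr gaussM borel (\<lambda>z. z \<bullet> b))"
    by (intro PiM_cong refl distr_gaussM_coordinate[symmetric])
  finally show ?thesis
    by (subst indep_vars_iff_distr_eq_PiM) auto
qed

text \<open>Rotation invariance of the Gaussian law, obtained from the stability of normal laws
  under independent sums instead of an orthogonal change of variables: the variances 2 (a \<bullet>
  b)^2 add up to 2 |a|^2 = 2.\<close>

lemma distributed_gaussM_inner:
  fixes a :: "'a::euclidean_space"
  assumes a: "norm a = 1"
  shows "distributed gaussM lborel (\<lambda>z. a \<bullet> z) (normal_density 0 (sqrt 2))"
proof -
  interpret prob_space "gaussM :: 'a measure" by (rule prob_space_gaussM)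
  \<comment> \<open>Zero coordinates are dropped because \<open>sum_indep_normal\<close> asks for
    positive standard deviations.\<close>
  define J where "J = {b \<in> Basis. a \<bullet> b \<noteq> 0}"
  have fin: "finite J" by (simp add: J_def)
  have ne: "J \<noteq> {}"
  proof
    assume "J = {}"
    then have "a = 0" by (auto simp: J_def intro: euclidean_eqI)
    with a show False by simp
  qed
  have ind: "indep_vars (\<lambda>_. borel) (\<lambda>b z. 0 + (a \<bullet> b) * (z \<bullet> b)) J"
  proof (rule indep_vars_compose2[of "\<lambda>_. borel" "\<lambda>b z. z \<bullet> b" J "\<lambda>b s. 0 + (a \<bullet> b) * s"])
    show "indep_vars (\<lambda>_. borel) (\<lambda>b z. z \<bullet> b) J"
      by (rule indep_vars_subset[OF indep_vars_gaussM_coordinates]) (auto simp: J_def)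
  qed simp
  have "distributed gaussM lborel (\<lambda>z. \<Sum>b\<in>J. 0 + (a \<bullet> b) * (z \<bullet> b))
      (normal_density (\<Sum>b\<in>J. 0) (sqrt (\<Sum>b\<in>J. (\<bar>a \<bullet> b\<bar> * sqrt 2)\<^sup>2)))"
  proof (rule sum_indep_normal[OF fin ne ind])
    fix b assume b: "b \<in> J"
    then show "0 < \<bar>a \<bullet> b\<bar> * sqrt 2" by (simp add: J_def)
    have "distributed gaussM lborel (\<lambda>z. z \<bullet> b) (normal_density 0 (sqrt 2))"
    proof -
      have "distr gaussM lborel (\<lambda>z. z \<bullet> b) = distr gaussM borel (\<lambda>z. z \<bullet> b)"
        by (intro distr_cong) auto
      then show ?thesis
        using distr_gaussM_coordinate[of b] b by (simp add: distributed_def J_def)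
    qed
    from normal_density_affine[OF this, of "a \<bullet> b" 0] b
    show "distributed gaussM lborel (\<lambda>z. 0 + (a \<bullet> b) * (z \<bullet> b)) (normal_density 0 (\<bar>a \<bullet> b\<bar> * sqrt 2))"
      by (simp add: J_def)
  qed
  moreover have "(\<Sum>b\<in>J. 0 + (a \<bullet> b) * (z \<bullet> b)) = a \<bullet> z" for z
    unfolding euclidean_inner[of a z] J_def by (intro sum.mono_neutral_cong_left) auto
  moreover have "(\<Sum>b\<in>J. (\<bar>a \<bullet> b\<bar> * sqrt 2)\<^sup>2) = 2"
  proof -
    have "(\<Sum>b\<in>J. (\<bar>a \<bullet> b\<bar> * sqrt 2)\<^sup>2) = (\<Sum>b\<in>Basis. 2 * ((a \<bullet> b) * (a \<bullet> b)))"
      unfolding J_def by (intro sum.mono_neutral_cong_left) (auto simp: power_mult_distrib simp flip: power2_eq_square)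
    also have "\<dots> = 2 * (a \<bullet> a)"
      unfolding euclidean_inner[of a a] by (simp add: sum_distrib_left)
    also have "\<dots> = 2" using a by (simp add: norm_eq_1)
    finally show ?thesis .
  qed
  ultimately show ?thesis by simp
qed

section \<open>One-dimensional normal moments and the Gamma function\<close>

lemma of_bool_mono: "(P \<Longrightarrow> Q) \<Longrightarrow> of_bool P \<le> (of_bool Q :: real)"
  by auto

text \<open>The substitution u = s^2/4 in Euler's integral for Gamma((p+1)/2). It is carried out on
  [0, k], where the substitution rule applies, and extended to the half-line by monotone
  convergence.\<close>

lemma nn_integral_exp_powr_half_line:
  fixes p :: real
  assumes p: "1 \<le> p"
  shows "(\<integral>\<^sup>+s. ennreal (exp (- s\<^sup>2 / 4) * (s / 2) powr p * indicator {0..} s) \<partial>lborel) = ennreal (Gamma ((p + 1) / 2))"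
proof -
  define f where "f u = u powr ((p + 1) / 2 - 1) / exp u" for u :: real
  let ?g = "\<lambda>s::real. s\<^sup>2 / 4"
  have [measurable]: "f \<in> borel_measurable borel" unfolding f_def by measurable
  have f0: "0 \<le> f u" for u by (simp add: f_def)
  have sub: "(\<integral>\<^sup>+u. ennreal (f u * indicator {0..(real k)\<^sup>2 / 4} u) \<partial>lborel) =
      (\<integral>\<^sup>+s. ennreal (exp (- s\<^sup>2 / 4) * (s / 2) powr p * indicator {0..real k} s) \<partial>lborel)" for k
  proof -
    have "(\<integral>\<^sup>+u. ennreal (f u * indicator {?g 0..?g (real k)} u) \<partial>lborel) =
        (\<integral>\<^sup>+s. ennreal (f (?g s) * (s / 2) * indicator {0..real k} s) \<partial>lborel)"
    proof (rule nn_integral_substitution)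
      show "(?g has_real_derivative s / 2) (at s)" for s
        by (auto intro!: derivative_eq_intros)
      show "set_borel_measurable borel {?g 0..?g (real k)} f"
        unfolding set_borel_measurable_def by measurable
    qed (auto intro!: continuous_intros)
    also have "\<dots> = (\<integral>\<^sup>+s. ennreal (exp (- s\<^sup>2 / 4) * (s / 2) powr p * indicator {0..real k} s) \<partial>lborel)"
    proof (intro nn_integral_cong arg_cong[where f=ennreal])
      fix s :: real
      show "f (?g s) * (s / 2) * indicator {0..real k} s = exp (- s\<^sup>2 / 4) * (s / 2) powr p * indicator {0..real k} s"
      proof (cases "0 < s")
        case True
        have "s\<^sup>2 / 4 = (s / 2) powr 2" using True by (simp add: power_divide)
        then have "(s\<^sup>2 / 4) powr ((p + 1) / 2 - 1) = (s / 2) powr (2 * ((p + 1) / 2 - 1))"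
          by (simp only: powr_powr)
        also have "2 * ((p + 1) / 2 - 1) = p - 1" by (simp add: field_simps)
        finally have "(s\<^sup>2 / 4) powr ((p + 1) / 2 - 1) * (s / 2) = (s / 2) powr (p - 1) * (s / 2) powr 1"
          using True by simp
        also have "\<dots> = (s / 2) powr p" by (simp only: powr_add[symmetric]) simp
        finally show ?thesis by (simp add: f_def exp_minus field_simps)
      qed (auto simp: indicator_def f_def)
    qed
    finally show ?thesis by simp
  qed
  have lim1: "(\<lambda>k. \<integral>\<^sup>+u. ennreal (f u * indicator {0..(real k)\<^sup>2 / 4} u) \<partial>lborel) \<longlonglongrightarrow> (\<integral>\<^sup>+u. ennreal (f u * indicator {0..} u) \<partial>lborel)"
  proof (rule nn_integral_LIMSEQ)
    show "mono (\<lambda>k u. ennreal (f u * indicator {0..(real k)\<^sup>2 / 4} u))"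
    proof (intro monoI le_funI ennreal_leI mult_left_mono f0)
      fix k l :: nat and u :: real assume "k \<le> l"
      then have "(real k)\<^sup>2 \<le> (real l)\<^sup>2" by (intro power_mono) auto
      then have "{0..(real k)\<^sup>2 / 4} \<subseteq> {0..(real l)\<^sup>2 / 4}" by (intro atLeastatMost_subset_iff[THEN iffD2]) auto
      then have "u \<in> {0..(real k)\<^sup>2 / 4} \<Longrightarrow> u \<in> {0..(real l)\<^sup>2 / 4}" by (rule subsetD)
      then show "indicator {0..(real k)\<^sup>2 / 4} u \<le> (indicator {0..(real l)\<^sup>2 / 4} u :: real)"
        unfolding indicator_def by (rule of_bool_mono)
    qed
    show "(\<lambda>k. ennreal (f u * indicator {0..(real k)\<^sup>2 / 4} u)) \<longlonglongrightarrow> ennreal (f u * indicator {0..} u)" for u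
    proof (rule tendsto_eventually)
      have "\<forall>\<^sub>F k in sequentially. u \<le> (real k)\<^sup>2 / 4"
      proof -
        obtain n where n: "2 * \<bar>u\<bar> + 2 \<le> real n" using real_arch_simple by blast
        have "u \<le> (real k)\<^sup>2 / 4" if "n \<le> k" for k
        proof -
          have "2 * \<bar>u\<bar> + 2 \<le> real k" using n that by linarith
          then have "(2 * \<bar>u\<bar> + 2)\<^sup>2 \<le> (real k)\<^sup>2" by (intro power_mono) auto
          moreover have "4 * \<bar>u\<bar> \<le> (2 * \<bar>u\<bar> + 2)\<^sup>2" by (simp add: power2_sum)
          ultimately show ?thesis by linarith
        qed
        then show ?thesis by (auto simp: eventually_sequentially)
      qed
      then show "\<forall>\<^sub>F k in sequentially. ennreal (f u * indicator {0..(real k)\<^sup>2 / 4} u) = ennreal (f u * indicator {0..} u)"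
        by eventually_elim (auto simp: indicator_def)
    qed
  qed measurable
  let ?h = "\<lambda>s::real. exp (- s\<^sup>2 / 4) * (s / 2) powr p"
  have lim2: "(\<lambda>k. \<integral>\<^sup>+s. ennreal (?h s * indicator {0..real k} s) \<partial>lborel) \<longlonglongrightarrow> (\<integral>\<^sup>+s. ennreal (?h s * indicator {0..} s) \<partial>lborel)"
  proof (rule nn_integral_LIMSEQ)
    show "mono (\<lambda>k s. ennreal (?h s * indicator {0..real k} s))"
      by (intro monoI le_funI ennreal_leI mult_left_mono) (auto simp: indicator_def)
    show "(\<lambda>k. ennreal (?h s * indicator {0..real k} s)) \<longlonglongrightarrow> ennreal (?h s * indicator {0..} s)" for s
    proof (rule tendsto_eventually)
      show "\<forall>\<^sub>F k in sequentially. ennreal (?h s * indicator {0..real k} s) = ennreal (?h s * indicator {0..} s)"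
        using eventually_ge_at_top[of "nat \<lceil>s\<rceil>"]
        by eventually_elim (auto simp: indicator_def; linarith)
    qed
  qed measurable
  have "(\<integral>\<^sup>+s. ennreal (?h s * indicator {0..} s) \<partial>lborel) = (\<integral>\<^sup>+u. ennreal (f u * indicator {0..} u) \<partial>lborel)"
    by (rule LIMSEQ_unique[OF lim2]) (use lim1 in \<open>simp only: sub\<close>)
  also have "\<dots> = (\<integral>\<^sup>+u. ennreal (indicator {0..} u * u powr ((p + 1) / 2 - 1) / exp u) \<partial>lborel)"
    by (intro nn_integral_cong) (simp add: f_def mult.commute)
  also have "\<dots> = ennreal (Gamma ((p + 1) / 2))"
    by (rule Gamma_conv_nn_integral_real[symmetric]) (use p in simp)
  finally show ?thesis .
qed

text \<open>Legendre's duplication formula at p/2, read off from its complex version. The left side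
  is the form in which the Gaussian moment appears, the right side the form of the theorem.\<close>

lemma Gamma_duplication_real:
  fixes p :: real
  assumes p: "1 \<le> p"
  shows "2 powr p * Gamma ((p + 1) / 2) / sqrt pi = 2 * Gamma p / Gamma (p / 2)"
proof -
  have nonpos: "complex_of_real x \<notin> \<int>\<^sub>\<le>\<^sub>0" if "0 < x" for x
    using that by (auto elim!: nonpos_Ints_cases) (metis of_real_of_int_eq of_real_eq_iff not_less of_int_le_0_iff)
  have "Gamma (complex_of_real (p / 2)) * Gamma (complex_of_real (p / 2) + 1 / 2) =
      exp ((1 - 2 * complex_of_real (p / 2)) * of_real (ln 2)) * of_real (sqrt pi) * Gamma (2 * complex_of_real (p / 2))"
    using nonpos[of "p / 2"] nonpos[of "p / 2 + 1 / 2"] p by (intro Gamma_legendre_duplication) auto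
  also have "complex_of_real (p / 2) + 1 / 2 = complex_of_real ((p + 1) / 2)" by simp
  also have "2 * complex_of_real (p / 2) = complex_of_real p" by simp
  also have "exp ((1 - complex_of_real p) * of_real (ln 2)) = complex_of_real (2 powr (1 - p))"
    by (simp add: powr_def exp_of_real[symmetric])
  finally have "complex_of_real (Gamma (p / 2) * Gamma ((p + 1) / 2)) = complex_of_real (2 powr (1 - p) * sqrt pi * Gamma p)"
    by (simp only: Gamma_complex_of_real of_real_mult)
  then have "Gamma (p / 2) * Gamma ((p + 1) / 2) = 2 powr (1 - p) * sqrt pi * Gamma p"
    by (simp only: of_real_eq_iff)
  moreover have "Gamma (p / 2) > 0" using p by (intro Gamma_real_pos) auto
  ultimately show ?thesis
    by (simp add: powr_diff field_simps)
qed

text \<open>The p-th absolute moment of a centred normal variable of variance 2; its value at p = 1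
  is 2 / sqrt pi.\<close>

definition heat_const :: "real \<Rightarrow> real" where
  "heat_const p = 2 * Gamma p / Gamma (p / 2)"

lemma heat_const_pos: "1 \<le> p \<Longrightarrow> 0 < heat_const p"
  by (simp add: heat_const_def Gamma_real_pos)

lemma nn_integral_normal_powr:
  fixes p :: real
  assumes p: "1 \<le> p"
  shows "(\<integral>\<^sup>+s. ennreal (normal_density 0 (sqrt 2) s) * ennreal (\<bar>s\<bar> powr p) \<partial>lborel) = ennreal (heat_const p)"
proof -
  let ?h = "\<lambda>s::real. exp (- s\<^sup>2 / 4) * (s / 2) powr p * indicator {0..} s"
  \<comment> \<open>The density contributes 1 / (2 sqrt pi), and |s|^p = 2^p (|s|/2)^p contributes
    2^p.\<close>
  let ?c = "2 powr p / (2 * sqrt pi)"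
  have sq: "sqrt (2 * pi * (sqrt 2)\<^sup>2) = 2 * sqrt pi"
    by (simp add: real_sqrt_mult)
  have h: "normal_density 0 (sqrt 2) s * \<bar>s\<bar> powr p = ?c * (?h s + ?h (- s))" for s
  proof -
    have "\<bar>s\<bar> powr p = 2 powr p * (\<bar>s\<bar> / 2) powr p" by (simp add: powr_divide)
    then have "normal_density 0 (sqrt 2) s * \<bar>s\<bar> powr p = ?c * (exp (- s\<^sup>2 / 4) * (\<bar>s\<bar> / 2) powr p)"
      unfolding normal_density_def sq by (simp add: field_simps)
    then show ?thesis by (cases "s > 0"; cases "s = 0") auto
  qed
  have "(\<integral>\<^sup>+s. ennreal (normal_density 0 (sqrt 2) s) * ennreal (\<bar>s\<bar> powr p) \<partial>lborel) =
      (\<integral>\<^sup>+s. ennreal ?c * (ennreal (?h s) + ennreal (?h (- s))) \<partial>lborel)"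
  proof (rule nn_integral_cong)
    fix s :: real
    have "ennreal (normal_density 0 (sqrt 2) s) * ennreal (\<bar>s\<bar> powr p) = ennreal (?c * (?h s + ?h (- s)))"
      unfolding h[symmetric] by (simp add: ennreal_mult)
    also have "\<dots> = ennreal ?c * ennreal (?h s + ?h (- s))" by (rule ennreal_mult) auto
    also have "ennreal (?h s + ?h (- s)) = ennreal (?h s) + ennreal (?h (- s))" by (rule ennreal_plus) auto
    finally show "ennreal (normal_density 0 (sqrt 2) s) * ennreal (\<bar>s\<bar> powr p) =
      ennreal ?c * (ennreal (?h s) + ennreal (?h (- s)))" .
  qed
  also have "\<dots> = ennreal ?c * ((\<integral>\<^sup>+s. ennreal (?h s) \<partial>lborel) + (\<integral>\<^sup>+s. ennreal (?h (- s)) \<partial>lborel))"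
    by (subst nn_integral_cmult, measurable, subst nn_integral_add) auto
  also have "(\<integral>\<^sup>+s. ennreal (?h (- s)) \<partial>lborel) = (\<integral>\<^sup>+s. ennreal (?h s) \<partial>lborel)"
    using nn_integral_real_affine[of "\<lambda>s. ennreal (?h s)" "-1" 0] by simp
  also have "ennreal ?c * ((\<integral>\<^sup>+s. ennreal (?h s) \<partial>lborel) + (\<integral>\<^sup>+s. ennreal (?h s) \<partial>lborel)) =
      ennreal (?c * (Gamma ((p + 1) / 2) + Gamma ((p + 1) / 2)))"
  proof -
    have g: "0 \<le> Gamma ((p + 1) / 2)" using p by (simp add: Gamma_real_pos less_imp_le)
    have c: "0 \<le> ?c" by simp
    show ?thesis
      unfolding nn_integral_exp_powr_half_line[OF p] ennreal_mult[OF c add_nonneg_nonneg[OF g g]]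
        ennreal_plus[OF g g] ..
  qed
  also have "?c * (Gamma ((p + 1) / 2) + Gamma ((p + 1) / 2)) = heat_const p"
    using Gamma_duplication_real[OF p] by (simp add: heat_const_def field_simps)
  finally show ?thesis .
qed

text \<open>By rotation invariance the moment sees only the length of \<open>a\<close>. This is
  where directional derivatives average to the Euclidean norm of the gradient.\<close>

lemma nn_integral_gauss_inner_powr:
  fixes a :: "'a::euclidean_space"
  assumes p: "1 \<le> p"
  shows "(\<integral>\<^sup>+z. ennreal (gauss z) * ennreal (norm (a \<bullet> z) powr p) \<partial>lborel) = ennreal (heat_const p) * ennreal (norm a powr p)"
proof (cases "a = 0")
  case False
  define e where "e = a /\<^sub>R norm a"
  have e: "norm e = 1" "a = norm a *\<^sub>R e" using False by (auto simp: e_def)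
  have "(\<integral>\<^sup>+z. ennreal (gauss z) * ennreal (norm (a \<bullet> z) powr p) \<partial>lborel) =
      (\<integral>\<^sup>+z. ennreal (norm (a \<bullet> z) powr p) \<partial>gaussM)"
    unfolding gaussM_def by (subst nn_integral_density) auto
  also have "\<dots> = (\<integral>\<^sup>+z. ennreal (norm a powr p) * ennreal (\<bar>e \<bullet> z\<bar> powr p) \<partial>gaussM)"
    by (subst (1) e(2)) (simp add: abs_mult powr_mult ennreal_mult)
  also have "\<dots> = ennreal (norm a powr p) * (\<integral>\<^sup>+z. ennreal (\<bar>e \<bullet> z\<bar> powr p) \<partial>gaussM)"
    by (rule nn_integral_cmult) measurable
  also have "(\<integral>\<^sup>+z. ennreal (\<bar>e \<bullet> z\<bar> powr p) \<partial>gaussM) =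
      (\<integral>\<^sup>+s. ennreal (normal_density 0 (sqrt 2) s) * ennreal (\<bar>s\<bar> powr p) \<partial>lborel)"
    by (rule distributed_nn_integral[OF distributed_gaussM_inner[OF e(1)], symmetric]) measurable
  also have "\<dots> = ennreal (heat_const p)" by (rule nn_integral_normal_powr[OF p])
  finally show ?thesis by (simp add: mult.commute)
qed simp

section \<open>Energy of continuously differentiable functions\<close>

text \<open>The gradient is carried along as an explicit vector field, so that \<open>Ip\<close> and
  convolution formulas apply to it directly.\<close>

definition C1_gradient :: "('a::euclidean_space \<Rightarrow> real) \<Rightarrow> ('a \<Rightarrow> 'a) \<Rightarrow> bool" where
  "C1_gradient v D \<longleftrightarrow> (\<forall>x. (v has_derivative (\<lambda>h. D x \<bullet> h)) (at x)) \<and> continuous_on UNIV D"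

lemma C1_gradientD:
  assumes "C1_gradient v D"
  shows "(v has_derivative (\<lambda>h. D x \<bullet> h)) (at x)" "continuous_on UNIV D" "continuous_on UNIV v"
    "D \<in> borel_measurable borel" "v \<in> borel_measurable borel"
proof -
  show d: "(v has_derivative (\<lambda>h. D x \<bullet> h)) (at x)" for x
    using assms by (simp add: C1_gradient_def)
  show c: "continuous_on UNIV D" using assms by (simp add: C1_gradient_def)
  show cv: "continuous_on UNIV v"
    using has_derivative_continuous[OF d] by (simp add: continuous_at_imp_continuous_on)
  show "D \<in> borel_measurable borel" "v \<in> borel_measurable borel"
    using c cv by (auto intro: borel_measurable_continuous_onI)
qed

lemma C1_gradient_has_real_derivative:
  assumes "C1_gradient v D"
  shows "((\<lambda>\<tau>. v (x + \<tau> *\<^sub>R z)) has_real_derivative D (x + \<tau> *\<^sub>R z) \<bullet> z) (at \<tau> within S)"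
proof -
  have "((\<lambda>\<tau>. v (x + \<tau> *\<^sub>R z)) has_derivative (\<lambda>k. D (x + \<tau> *\<^sub>R z) \<bullet> (k *\<^sub>R z))) (at \<tau> within S)"
    by (rule has_derivative_compose[where f="\<lambda>\<tau>. x + \<tau> *\<^sub>R z", OF _ C1_gradientD(1)[OF assms]])
       (auto intro!: derivative_eq_intros)
  then show ?thesis by (rule has_derivative_imp_has_field_derivative) simp
qed

text \<open>By the fundamental theorem of calculus the increment is the average over [0, 1] of
  translates of x \<mapsto> D x \<bullet> (s z), and averaging contracts. Hence no difference
  quotient exceeds the limiting energy.\<close>

lemma Wp_C1_le:
  assumes p: "1 \<le> p" and v: "C1_gradient v D" and s: "0 < s"
  shows "Wp p v (s *\<^sub>R z) \<le> ennreal (s powr p) * Ip p (\<lambda>x. D x \<bullet> z)"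
proof -
  note [measurable] = C1_gradientD(4,5)[OF v]
  define M where "M = density lborel (\<lambda>\<tau>::real. ennreal (indicator {0..1} \<tau>))"
  have M: "prob_space M"
    by standard (simp add: M_def emeasure_density ennreal_indicator)
  have "v (x + s *\<^sub>R z) - v x = (\<integral>\<tau>. D (x + \<tau> *\<^sub>R (s *\<^sub>R z)) \<bullet> (s *\<^sub>R z) \<partial>M)" for x
  proof -
    have "(\<integral>\<tau>. indicator {0..1} \<tau> *\<^sub>R (D (x + \<tau> *\<^sub>R (s *\<^sub>R z)) \<bullet> (s *\<^sub>R z)) \<partial>lborel) =
        v (x + 1 *\<^sub>R (s *\<^sub>R z)) - v (x + 0 *\<^sub>R (s *\<^sub>R z))"
    proof (rule integral_FTC_Icc)
      show "((\<lambda>\<tau>. v (x + \<tau> *\<^sub>R (s *\<^sub>R z))) has_vector_derivative D (x + \<tau> *\<^sub>R (s *\<^sub>R z)) \<bullet> (s *\<^sub>R z)) (at \<tau> within {0..1})" for \<tau>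
        using C1_gradient_has_real_derivative[OF v] by (simp only: has_real_derivative_iff_has_vector_derivative)
      show "continuous_on {0..1} (\<lambda>\<tau>. D (x + \<tau> *\<^sub>R (s *\<^sub>R z)) \<bullet> (s *\<^sub>R z))"
        by (intro continuous_intros continuous_on_compose2[OF C1_gradientD(2)[OF v]]) auto
    qed simp
    then show ?thesis
      unfolding M_def by (subst integral_density) auto
  qed
  then have "Wp p v (s *\<^sub>R z) = Ip p (\<lambda>x. \<integral>\<tau>. D (x + \<tau> *\<^sub>R (s *\<^sub>R z)) \<bullet> (s *\<^sub>R z) \<partial>M)"
    by (simp add: Wp_def)
  also have "\<dots> \<le> Ip p (\<lambda>x. D x \<bullet> (s *\<^sub>R z))"
    by (rule Ip_average_translate_le[OF p M, of "\<lambda>x. D x \<bullet> (s *\<^sub>R z)"]) (auto simp: M_def)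
  also have "\<dots> = ennreal (s powr p) * Ip p (\<lambda>x. D x \<bullet> z)"
    using Ip_scaleR[of "\<lambda>x. D x \<bullet> z" p s] s by simp
  finally show ?thesis .
qed

text \<open>Fatou's lemma for the difference quotients along the scales 1 / (k + 1).\<close>

lemma Ip_C1_le_Lsup:
  assumes p: "1 \<le> p" and v: "C1_gradient v D"
  shows "Ip p (\<lambda>x. D x \<bullet> z) \<le> Lsup p v z"
proof -
  note [measurable] = C1_gradientD(4,5)[OF v]
  define s where "s k = inverse (real (Suc k))" for k
  have s: "0 < s k" for k by (simp add: s_def)
  have s0: "s \<longlonglongrightarrow> 0" unfolding s_def by (rule LIMSEQ_inverse_real_of_nat)
  have "(\<lambda>k. ennreal (s k powr - p) * ennreal (norm (v (x + s k *\<^sub>R z) - v x) powr p)) \<longlonglongrightarrow> ennreal (norm (D x \<bullet> z) powr p)" for x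
  proof -
    have "((\<lambda>h. (v (x + h *\<^sub>R z) - v x) / h) \<longlongrightarrow> D x \<bullet> z) (at 0)"
      using C1_gradient_has_real_derivative[OF v, of x z 0 UNIV] by (simp add: DERIV_def)
    moreover have "filterlim s (at 0) sequentially"
      using s0 s by (auto simp: filterlim_at intro!: always_eventually) (metis less_irrefl)
    ultimately have "(\<lambda>k. (v (x + s k *\<^sub>R z) - v x) / s k) \<longlonglongrightarrow> D x \<bullet> z"
      by (rule filterlim_compose)
    then have "(\<lambda>k. norm ((v (x + s k *\<^sub>R z) - v x) / s k)) \<longlonglongrightarrow> norm (D x \<bullet> z)"
      by (rule tendsto_norm)
    then have "(\<lambda>k. norm ((v (x + s k *\<^sub>R z) - v x) / s k) powr p) \<longlonglongrightarrow> norm (D x \<bullet> z) powr p"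
      by (rule tendsto_powr'[OF _ tendsto_const]) (use p in auto)
    moreover have "norm ((v (x + s k *\<^sub>R z) - v x) / s k) powr p = s k powr - p * norm (v (x + s k *\<^sub>R z) - v x) powr p" for k
      using s[of k] by (simp add: powr_divide powr_minus field_simps)
    ultimately show ?thesis
      by (simp add: ennreal_mult[symmetric])
  qed
  then have "Ip p (\<lambda>x. D x \<bullet> z) = (\<integral>\<^sup>+x. liminf (\<lambda>k. ennreal (s k powr - p) * ennreal (norm (v (x + s k *\<^sub>R z) - v x) powr p)) \<partial>lborel)"
    unfolding Ip_def by (intro nn_integral_cong lim_imp_Liminf[symmetric]) auto
  also have "\<dots> \<le> liminf (\<lambda>k. \<integral>\<^sup>+x. ennreal (s k powr - p) * ennreal (norm (v (x + s k *\<^sub>R z) - v x) powr p) \<partial>lborel)"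
    by (rule nn_integral_liminf) measurable
  also have "\<dots> = liminf (\<lambda>k. ennreal (s k powr - p) * Wp p v (s k *\<^sub>R z))"
    unfolding Wp_def Ip_def by (subst nn_integral_cmult) auto
  also have "\<dots> \<le> limsup (\<lambda>k. ennreal (s k powr - p) * Wp p v (s k *\<^sub>R z))"
    by (rule Liminf_le_Limsup) simp
  also have "\<dots> \<le> Lsup p v z"
    by (intro Limsup_bounded always_eventually allI Lsup_upper s)
  finally show ?thesis .
qed

lemma Lsup_C1:
  assumes p: "1 \<le> p" and v: "C1_gradient v D"
  shows "Lsup p v z = Ip p (\<lambda>x. D x \<bullet> z)"
proof (rule antisym[OF _ Ip_C1_le_Lsup[OF p v]])
  show "Lsup p v z \<le> Ip p (\<lambda>x. D x \<bullet> z)"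
    unfolding Lsup_def
  proof (rule SUP_least)
    fix s :: real assume "s \<in> {0<..}"
    then have s: "0 < s" by simp
    have "ennreal (s powr - p) * Wp p v (s *\<^sub>R z) \<le> ennreal (s powr - p) * (ennreal (s powr p) * Ip p (\<lambda>x. D x \<bullet> z))"
      by (intro mult_left_mono Wp_C1_le[OF p v s]) simp
    also have "\<dots> = Ip p (\<lambda>x. D x \<bullet> z)"
      using s by (simp add: mult.assoc[symmetric] ennreal_mult[symmetric] powr_add[symmetric])
    finally show "ennreal (s powr - p) * Wp p v (s *\<^sub>R z) \<le> Ip p (\<lambda>x. D x \<bullet> z)" .
  qed
qed

text \<open>After exchanging the integrals, the inner one is for each \<open>x\<close> the Gaussian
  moment of the linear form z \<mapsto> D x \<bullet> z.\<close>

lemma Lam_C1: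
  assumes p: "1 \<le> p" and v: "C1_gradient v D"
  shows "Lam p v = ennreal (heat_const p) * Ip p D"
proof -
  note [measurable] = C1_gradientD(4,5)[OF v]
  have "Lam p v = (\<integral>\<^sup>+z. \<integral>\<^sup>+x. ennreal (gauss z) * ennreal (norm (D x \<bullet> z) powr p) \<partial>lborel \<partial>lborel)"
    unfolding Lam_def Lsup_C1[OF p v] Ip_def by (intro nn_integral_cong nn_integral_cmult[symmetric]) measurable
  also have "\<dots> = (\<integral>\<^sup>+x. \<integral>\<^sup>+z. ennreal (gauss z) * ennreal (norm (D x \<bullet> z) powr p) \<partial>lborel \<partial>lborel)"
    by (rule lborel_pair.Fubini') measurable
  also have "\<dots> = (\<integral>\<^sup>+x. ennreal (heat_const p) * ennreal (norm (D x) powr p) \<partial>lborel)"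
    by (intro nn_integral_cong nn_integral_gauss_inner_powr p)
  also have "\<dots> = ennreal (heat_const p) * Ip p D"
    unfolding Ip_def by (rule nn_integral_cmult) measurable
  finally show ?thesis .
qed

section \<open>Mollification\<close>

text \<open>Squaring makes the truncated paraboloid continuously differentiable across the sphere of
  radius \<open>e\<close>. C^1 is all the regularity that the test space asks for, and the
  second-order remainder can be bounded by polynomial algebra.\<close>

definition bump :: "real \<Rightarrow> 'a::euclidean_space \<Rightarrow> real" where
  "bump e x = (max 0 (e\<^sup>2 - (norm x)\<^sup>2))\<^sup>2"

definition bump_grad :: "real \<Rightarrow> 'a::euclidean_space \<Rightarrow> 'a" where
  "bump_grad e x = (-4 * max 0 (e\<^sup>2 - (norm x)\<^sup>2)) *\<^sub>R x"

lemma continuous_on_bump [continuous_intros]: "continuous_on UNIV (bump e)"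
  unfolding bump_def by (intro continuous_intros)

lemma continuous_on_bump_grad: "continuous_on UNIV (bump_grad e)"
  unfolding bump_grad_def by (intro continuous_intros)

lemma bump_nonneg [simp]: "0 \<le> bump e x"
  by (simp add: bump_def)

lemma bump_minus [simp]: "bump e (- x) = bump e x" "bump_grad e (- x) = - bump_grad e x"
  by (simp_all add: bump_def bump_grad_def)

lemma bump_eq_0:
  assumes "0 < e" "e \<le> norm x"
  shows "bump e x = 0" "bump_grad e x = 0"
proof -
  have "e\<^sup>2 \<le> (norm x)\<^sup>2" using assms by (intro power_mono) auto
  then show "bump e x = 0" "bump_grad e x = 0" by (simp_all add: bump_def bump_grad_def max_def)
qed

lemma bump_bounds:
  assumes e: "0 < e"
  shows "bump e x \<le> e ^ 4" "norm (bump_grad e x) \<le> 4 * e ^ 3"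
proof -
  have P: "0 \<le> max 0 (e\<^sup>2 - (norm x)\<^sup>2)" "max 0 (e\<^sup>2 - (norm x)\<^sup>2) \<le> e\<^sup>2" by auto
  have "bump e x \<le> (e\<^sup>2)\<^sup>2" unfolding bump_def using P by (intro power_mono) auto
  then show "bump e x \<le> e ^ 4" by simp
  show "norm (bump_grad e x) \<le> 4 * e ^ 3"
  proof (cases "e \<le> norm x")
    case False
    have "norm (bump_grad e x) = 4 * max 0 (e\<^sup>2 - (norm x)\<^sup>2) * norm x"
      by (simp add: bump_grad_def)
    also have "\<dots> \<le> 4 * e\<^sup>2 * e" using P False e by (intro mult_mono) auto
    finally show ?thesis by (simp add: power3_eq_cube power2_eq_square)
  next
    case True
    then show ?thesis using bump_eq_0[OF e True] e by simp
  qed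
qed

text \<open>A quadratic remainder bound uniform in \<open>x\<close>, as needed to differentiate a
  convolution under the integral. Beyond radius e + 1 all three terms vanish, since |h| \<le>
  1.\<close>

lemma bump_taylor:
  fixes x h :: "'a::euclidean_space"
  assumes e: "0 < e" and h: "norm h \<le> 1"
  shows "\<bar>bump e (x + h) - bump e x - bump_grad e x \<bullet> h\<bar> \<le> ((2 * e + 3)\<^sup>2 + 2 * e\<^sup>2) * (norm h)\<^sup>2"
proof (cases "e + 1 \<le> norm x")
  case True
  have "norm x \<le> norm (x + h) + norm h" using norm_triangle_ineq4[of "x + h" h] by simp
  then have "e \<le> norm (x + h)" using True h by linarith
  then show ?thesis using True bump_eq_0[OF e, of x] bump_eq_0[OF e, of "x + h"] by simp
next
  case False
  define u where "u = e\<^sup>2 - (norm x)\<^sup>2"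
  define v where "v = e\<^sup>2 - (norm (x + h))\<^sup>2"
  have vu: "v - u = - 2 * (x \<bullet> h) - (norm h)\<^sup>2"
    by (simp add: u_def v_def power2_norm_eq_inner inner_add_left inner_add_right inner_commute)
  \<comment> \<open>First-order expansion of u \<mapsto> (max 0 u)^2, whose derivative 2 max 0 u is
    Lipschitz with constant 2.\<close>
  have quad: "\<bar>(max 0 v)\<^sup>2 - (max 0 u)\<^sup>2 - 2 * max 0 u * (v - u)\<bar> \<le> (v - u)\<^sup>2"
  proof -
    consider "0 \<le> u" "0 \<le> v" | "0 \<le> u" "v < 0" | "u < 0" "0 \<le> v" | "u < 0" "v < 0" by linarith
    then show ?thesis
    proof cases
      case 1
      have "v\<^sup>2 - u\<^sup>2 - 2 * u * (v - u) = (v - u)\<^sup>2" by (simp add: power2_eq_square algebra_simps)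
      with 1 show ?thesis by simp
    next
      case 2
      then have "(max 0 v)\<^sup>2 - (max 0 u)\<^sup>2 - 2 * max 0 u * (v - u) = u\<^sup>2 + 2 * u * (- v)"
        by (simp add: power2_eq_square algebra_simps)
      moreover have "0 \<le> u * (- v)" using 2 by (intro mult_nonneg_nonneg) auto
      moreover have "(v - u)\<^sup>2 = u\<^sup>2 + 2 * u * (- v) + v\<^sup>2" by (simp add: power2_eq_square algebra_simps)
      moreover have "0 \<le> u\<^sup>2" "0 \<le> v\<^sup>2" by auto
      ultimately show ?thesis by linarith
    next
      case 3
      then have "v\<^sup>2 \<le> (v - u)\<^sup>2" by (intro power_mono) auto
      with 3 show ?thesis by simp
    qed simp
  qed
  \<comment> \<open>2e + 3 = 2 (e + 1) + 1, from |x| < e + 1 and |h|^2 \<le> |h|.\<close>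
  have "\<bar>v - u\<bar> \<le> (2 * e + 3) * norm h"
  proof -
    have "\<bar>v - u\<bar> \<le> 2 * \<bar>x \<bullet> h\<bar> + (norm h)\<^sup>2" unfolding vu using zero_le_power2[of "norm h"] by linarith
    also have "\<dots> \<le> 2 * (norm x * norm h) + 1 * norm h"
      using Cauchy_Schwarz_ineq2[of x h] h
      by (intro add_mono mult_left_mono) (auto simp: power2_eq_square mult_left_le)
    also have "\<dots> \<le> 2 * ((e + 1) * norm h) + 1 * norm h"
      using False by (intro add_mono mult_left_mono mult_right_mono) auto
    finally show ?thesis by (simp add: algebra_simps)
  qed
  then have sq: "(v - u)\<^sup>2 \<le> (2 * e + 3)\<^sup>2 * (norm h)\<^sup>2"
    using e by (metis abs_ge_zero power2_abs power_mono power_mult_distrib)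
  have eq: "bump e (x + h) - bump e x - bump_grad e x \<bullet> h =
      ((max 0 v)\<^sup>2 - (max 0 u)\<^sup>2 - 2 * max 0 u * (v - u)) - 2 * max 0 u * (norm h)\<^sup>2"
    unfolding vu by (simp add: bump_def bump_grad_def u_def v_def algebra_simps)
  have "\<bar>bump e (x + h) - bump e x - bump_grad e x \<bullet> h\<bar> \<le> (v - u)\<^sup>2 + 2 * max 0 u * (norm h)\<^sup>2"
    unfolding eq using quad abs_triangle_ineq4[of "(max 0 v)\<^sup>2 - (max 0 u)\<^sup>2 - 2 * max 0 u * (v - u)" "2 * max 0 u * (norm h)\<^sup>2"]
    by (simp add: abs_mult)
  also have "\<dots> \<le> (2 * e + 3)\<^sup>2 * (norm h)\<^sup>2 + 2 * e\<^sup>2 * (norm h)\<^sup>2"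
  proof -
    have "max 0 u \<le> e\<^sup>2" by (simp add: u_def)
    then show ?thesis using sq by (intro add_mono mult_right_mono) auto
  qed
  finally show ?thesis by (simp add: algebra_simps)
qed

lemma integrable_bump:
  assumes e: "0 < e"
  shows "integrable lborel (bump e :: 'a::euclidean_space \<Rightarrow> real)"
proof -
  have "integrable lborel (\<lambda>x::'a. indicator (cball 0 e) x *\<^sub>R bump e x)"
    by (intro borel_integrable_compact continuous_on_subset[OF continuous_on_bump]) auto
  moreover have "(\<lambda>x::'a. indicator (cball 0 e) x *\<^sub>R bump e x) = bump e"
  proof
    fix x :: 'a
    show "indicator (cball 0 e) x *\<^sub>R bump e x = bump e x"
      using bump_eq_0(1)[OF e, of x] by (auto simp: indicator_def)
  qed
  ultimately show ?thesis by simp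
qed

text \<open>The type argument supplies the dimension, on which the mass depends.\<close>

definition bump_mass :: "'a::euclidean_space itself \<Rightarrow> real \<Rightarrow> real" where
  "bump_mass _ e = (\<integral>x. bump e (x::'a) \<partial>lborel)"

lemma bump_mass_pos:
  assumes e: "0 < e"
  shows "0 < bump_mass TYPE('a::euclidean_space) e"
proof -
  \<comment> \<open>On the ball of radius e/2 the paraboloid is at least 3/4 e^2.\<close>
  define m where "m = (3 / 4 * e\<^sup>2)\<^sup>2"
  have m: "0 < m" using e by (simp add: m_def)
  have le: "indicator (ball 0 (e / 2)) x * m \<le> bump e x" for x :: 'a
  proof (cases "norm x < e / 2")
    case True
    then have "(norm x)\<^sup>2 \<le> (e / 2)\<^sup>2" by (intro power_mono) auto
    then have "3 / 4 * e\<^sup>2 \<le> e\<^sup>2 - (norm x)\<^sup>2" by (simp add: power_divide)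
    then have "3 / 4 * e\<^sup>2 \<le> max 0 (e\<^sup>2 - (norm x)\<^sup>2)" by (rule max.coboundedI2)
    then have "m \<le> bump e x" unfolding m_def bump_def by (intro power_mono) auto
    then show ?thesis using True by (simp add: indicator_def)
  qed (simp add: indicator_def)
  have "0 < measure lborel (ball (0::'a) (e / 2)) * m"
    using e m content_ball_pos[of "e / 2" "0::'a"] by simp
  also have "\<dots> = (\<integral>x. indicator (ball (0::'a) (e / 2)) x * m \<partial>lborel)"
    by simp
  also have "\<dots> \<le> bump_mass TYPE('a) e"
    unfolding bump_mass_def using integrable_bump[OF e] le
    by (intro integral_mono) (auto intro!: integrable_real_indicator emeasure_bounded_finite[of "ball 0 (e / 2)", simplified])
  finally show ?thesis .
qed

section \<open>The normalised mollifier\<close>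

definition moll :: "real \<Rightarrow> 'a::euclidean_space \<Rightarrow> real" where
  "moll e x = bump e x / bump_mass TYPE('a) e"

definition moll_grad :: "real \<Rightarrow> 'a::euclidean_space \<Rightarrow> 'a" where
  "moll_grad e x = bump_grad e x /\<^sub>R bump_mass TYPE('a) e"

lemma continuous_on_moll: "continuous_on UNIV (moll e)" "continuous_on UNIV (moll_grad e)"
  unfolding moll_def moll_grad_def divide_inverse
  by (intro continuous_intros continuous_on_bump continuous_on_bump_grad)+

lemma moll_measurable [measurable]:
  "moll e \<in> borel_measurable borel" "moll_grad e \<in> borel_measurable borel"
  using continuous_on_moll[of e] by (auto intro: borel_measurable_continuous_onI)

lemma moll_nonneg: "0 < e \<Longrightarrow> 0 \<le> moll e (x::'a::euclidean_space)"
  using bump_mass_pos[of e, where 'a='a] by (simp add: moll_def)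

lemma moll_minus [simp]: "moll e (- x) = moll e x" "moll_grad e (- x) = - moll_grad e x"
  by (simp_all add: moll_def moll_grad_def)

lemma moll_eq_0:
  assumes "0 < e" "e \<le> norm x"
  shows "moll e x = 0" "moll_grad e x = 0"
  using bump_eq_0[OF assms] by (simp_all add: moll_def moll_grad_def)

lemma moll_bounded:
  assumes e: "0 < e"
  obtains B where "0 < B" "\<And>x::'a::euclidean_space. \<bar>moll e x\<bar> \<le> B" "\<And>x::'a. norm (moll_grad e x) \<le> B"
proof
  let ?m = "bump_mass TYPE('a) e"
  note m = bump_mass_pos[OF e, where 'a='a]
  let ?B = "(e ^ 4 + 4 * e ^ 3) / ?m"
  have nn: "0 \<le> e ^ 4" "0 \<le> 4 * e ^ 3" "0 < e ^ 4" using e by auto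
  show "0 < ?B" using m nn by (intro divide_pos_pos add_pos_nonneg)
  show "\<bar>moll e x\<bar> \<le> ?B" for x :: 'a
  proof -
    have "\<bar>moll e x\<bar> = bump e x / ?m" using m by (simp add: moll_def)
    also have "\<dots> \<le> ?B"
      using add_mono[OF bump_bounds(1)[OF e, of x] nn(2)] add_mono[OF nn(1) bump_bounds(2)[OF e, of x]] m
      by (intro divide_right_mono) auto
    finally show ?thesis .
  qed
  show "norm (moll_grad e x) \<le> ?B" for x :: 'a
  proof -
    have "norm (moll_grad e x) = norm (bump_grad e x) / ?m" using m by (simp add: moll_grad_def divide_inverse mult.commute)
    also have "\<dots> \<le> ?B"
      using add_mono[OF bump_bounds(1)[OF e, of x] nn(2)] add_mono[OF nn(1) bump_bounds(2)[OF e, of x]] m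
      by (intro divide_right_mono) auto
    finally show ?thesis .
  qed
qed

lemma moll_taylor:
  assumes e: "0 < e"
  obtains K where "0 \<le> K" "\<And>x h::'a::euclidean_space. norm h \<le> 1 \<Longrightarrow>
    \<bar>moll e (x + h) - moll e x - moll_grad e x \<bullet> h\<bar> \<le> K * (norm h)\<^sup>2"
proof
  let ?m = "bump_mass TYPE('a) e"
  note m = bump_mass_pos[OF e, where 'a='a]
  let ?K = "((2 * e + 3)\<^sup>2 + 2 * e\<^sup>2) / ?m"
  show "0 \<le> ?K" using m by (intro divide_nonneg_pos) auto
  show "\<bar>moll e (x + h) - moll e x - moll_grad e x \<bullet> h\<bar> \<le> ?K * (norm h)\<^sup>2"
    if h: "norm h \<le> 1" for x h :: 'a
  proof -
    have "moll e (x + h) - moll e x - moll_grad e x \<bullet> h = (bump e (x + h) - bump e x - bump_grad e x \<bullet> h) / ?m"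
      using m by (simp add: moll_def moll_grad_def divide_inverse algebra_simps)
    then have "\<bar>moll e (x + h) - moll e x - moll_grad e x \<bullet> h\<bar> = \<bar>bump e (x + h) - bump e x - bump_grad e x \<bullet> h\<bar> / ?m"
      using m by (simp add: abs_divide)
    also have "\<dots> \<le> ((2 * e + 3)\<^sup>2 + 2 * e\<^sup>2) * (norm h)\<^sup>2 / ?m"
      using bump_taylor[OF e h, of x] m by (intro divide_right_mono) auto
    finally show ?thesis by simp
  qed
qed

lemma integrable_moll:
  assumes "0 < e"
  shows "integrable lborel (moll e :: 'a::euclidean_space \<Rightarrow> real)" "(\<integral>x. moll e (x::'a) \<partial>lborel) = 1"
  using integrable_bump[OF assms, where 'a='a] bump_mass_pos[OF assms, where 'a='a]
  by (simp_all add: moll_def[abs_def] bump_mass_def)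

text \<open>The mollifier as a probability measure, so that the averaging inequalities apply to
  convolutions.\<close>

definition mollM :: "real \<Rightarrow> 'a::euclidean_space measure" where
  "mollM e = density lborel (\<lambda>x. ennreal (moll e x))"

lemma sets_mollM [simp, measurable_cong]: "sets (mollM e) = sets borel"
  and space_mollM [simp]: "space (mollM e) = UNIV"
  by (simp_all add: mollM_def)

lemma prob_space_mollM:
  assumes e: "0 < e"
  shows "prob_space (mollM e :: 'a::euclidean_space measure)"
proof
  have "emeasure (mollM e) (UNIV :: 'a set) = (\<integral>\<^sup>+x. ennreal (moll e (x::'a)) \<partial>lborel)"
    unfolding mollM_def by (subst emeasure_density) auto
  also have "\<dots> = 1"
    using integrable_moll[OF e, where 'a='a] moll_nonneg[OF e] by (subst nn_integral_eq_integral) auto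
  finally show "emeasure (mollM e :: 'a measure) (space (mollM e)) = 1" by simp
qed

lemma integral_mollM:
  fixes g :: "'a::euclidean_space \<Rightarrow> 'b::{banach, second_countable_topology}"
  assumes e: "0 < e" and "g \<in> borel_measurable borel"
  shows "(\<integral>y. g y \<partial>mollM e) = (\<integral>y. moll e y *\<^sub>R g y \<partial>lborel)"
  unfolding mollM_def using assms moll_nonneg[OF e] by (intro integral_density) auto

section \<open>Local integrability and compactly supported kernels\<close>

lemma integrable_indicator_cball: "integrable lborel (\<lambda>x::'a::euclidean_space. indicator (cball 0 R) x :: real)"
  using emeasure_bounded_finite[of "cball (0::'a) R"] by (intro integrable_real_indicator) auto

definition loc_int :: "('a::euclidean_space \<Rightarrow> 'b::euclidean_space) \<Rightarrow> bool" where
  "loc_int u \<longleftrightarrow> (\<forall>R. integrable lborel (\<lambda>x. indicator (cball 0 R) x *\<^sub>R u x))"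

lemma loc_intD: "loc_int u \<Longrightarrow> integrable lborel (\<lambda>x. indicator (cball 0 R) x *\<^sub>R norm (u x))"
  unfolding loc_int_def using integrable_norm[of lborel "\<lambda>x. indicator (cball 0 R) x *\<^sub>R u x"] by simp

lemma integrable_of_loc_int:
  fixes u :: "'a::euclidean_space \<Rightarrow> 'b::euclidean_space" and F :: "'a \<Rightarrow> 'c::euclidean_space"
  assumes u: "loc_int u" and F: "F \<in> borel_measurable borel"
    and bound: "\<And>y. norm (F y) \<le> B * norm (u y)" and supp: "\<And>y. R < norm y \<Longrightarrow> F y = 0"
  shows "integrable lborel F"
proof (rule Bochner_Integration.integrable_bound)
  show "integrable lborel (\<lambda>y. B * (indicator (cball 0 R) y *\<^sub>R norm (u y)))"
    by (intro integrable_mult_right loc_intD u)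
  show "F \<in> borel_measurable lborel" using F by simp
  show "AE y in lborel. norm (F y) \<le> norm (B * (indicator (cball 0 R) y *\<^sub>R norm (u y)))"
  proof (rule AE_I2)
    fix y
    show "norm (F y) \<le> norm (B * (indicator (cball 0 R) y *\<^sub>R norm (u y)))"
      using bound[of y] supp[of y] by (cases "R < norm y") (auto simp: indicator_def)
  qed
qed

lemma loc_int_of_Ip:
  fixes u :: "'a::euclidean_space \<Rightarrow> 'b::euclidean_space"
  assumes p: "1 \<le> p" and [measurable]: "u \<in> borel_measurable borel" and fin: "Ip p u < \<infinity>"
  shows "loc_int u"
  unfolding loc_int_def
proof
  fix R
  have ip: "integrable lborel (\<lambda>x. norm (u x) powr p)"
    using fin by (intro integrableI_bounded) (auto simp: Ip_def)
  show "integrable lborel (\<lambda>x. indicator (cball 0 R) x *\<^sub>R u x)"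
  proof (rule Bochner_Integration.integrable_bound)
    show "integrable lborel (\<lambda>x. indicator (cball 0 R) x + norm (u x) powr p)"
      by (rule Bochner_Integration.integrable_add[OF integrable_indicator_cball ip])
    show "AE x in lborel. norm (indicator (cball 0 R) x *\<^sub>R u x) \<le> norm (indicator (cball 0 R) x + norm (u x) powr p)"
    proof (rule AE_I2)
      fix x
      show "norm (indicator (cball 0 R) x *\<^sub>R u x) \<le> norm (indicator (cball 0 R) x + norm (u x) powr p)"
        using le_one_plus_powr[OF p, of "norm (u x)"] by (simp add: indicator_def)
    qed
    show "(\<lambda>x. indicator (cball 0 R) x *\<^sub>R u x) \<in> borel_measurable lborel"
      by (auto intro!: borel_measurable_scaleR borel_measurable_indicator)
  qed
qed

lemma integrable_kernel:
  fixes u :: "'a::euclidean_space \<Rightarrow> 'b::euclidean_space" and k :: "'a \<Rightarrow> real"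
  assumes u: "loc_int u" and [measurable]: "u \<in> borel_measurable borel" "k \<in> borel_measurable borel"
    and B: "\<And>z. \<bar>k z\<bar> \<le> B" and supp: "\<And>z. e \<le> norm z \<Longrightarrow> k z = 0"
  shows "integrable lborel (\<lambda>y. k (x - y) *\<^sub>R u y)"
proof (rule integrable_of_loc_int[OF u])
  show "norm (k (x - y) *\<^sub>R u y) \<le> B * norm (u y)" for y
    using B[of "x - y"] by (simp add: mult_right_mono)
  show "k (x - y) *\<^sub>R u y = 0" if "norm x + e < norm y" for y
    using norm_triangle_ineq2[of y x] that by (simp add: supp norm_minus_commute)
qed measurable

lemma continuous_on_kernel:
  fixes u :: "'a::euclidean_space \<Rightarrow> 'b::euclidean_space" and k :: "'a \<Rightarrow> real"
  assumes u: "loc_int u" and [measurable]: "u \<in> borel_measurable borel" and k: "continuous_on UNIV k"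
    and B: "\<And>z. \<bar>k z\<bar> \<le> B" and supp: "\<And>z. e \<le> norm z \<Longrightarrow> k z = 0"
  shows "continuous_on UNIV (\<lambda>x. \<integral>y. k (x - y) *\<^sub>R u y \<partial>lborel)"
  unfolding continuous_on_sequentially
proof safe
  fix X :: "nat \<Rightarrow> 'a" and x assume X: "X \<longlonglongrightarrow> x"
  have [measurable]: "k \<in> borel_measurable borel" using k by (rule borel_measurable_continuous_onI)
  obtain C where C: "\<And>n. norm (X n) \<le> C"
    using convergent_imp_Bseq[OF convergentI[OF X]] by (auto simp: Bseq_def)
  show "((\<lambda>x. \<integral>y. k (x - y) *\<^sub>R u y \<partial>lborel) \<circ> X) \<longlonglongrightarrow> (\<integral>y. k (x - y) *\<^sub>R u y \<partial>lborel)"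
    unfolding comp_def
  proof (rule integral_dominated_convergence[where w="\<lambda>y. B * (indicator (cball 0 (C + e)) y *\<^sub>R norm (u y))"])
    show "integrable lborel (\<lambda>y. B * (indicator (cball 0 (C + e)) y *\<^sub>R norm (u y)))"
      by (intro integrable_mult_right loc_intD u)
    show "AE y in lborel. (\<lambda>n. k (X n - y) *\<^sub>R u y) \<longlonglongrightarrow> k (x - y) *\<^sub>R u y"
    proof (rule AE_I2)
      fix y
      have "(\<lambda>n. k (X n - y)) \<longlonglongrightarrow> k (x - y)"
        by (rule continuous_on_tendsto_compose[OF k]) (auto intro!: tendsto_intros X)
      then show "(\<lambda>n. k (X n - y) *\<^sub>R u y) \<longlonglongrightarrow> k (x - y) *\<^sub>R u y"
        by (intro tendsto_intros)
    qed
    show "AE y in lborel. norm (k (X n - y) *\<^sub>R u y) \<le> B * (indicator (cball 0 (C + e)) y *\<^sub>R norm (u y))" for n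
    proof (rule AE_I2)
      fix y
      show "norm (k (X n - y) *\<^sub>R u y) \<le> B * (indicator (cball 0 (C + e)) y *\<^sub>R norm (u y))"
      proof (cases "C + e < norm y")
        case True
        then have "e \<le> norm (X n - y)"
          using norm_triangle_ineq2[of y "X n"] C[of n] by (simp add: norm_minus_commute)
        then show ?thesis using True by (simp add: supp)
      next
        case False
        then show ?thesis using B[of "X n - y"] by (simp add: mult_right_mono)
      qed
    qed
  qed auto
qed

section \<open>Convolution with the mollifier and its derivative\<close>

definition conv :: "real \<Rightarrow> ('a::euclidean_space \<Rightarrow> 'b::euclidean_space) \<Rightarrow> 'a \<Rightarrow> 'b" where
  "conv e u x = (\<integral>y. moll e (x - y) *\<^sub>R u y \<partial>lborel)"

definition conv_deriv :: "real \<Rightarrow> ('a::euclidean_space \<Rightarrow> 'b::euclidean_space) \<Rightarrow> 'a \<Rightarrow> 'a \<Rightarrow> 'b" where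
  "conv_deriv e u x h = (\<integral>y. (moll_grad e (x - y) \<bullet> h) *\<^sub>R u y \<partial>lborel)"

lemma moll_grad_inner_bounded:
  assumes e: "0 < e"
  obtains B where "\<And>z::'a::euclidean_space. \<bar>moll_grad e z \<bullet> h\<bar> \<le> B"
proof -
  obtain B where B: "\<And>z::'a. norm (moll_grad e z) \<le> B"
    by (rule moll_bounded[OF e, where 'a='a]) blast
  have "\<bar>moll_grad e z \<bullet> h\<bar> \<le> B * norm h" for z
    by (rule order_trans[OF Cauchy_Schwarz_ineq2]) (intro mult_right_mono B, simp)
  then show ?thesis using that by blast
qed

lemma integrable_conv:
  assumes e: "0 < e" and u: "loc_int u" "u \<in> borel_measurable borel"
  shows "integrable lborel (\<lambda>y. moll e (x - y) *\<^sub>R u y)"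
    "integrable lborel (\<lambda>y. (moll_grad e (x - y) \<bullet> h) *\<^sub>R u y)"
proof -
  obtain B where B: "\<And>x. \<bar>moll e (x :: 'a)\<bar> \<le> B" by (rule moll_bounded[OF e, where 'a='a]) blast
  show "integrable lborel (\<lambda>y. moll e (x - y) *\<^sub>R u y)"
    by (rule integrable_kernel[OF u _ B moll_eq_0(1)[OF e]]) measurable
  obtain B' where B': "\<And>z. \<bar>moll_grad e z \<bullet> h\<bar> \<le> B'" by (rule moll_grad_inner_bounded[OF e, of h]) blast
  show "integrable lborel (\<lambda>y. (moll_grad e (x - y) \<bullet> h) *\<^sub>R u y)"
    by (rule integrable_kernel[where e=e, OF u _ B']) (auto simp: moll_eq_0(2)[OF e])
qed

lemma continuous_on_conv_deriv:
  assumes e: "0 < e" and u: "loc_int u" "u \<in> borel_measurable borel"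
  shows "continuous_on UNIV (\<lambda>x. conv_deriv e u x h)"
proof -
  obtain B where B: "\<And>z. \<bar>moll_grad e z \<bullet> h\<bar> \<le> B" by (rule moll_grad_inner_bounded[OF e, of h]) blast
  show ?thesis unfolding conv_deriv_def
    by (rule continuous_on_kernel[where e=e, OF u _ B])
       (auto simp: moll_eq_0(2)[OF e] intro!: continuous_intros continuous_on_moll)
qed

lemma linear_conv_deriv:
  assumes e: "0 < e" and u: "loc_int u" "u \<in> borel_measurable borel"
  shows "linear (conv_deriv e u x)"
proof (rule linearI)
  fix h k :: 'a and c :: real
  show "conv_deriv e u x (h + k) = conv_deriv e u x h + conv_deriv e u x k"
    unfolding conv_deriv_def inner_add_right scaleR_add_left
    by (intro Bochner_Integration.integral_add integrable_conv[OF e u])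
  show "conv_deriv e u x (c *\<^sub>R h) = c *\<^sub>R conv_deriv e u x h"
    unfolding conv_deriv_def by (simp flip: scaleR_scaleR)
qed

text \<open>The uniform Taylor bound replaces dominated convergence: the remainder is at most K
  |h|^2 times the integral of |u| over one fixed ball, and this works for merely locally integrable
  \<open>u\<close>.\<close>

lemma has_derivative_conv:
  fixes u :: "'a::euclidean_space \<Rightarrow> 'b::euclidean_space"
  assumes e: "0 < e" and u: "loc_int u" and um[measurable]: "u \<in> borel_measurable borel"
  shows "(conv e u has_derivative conv_deriv e u x) (at x)"
proof -
  obtain K where K: "0 \<le> K" and taylor: "\<And>x h::'a. norm h \<le> 1 \<Longrightarrow>
      \<bar>moll e (x + h) - moll e x - moll_grad e x \<bullet> h\<bar> \<le> K * (norm h)\<^sup>2"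
    using moll_taylor[OF e, where 'a='a] by blast
  \<comment> \<open>For |h| \<le> 1 the kernel at \<open>x\<close>, its translate by
    \<open>h\<close> and its gradient all vanish outside this radius.\<close>
  define R where "R = norm x + e + 1"
  define M where "M = (\<integral>y. indicator (cball 0 R) y *\<^sub>R norm (u y) \<partial>lborel)"
  show ?thesis
  proof (rule has_derivativeI_sandwich[of 1])
    show "bounded_linear (conv_deriv e u x)"
      using linear_conv_deriv[OF e u um] by (simp add: linear_conv_bounded_linear)
    have "((\<lambda>y. K * M * norm (y - x)) \<longlongrightarrow> K * M * norm (x - x)) (at x)"
      by (intro tendsto_intros)
    then show "((\<lambda>y. K * M * norm (y - x)) \<longlongrightarrow> 0) (at x)" by simp
    fix y assume y: "y \<noteq> x" "dist y x < 1"
    define h where "h = y - x"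
    have h: "h \<noteq> 0" "norm h \<le> 1" "y = x + h" using y by (auto simp: h_def dist_norm)
    let ?r = "\<lambda>w. moll e (x - w + h) - moll e (x - w) - moll_grad e (x - w) \<bullet> h"
    have r: "\<bar>?r w\<bar> \<le> K * (norm h)\<^sup>2 * indicator (cball 0 R) w" for w
    proof (cases "R < norm w")
      case True
      have 1: "norm w - norm x \<le> norm (x - w)"
        using norm_triangle_ineq2[of w x] by (simp add: norm_minus_commute)
      have 2: "norm (x - w) - norm h \<le> norm (x - w + h)"
        using norm_triangle_ineq2[of "x - w" "- h"] by simp
      have "e \<le> norm (x - w)" "e \<le> norm (x - w + h)"
        using True 1 2 h by (auto simp: R_def)
      then show ?thesis using True by (simp add: moll_eq_0[OF e])
    next
      case False
      then show ?thesis using taylor[OF h(2), of "x - w"] by (simp add: indicator_def)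
    qed
    have ir: "integrable lborel (\<lambda>w. ?r w *\<^sub>R u w)"
      using integrable_conv[OF e u um, of "x + h"] integrable_conv[OF e u um, of x]
      by (simp add: scaleR_diff_left algebra_simps)
    have r_eq: "conv e u y - conv e u x - conv_deriv e u x h = (\<integral>w. ?r w *\<^sub>R u w \<partial>lborel)"
      unfolding conv_def conv_deriv_def h(3)
      using integrable_conv[OF e u um, of "x + h"] integrable_conv[OF e u um, of x]
      by (simp add: scaleR_diff_left diff_add_eq)
    have "norm (conv e u y - conv e u x - conv_deriv e u x h) \<le> (\<integral>w. norm (?r w *\<^sub>R u w) \<partial>lborel)"
      unfolding r_eq by (rule integral_norm_bound)
    also have "\<dots> \<le> (\<integral>w. K * (norm h)\<^sup>2 * (indicator (cball 0 R) w *\<^sub>R norm (u w)) \<partial>lborel)"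
    proof (rule integral_mono)
      show "integrable lborel (\<lambda>w. norm (?r w *\<^sub>R u w))" using ir by (rule integrable_norm)
      show "integrable lborel (\<lambda>w. K * (norm h)\<^sup>2 * (indicator (cball 0 R) w *\<^sub>R norm (u w)))"
        by (intro integrable_mult_right loc_intD u)
      show "norm (?r w *\<^sub>R u w) \<le> K * (norm h)\<^sup>2 * (indicator (cball 0 R) w *\<^sub>R norm (u w))" for w
        using mult_right_mono[OF r[of w], of "norm (u w)"] by (simp add: mult.assoc)
    qed
    also have "\<dots> = K * M * (norm h)\<^sup>2" by (simp add: M_def)
    finally have "norm (conv e u y - conv e u x - conv_deriv e u x h) \<le> K * M * (norm h)\<^sup>2" .
    then show "norm (conv e u y - conv e u x - conv_deriv e u x (y - x)) / norm (y - x) \<le> K * M * norm (y - x)"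
      using h by (simp add: h_def[symmetric] divide_le_eq power2_eq_square mult.assoc)
  qed simp
qed

definition conv_grad :: "real \<Rightarrow> ('a::euclidean_space \<Rightarrow> real) \<Rightarrow> 'a \<Rightarrow> 'a" where
  "conv_grad e f x = (\<Sum>b\<in>Basis. conv_deriv e f x b *\<^sub>R b)"

lemma conv_deriv_eq_inner:
  fixes f :: "'a::euclidean_space \<Rightarrow> real"
  assumes e: "0 < e" and f: "loc_int f" "f \<in> borel_measurable borel"
  shows "conv_deriv e f x h = conv_grad e f x \<bullet> h"
proof -
  have "conv_deriv e f x h = conv_deriv e f x (\<Sum>b\<in>Basis. (h \<bullet> b) *\<^sub>R b)"
    by (simp add: euclidean_representation)
  also have "\<dots> = (\<Sum>b\<in>Basis. (h \<bullet> b) *\<^sub>R conv_deriv e f x b)"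
    using linear_conv_deriv[OF e f, of x] by (simp only: linear_sum linear_scale)
  also have "\<dots> = conv_grad e f x \<bullet> h"
    unfolding conv_grad_def inner_sum_left by (intro sum.cong) (auto simp: inner_commute)
  finally show ?thesis .
qed

lemma C1_gradient_conv:
  fixes f :: "'a::euclidean_space \<Rightarrow> real"
  assumes e: "0 < e" and f: "loc_int f" "f \<in> borel_measurable borel"
  shows "C1_gradient (conv e f) (conv_grad e f)"
  unfolding C1_gradient_def
proof safe
  show "(conv e f has_derivative (\<lambda>h. conv_grad e f x \<bullet> h)) (at x)" for x
  proof -
    have "conv_deriv e f x = (\<lambda>h. conv_grad e f x \<bullet> h)"
      by (rule ext) (rule conv_deriv_eq_inner[OF e f])
    then show ?thesis using has_derivative_conv[OF e f, of x] by simp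
  qed
  show "continuous_on UNIV (conv_grad e f)"
    unfolding conv_grad_def by (intro continuous_intros continuous_on_conv_deriv[OF e f])
qed

lemma lborel_distr_reflect:
  fixes x :: "'a::euclidean_space"
  shows "distr lborel borel (\<lambda>z. x - z) = lborel"
  using lborel_affine[of "-1" x] by (simp add: density_1)

text \<open>The kernel form of the convolution carries the derivative, this form carries Jensen's
  inequality. Integrability is recorded so that averages can be subtracted from one another.\<close>

lemma conv_eq_average:
  fixes u :: "'a::euclidean_space \<Rightarrow> 'b::euclidean_space"
  assumes e: "0 < e" and u: "loc_int u" and um[measurable]: "u \<in> borel_measurable borel"
  shows "conv e u x = (\<integral>y. u (x - y) \<partial>mollM e)" "integrable (mollM e) (\<lambda>y. u (x - y))"
proof -
  have "conv e u x = (\<integral>y. moll e (x - y) *\<^sub>R u y \<partial>distr lborel borel (\<lambda>z. x - z))"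
    by (simp add: conv_def lborel_distr_reflect)
  also have "\<dots> = (\<integral>z. moll e z *\<^sub>R u (x - z) \<partial>lborel)"
    by (subst integral_distr) auto
  also have "\<dots> = (\<integral>y. u (x - y) \<partial>mollM e)"
    by (rule integral_mollM[OF e, symmetric]) measurable
  finally show "conv e u x = (\<integral>y. u (x - y) \<partial>mollM e)" .
  have "integrable (distr lborel borel (\<lambda>z. x - z)) (\<lambda>y. moll e (x - y) *\<^sub>R u y)"
    unfolding lborel_distr_reflect by (rule integrable_conv(1)[OF e u um])
  then have "integrable lborel (\<lambda>z. moll e z *\<^sub>R u (x - z))"
    by (subst (asm) integrable_distr_eq) auto
  then show "integrable (mollM e) (\<lambda>y. u (x - y))"
    unfolding mollM_def using moll_nonneg[OF e] by (subst integrable_density) auto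
qed

lemma Ip_conv_le:
  fixes u :: "'a::euclidean_space \<Rightarrow> 'b::euclidean_space"
  assumes p: "1 \<le> p" and e: "0 < e" and u: "loc_int u" and um: "u \<in> borel_measurable borel"
  shows "Ip p (conv e u) \<le> Ip p u"
proof -
  have "conv e u = (\<lambda>x. \<integral>y. u (x + - y) \<partial>mollM e)"
    using conv_eq_average(1)[OF e u um] by auto
  then show ?thesis
    using Ip_average_translate_le[OF p prob_space_mollM[OF e] um, of uminus] by simp
qed

lemma Wp_conv_le:
  fixes f :: "'a::euclidean_space \<Rightarrow> real"
  assumes p: "1 \<le> p" and e: "0 < e" and f: "loc_int f" and fm[measurable]: "f \<in> borel_measurable borel"
  shows "Wp p (conv e f) h \<le> Wp p f h"
proof -
  have eq: "conv e f (x + h) - conv e f x = (\<integral>y. f (x + - y + h) - f (x + - y) \<partial>mollM e)" for x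
    using conv_eq_average[OF e f fm, of "x + h"] conv_eq_average[OF e f fm, of x]
    by (simp add: algebra_simps)
  show ?thesis
    unfolding Wp_def eq
    by (rule Ip_average_translate_le[OF p prob_space_mollM[OF e], of "\<lambda>x. f (x + h) - f x" uminus]) measurable
qed

lemma Lam_conv_le:
  fixes f :: "'a::euclidean_space \<Rightarrow> real"
  assumes "1 \<le> p" "0 < e" "loc_int f" "f \<in> borel_measurable borel"
  shows "Lam p (conv e f) \<le> Lam p f"
  unfolding Lam_def Lsup_def
  by (intro nn_integral_mono mult_left_mono SUP_mono') (auto intro!: Wp_conv_le assms)

lemma Wp_small:
  fixes f :: "'a::euclidean_space \<Rightarrow> real"
  assumes p: "1 \<le> p" and f: "f \<in> borel_measurable borel" and fin: "Ip p f < \<infinity>" and r: "0 < r"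
  obtains d where "0 < d" "\<And>h. norm h < d \<Longrightarrow> Wp p f h \<le> ennreal r"
proof -
  have "\<exists>d>0. \<forall>h. norm h < d \<longrightarrow> Wp p f h \<le> ennreal r"
  proof (rule ccontr)
    assume "\<not> ?thesis"
    then have "\<forall>k. \<exists>h. norm h < inverse (real (Suc k)) \<and> \<not> Wp p f h \<le> ennreal r"
      by (metis inverse_positive_iff_positive of_nat_0_less_iff zero_less_Suc)
    then obtain X where X: "\<And>k. norm (X k) < inverse (real (Suc k))" "\<And>k. \<not> Wp p f (X k) \<le> ennreal r"
      by metis
    have "X \<longlonglongrightarrow> 0"
      by (rule Lim_null_comparison[OF _ LIMSEQ_inverse_real_of_nat]) (intro always_eventually allI less_imp_le X(1))
    from Wp_tendsto_0[OF p f fin this] have "\<forall>\<^sub>F k in sequentially. Wp p f (X k) \<le> ennreal r"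
      by (rule tendsto_0_ennrealD[OF _ r])
    with X(2) show False by auto
  qed
  with that show ?thesis by blast
qed

text \<open>conv f - f averages the increments f(x - y) - f(x) over |y| < e, so its energy is at
  most an average of values of \<open>Wp\<close> near 0.\<close>

lemma conv_tendsto:
  fixes f :: "'a::euclidean_space \<Rightarrow> real"
  assumes p: "1 \<le> p" and fm[measurable]: "f \<in> borel_measurable borel" and fin: "Ip p f < \<infinity>"
    and e: "e \<longlonglongrightarrow> 0" "\<And>k::nat. 0 < e k"
  shows "(\<lambda>k. Ip p (\<lambda>x. conv (e k) f x - f x)) \<longlonglongrightarrow> 0"
proof (rule tendsto_0_ennrealI)
  fix r :: real assume "0 < r"
  note f = loc_int_of_Ip[OF p fm fin]
  obtain d where d: "0 < d" "\<And>h. norm h < d \<Longrightarrow> Wp p f h \<le> ennreal r"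
    using Wp_small[OF p fm fin \<open>0 < r\<close>] by blast
  have "\<forall>\<^sub>F k in sequentially. e k < d" using d(1) by (rule order_tendstoD[OF e(1)])
  then show "\<forall>\<^sub>F k in sequentially. Ip p (\<lambda>x. conv (e k) f x - f x) \<le> ennreal r"
  proof eventually_elim
    case (elim k)
    note ek = e(2)[of k]
    interpret prob_space "mollM (e k) :: 'a measure" by (rule prob_space_mollM[OF ek])
    have eq: "conv (e k) f x - f x = (\<integral>y. f (x + - y) - f x \<partial>mollM (e k))" for x
      using conv_eq_average[OF ek f fm, of x] prob_space by simp
    have "Ip p (\<lambda>x. conv (e k) f x - f x) \<le> (\<integral>\<^sup>+y. Wp p f (- y) \<partial>mollM (e k))"
      unfolding eq Wp_def by (rule Ip_integral_le[OF p]) (unfold_locales, measurable)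
    also have "\<dots> = (\<integral>\<^sup>+y. ennreal (moll (e k) y) * Wp p f (- y) \<partial>lborel)"
      unfolding mollM_def by (rule nn_integral_density) measurable
    also have "\<dots> \<le> (\<integral>\<^sup>+y. ennreal (moll (e k) (y::'a)) * ennreal r \<partial>lborel)"
    proof (rule nn_integral_mono)
      fix y :: 'a
      show "ennreal (moll (e k) y) * Wp p f (- y) \<le> ennreal (moll (e k) y) * ennreal r"
      proof (cases "e k \<le> norm y")
        case True
        then show ?thesis by (simp add: moll_eq_0(1)[OF ek])
      next
        case False
        then show ?thesis using d(2)[of "- y"] elim by (intro mult_left_mono) auto
      qed
    qed
    also have "\<dots> = (\<integral>\<^sup>+y. ennreal r \<partial>(mollM (e k) :: 'a measure))"
      unfolding mollM_def by (rule nn_integral_density[symmetric]) measurable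
    also have "\<dots> = ennreal r" using emeasure_space_1 by simp
    finally show ?case .
  qed
qed

section \<open>Weak gradients\<close>

lemma cball_borel [measurable]: "cball a r \<in> sets borel"
  by simp

section \<open>Integration by parts for continuously differentiable functions\<close>

lemma C1_gradient_vanishes:
  assumes v: "C1_gradient v D" and z: "\<And>x. R < norm x \<Longrightarrow> v x = 0" and x: "R < norm x"
  shows "D x = 0"
proof -
  have "((\<lambda>_. 0::real) has_derivative (\<lambda>h. D x \<bullet> h)) (at x)"
  proof (rule has_derivative_transform_within_open[OF C1_gradientD(1)[OF v]])
    show "open {x. R < norm x}" by (intro open_Collect_less continuous_intros)
  qed (use x z in auto)
  moreover have "((\<lambda>_. 0::real) has_derivative (\<lambda>h. 0)) (at x)" by simp
  ultimately have "(\<lambda>h. D x \<bullet> h) = (\<lambda>h. 0)" by (rule has_derivative_unique)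
  then have "D x \<bullet> D x = 0" by metis
  then show ?thesis by simp
qed

lemma bounded_of_support:
  fixes g :: "'a::euclidean_space \<Rightarrow> 'b::real_normed_vector"
  assumes g: "continuous_on UNIV g" and z: "\<And>x. R < norm x \<Longrightarrow> g x = 0"
  obtains B where "0 < B" "\<And>x. norm (g x) \<le> B"
proof -
  have "compact (g ` cball 0 R)"
    by (intro compact_continuous_image continuous_on_subset[OF g]) auto
  then obtain B where B: "0 < B" "\<forall>y\<in>g ` cball 0 R. norm y \<le> B"
    using compact_imp_bounded bounded_pos by metis
  have "norm (g x) \<le> B" for x
    using B z[of x] by (cases "R < norm x") auto
  with B(1) show ?thesis by (rule that)
qed

lemma integrable_supported:
  fixes g :: "'a::euclidean_space \<Rightarrow> 'b::euclidean_space"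
  assumes g: "g \<in> borel_measurable borel" and B: "\<And>x. norm (g x) \<le> B" and z: "\<And>x. R < norm x \<Longrightarrow> g x = 0"
  shows "integrable lborel g"
proof (rule Bochner_Integration.integrable_bound)
  show "integrable lborel (\<lambda>x. B * indicator (cball (0::'a) R) x)"
    by (intro integrable_mult_right integrable_indicator_cball)
  show "AE x in lborel. norm (g x) \<le> norm (B * indicator (cball 0 R) x)"
  proof (rule AE_I2)
    fix x
    show "norm (g x) \<le> norm (B * indicator (cball 0 R) x)"
      using B[of x] z[of x] by (cases "R < norm x") (auto simp: indicator_def)
  qed
qed (use g in simp)

lemma integral_translate:
  fixes g :: "'a::euclidean_space \<Rightarrow> 'b::{banach, second_countable_topology}"
  assumes "g \<in> borel_measurable borel"
  shows "(\<integral>x. g (x + h) \<partial>lborel) = (\<integral>x. g x \<partial>lborel)"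
proof -
  have "(\<integral>x. g x \<partial>lborel) = (\<integral>x. g x \<partial>distr lborel borel ((+) h))"
    by (simp add: lborel_distr_plus)
  also have "\<dots> = (\<integral>x. g (h + x) \<partial>lborel)"
    by (subst integral_distr) (use assms in auto)
  finally show ?thesis by (simp add: add.commute)
qed

text \<open>Every difference quotient has integral 0 by translation invariance. The mean value bound
  and the bounded support give a common majorant for the passage to the derivative.\<close>

lemma integral_directional_derivative_eq_0:
  assumes v: "C1_gradient v D" and z: "\<And>x. R < norm x \<Longrightarrow> v x = 0"
  shows "(\<integral>x. D x \<bullet> b \<partial>lborel) = 0"
proof -
  note [measurable] = C1_gradientD(4,5)[OF v]
  note Dz = C1_gradient_vanishes[where R=R, OF v z]
  obtain B where B: "0 < B" "\<And>x. norm (D x \<bullet> b) \<le> B"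
    by (rule bounded_of_support[of "\<lambda>x. D x \<bullet> b" R])
       (auto intro!: continuous_intros C1_gradientD(2)[OF v] simp: Dz)
  obtain B0 where B0: "0 < B0" "\<And>x. norm (v x) \<le> B0"
    by (rule bounded_of_support[where R=R, OF C1_gradientD(3)[OF v] z]) auto
  have iv: "integrable lborel v" by (rule integrable_supported[where R=R, OF _ B0(2) z]) measurable
  define s where "s k = inverse (real (Suc k))" for k
  have s: "0 < s k" "s k \<le> 1" for k by (simp_all add: s_def field_simps)
  have s0: "s \<longlonglongrightarrow> 0" unfolding s_def by (rule LIMSEQ_inverse_real_of_nat)
  let ?q = "\<lambda>k x. (v (x + s k *\<^sub>R b) - v x) / s k"
  have "(\<lambda>k. \<integral>x. ?q k x \<partial>lborel) \<longlonglongrightarrow> (\<integral>x. D x \<bullet> b \<partial>lborel)"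
  proof (rule integral_dominated_convergence[where w="\<lambda>x. B * indicator (cball 0 (R + norm b)) x"])
    show "integrable lborel (\<lambda>x. B * indicator (cball (0::'a) (R + norm b)) x)"
      by (intro integrable_mult_right integrable_indicator_cball)
    show "AE x in lborel. (\<lambda>k. ?q k x) \<longlonglongrightarrow> D x \<bullet> b"
    proof (rule AE_I2)
      fix x
      have "((\<lambda>h. (v (x + h *\<^sub>R b) - v x) / h) \<longlongrightarrow> D x \<bullet> b) (at 0)"
        using C1_gradient_has_real_derivative[OF v, of x b 0 UNIV] by (simp add: DERIV_def)
      moreover have "filterlim s (at 0) sequentially"
        using s0 s by (auto simp: filterlim_at intro!: always_eventually) (metis less_irrefl)
      ultimately show "(\<lambda>k. ?q k x) \<longlonglongrightarrow> D x \<bullet> b"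
        by (rule filterlim_compose)
    qed
    show "AE x in lborel. norm (?q k x) \<le> B * indicator (cball 0 (R + norm b)) x" for k
    proof (rule AE_I2)
      fix x
      show "norm (?q k x) \<le> B * indicator (cball 0 (R + norm b)) x"
      proof (cases "R + norm b < norm x")
        case True
        have "norm x - norm (s k *\<^sub>R b) \<le> norm (x + s k *\<^sub>R b)"
          using norm_triangle_ineq2[of x "- (s k *\<^sub>R b)"] by simp
        moreover have "norm (s k *\<^sub>R b) \<le> 1 * norm b"
          unfolding norm_scaleR using s[of k] by (intro mult_right_mono) auto
        ultimately have "R < norm (x + s k *\<^sub>R b)" using True by simp
        moreover have "R < norm x" using True norm_ge_zero[of b] by linarith
        ultimately show ?thesis using True by (simp add: z)
      next
        case False
        have "norm (v (x + s k *\<^sub>R b) - v (x + 0 *\<^sub>R b)) \<le> B * norm (s k - 0)"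
          by (rule field_differentiable_bound[of UNIV "\<lambda>\<tau>. v (x + \<tau> *\<^sub>R b)"
                "\<lambda>\<tau>. D (x + \<tau> *\<^sub>R b) \<bullet> b", OF _ C1_gradient_has_real_derivative[OF v] B(2)]) auto
        then show ?thesis using False s[of k] by (simp add: divide_le_eq)
      qed
    qed
  qed measurable
  moreover have "(\<integral>x. ?q k x \<partial>lborel) = 0" for k
  proof -
    have "integrable lborel (\<lambda>x. v (x + s k *\<^sub>R b))"
    proof (rule integrable_supported[where R="R + norm (s k *\<^sub>R b)"])
      show "v (x + s k *\<^sub>R b) = 0" if "R + norm (s k *\<^sub>R b) < norm x" for x
        using norm_triangle_ineq2[of x "- (s k *\<^sub>R b)"] that by (intro z) simp
    qed (use B0 in auto)
    then show ?thesis using iv integral_translate[of v "s k *\<^sub>R b"] by simp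
  qed
  ultimately have "(\<lambda>k::nat. 0) \<longlonglongrightarrow> (\<integral>x. D x \<bullet> b \<partial>lborel)" by (simp only:)
  then show ?thesis by (simp add: LIMSEQ_const_iff)
qed

lemma C1_gradient_mult:
  assumes v: "C1_gradient v D" and w: "C1_gradient w E"
  shows "C1_gradient (\<lambda>x. v x * w x) (\<lambda>x. w x *\<^sub>R D x + v x *\<^sub>R E x)"
  unfolding C1_gradient_def
proof safe
  show "((\<lambda>x. v x * w x) has_derivative (\<lambda>h. (w x *\<^sub>R D x + v x *\<^sub>R E x) \<bullet> h)) (at x)" for x
    by (rule has_derivative_eq_rhs[OF has_derivative_mult[OF C1_gradientD(1)[OF v] C1_gradientD(1)[OF w]]])
       (auto simp: inner_add_left algebra_simps)
  show "continuous_on UNIV (\<lambda>x. w x *\<^sub>R D x + v x *\<^sub>R E x)"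
    by (intro continuous_intros C1_gradientD[OF v] C1_gradientD[OF w])
qed

text \<open>The previous vanishing result applied to the product v w, whose support is bounded
  because that of \<open>w\<close> is.\<close>

lemma C1_integration_by_parts:
  assumes v: "C1_gradient v D" and w: "C1_gradient w E" and z: "\<And>x. R < norm x \<Longrightarrow> w x = 0"
  shows "(\<integral>x. v x * (E x \<bullet> b) \<partial>lborel) = - (\<integral>x. (D x \<bullet> b) * w x \<partial>lborel)"
proof -
  note [continuous_intros] = C1_gradientD(2,3)[OF v] C1_gradientD(2,3)[OF w]
  note Ez = C1_gradient_vanishes[where R=R, OF w z]
  have int: "integrable lborel g" if g: "continuous_on UNIV g" and gz: "\<And>x. R < norm x \<Longrightarrow> g x = 0" for g :: "'a \<Rightarrow> real"
  proof -
    obtain B where "\<And>x. norm (g x) \<le> B" using bounded_of_support[where R=R, OF g gz] by metis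
    then show ?thesis by (rule integrable_supported[where R=R, OF borel_measurable_continuous_onI[OF g] _ gz])
  qed
  have i1: "integrable lborel (\<lambda>x. v x * (E x \<bullet> b))"
    by (rule int) (auto intro!: continuous_intros simp: Ez)
  have i2: "integrable lborel (\<lambda>x. (D x \<bullet> b) * w x)"
    by (rule int) (auto intro!: continuous_intros simp: z)
  have "0 = (\<integral>x. (w x *\<^sub>R D x + v x *\<^sub>R E x) \<bullet> b \<partial>lborel)"
    by (rule integral_directional_derivative_eq_0[OF C1_gradient_mult[OF v w], symmetric, where R=R]) (simp add: z)
  also have "\<dots> = (\<integral>x. (D x \<bullet> b) * w x + v x * (E x \<bullet> b) \<partial>lborel)"
    by (simp add: inner_add_left mult.commute)
  also have "\<dots> = (\<integral>x. (D x \<bullet> b) * w x \<partial>lborel) + (\<integral>x. v x * (E x \<bullet> b) \<partial>lborel)"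
    by (rule Bochner_Integration.integral_add[OF i2 i1])
  finally show ?thesis by simp
qed

text \<open>Either \<open>y \<le> d\<close>, or \<open>y = y powr (1 - p) * y powr p\<close> with first factor at most \<open>d powr (1 - p)\<close>.\<close>

lemma le_add_powr:
  fixes y d p :: real
  assumes p: "1 \<le> p" and d: "0 < d" and y: "0 \<le> y"
  shows "y \<le> d + d powr (1 - p) * y powr p"
proof (cases "y \<le> d")
  case False
  then have "y powr (1 - p) \<le> d powr (1 - p)" using d p by (intro powr_mono2') auto
  then have "y powr (1 - p) * y powr p \<le> d powr (1 - p) * y powr p" by (rule mult_right_mono) auto
  moreover have "y powr (1 - p) * y powr p = y" using False d by (simp add: powr_add[symmetric])
  ultimately show ?thesis using d by simp
qed (simp add: add_increasing2)

section \<open>Limits of integrals against test functions\<close>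

lemma local_L1_tendsto:
  fixes u :: "nat \<Rightarrow> 'a::euclidean_space \<Rightarrow> 'b::euclidean_space"
  assumes p: "1 \<le> p" and um[measurable]: "\<And>k. u k \<in> borel_measurable borel"
    and lim: "(\<lambda>k. Ip p (u k)) \<longlonglongrightarrow> 0"
  shows "(\<lambda>k. \<integral>\<^sup>+x. indicator (cball 0 R) x * ennreal (norm (u k x)) \<partial>lborel) \<longlonglongrightarrow> 0"
proof (rule tendsto_0_ennrealI)
  fix r :: real assume r: "0 < r"
  define m where "m = measure lborel (cball (0::'a) R)"
  have em: "emeasure lborel (cball (0::'a) R) = ennreal m"
    unfolding m_def using emeasure_bounded_finite[of "cball (0::'a) R"]
    by (intro emeasure_eq_ennreal_measure) (auto simp: top.not_eq_extremum)
  have m0: "0 \<le> m" by (simp add: m_def)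
  \<comment> \<open>Chosen so that the constant part contributes at most r/2 over the ball; the
    added 1 covers a ball of measure 0.\<close>
  define d where "d = r / (2 * (m + 1))"
  have d: "0 < d" using r m0 by (simp add: d_def)
  have dm: "d * m \<le> r / 2" using r m0 by (simp add: d_def field_simps)
  have y: "y \<le> d + d powr (1 - p) * y powr p" if "0 \<le> y" for y
    by (rule le_add_powr[OF p d that])
  have "(\<lambda>k. ennreal (d powr (1 - p)) * Ip p (u k)) \<longlonglongrightarrow> ennreal (d powr (1 - p)) * 0"
    by (intro ennreal_tendsto_cmult lim) auto
  then have "\<forall>\<^sub>F k in sequentially. ennreal (d powr (1 - p)) * Ip p (u k) \<le> ennreal (r / 2)"
    by (intro tendsto_0_ennrealD) (use r in auto)
  then show "\<forall>\<^sub>F k in sequentially. (\<integral>\<^sup>+x. indicator (cball 0 R) x * ennreal (norm (u k x)) \<partial>lborel) \<le> ennreal r"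
  proof eventually_elim
    case (elim k)
    have "(\<integral>\<^sup>+x. indicator (cball 0 R) x * ennreal (norm (u k x)) \<partial>lborel) \<le>
        (\<integral>\<^sup>+x. ennreal d * indicator (cball 0 R) x + ennreal (d powr (1 - p)) * ennreal (norm (u k x) powr p) \<partial>lborel)"
    proof (rule nn_integral_mono)
      fix x
      have "ennreal (norm (u k x)) \<le> ennreal (d + d powr (1 - p) * norm (u k x) powr p)"
        by (intro ennreal_leI y) auto
      also have "\<dots> = ennreal d + ennreal (d powr (1 - p)) * ennreal (norm (u k x) powr p)"
        using d by (simp add: ennreal_mult)
      finally show "indicator (cball 0 R) x * ennreal (norm (u k x)) \<le>
          ennreal d * indicator (cball 0 R) x + ennreal (d powr (1 - p)) * ennreal (norm (u k x) powr p)"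
        by (auto simp: indicator_def)
    qed
    also have "\<dots> = ennreal d * ennreal m + ennreal (d powr (1 - p)) * Ip p (u k)"
      unfolding Ip_def em[symmetric] by (subst nn_integral_add) (auto simp: nn_integral_cmult)
    also have "\<dots> \<le> ennreal (r / 2) + ennreal (r / 2)"
      using dm d m0 elim by (intro add_mono) (auto simp: ennreal_mult[symmetric] intro!: ennreal_leI)
    also have "\<dots> = ennreal r" using r by (simp flip: ennreal_plus)
    finally show ?case .
  qed
qed

text \<open>A bounded factor of bounded support needs only local L^1 convergence, so the argument is
  the same for every p \<ge> 1 and involves no conjugate exponent.\<close>

lemma integral_inner_tendsto:
  fixes u :: "'a::euclidean_space \<Rightarrow> 'b::euclidean_space"
  assumes p: "1 \<le> p" and um[measurable]: "u \<in> borel_measurable borel" "\<And>k. v k \<in> borel_measurable borel"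
    and loc: "loc_int u" "\<And>k. loc_int (v k)"
    and lim: "(\<lambda>k. Ip p (\<lambda>x. v k x - u x)) \<longlonglongrightarrow> 0"
    and psi[measurable]: "\<psi> \<in> borel_measurable borel" and B: "\<And>x. norm (\<psi> x) \<le> B" and z: "\<And>x. R < norm x \<Longrightarrow> \<psi> x = 0"
  shows "(\<lambda>k. \<integral>x. v k x \<bullet> \<psi> x \<partial>lborel) \<longlonglongrightarrow> (\<integral>x. u x \<bullet> \<psi> x \<partial>lborel)"
proof -
  have int: "integrable lborel (\<lambda>x. w x \<bullet> \<psi> x)" if w: "loc_int w" and [measurable]: "w \<in> borel_measurable borel" for w
  proof (rule integrable_of_loc_int[where R=R, OF w])
    show "norm (w x \<bullet> \<psi> x) \<le> B * norm (w x)" for x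
      using Cauchy_Schwarz_ineq2[of "w x" "\<psi> x"] mult_right_mono[OF B[of x], of "norm (w x)"] by (simp add: mult.commute)
  qed (auto simp: z)
  let ?a = "\<lambda>k. \<integral>\<^sup>+x. indicator (cball 0 R) x * ennreal (norm (v k x - u x)) \<partial>lborel"
  have B0: "0 \<le> B" using B[of 0] norm_ge_zero order_trans by blast
  have le: "ennreal (norm ((\<integral>x. v k x \<bullet> \<psi> x \<partial>lborel) - (\<integral>x. u x \<bullet> \<psi> x \<partial>lborel))) \<le> ennreal B * ?a k" for k
  proof -
    have "(\<integral>x. v k x \<bullet> \<psi> x \<partial>lborel) - (\<integral>x. u x \<bullet> \<psi> x \<partial>lborel) = (\<integral>x. (v k x - u x) \<bullet> \<psi> x \<partial>lborel)"
      using int[OF loc(1) um(1)] int[OF loc(2)[of k] um(2)[of k]] by (simp add: inner_diff_left)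
    then have "ennreal (norm ((\<integral>x. v k x \<bullet> \<psi> x \<partial>lborel) - (\<integral>x. u x \<bullet> \<psi> x \<partial>lborel))) \<le>
        (\<integral>\<^sup>+x. ennreal (norm ((v k x - u x) \<bullet> \<psi> x)) \<partial>lborel)"
      using int[OF loc(1) um(1)] int[OF loc(2)[of k] um(2)[of k]]
      by (simp only:) (intro integral_norm_bound_ennreal, simp add: inner_diff_left)
    also have "\<dots> \<le> (\<integral>\<^sup>+x. ennreal B * (indicator (cball 0 R) x * ennreal (norm (v k x - u x))) \<partial>lborel)"
    proof (rule nn_integral_mono)
      fix x
      show "ennreal (norm ((v k x - u x) \<bullet> \<psi> x)) \<le> ennreal B * (indicator (cball 0 R) x * ennreal (norm (v k x - u x)))"
      proof (cases "R < norm x")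
        case False
        have "norm ((v k x - u x) \<bullet> \<psi> x) \<le> B * norm (v k x - u x)"
          using Cauchy_Schwarz_ineq2[of "v k x - u x" "\<psi> x"] mult_right_mono[OF B[of x], of "norm (v k x - u x)"]
          by (simp add: mult.commute)
        then show ?thesis using False B0 by (auto simp: ennreal_mult[symmetric] intro!: ennreal_leI)
      qed (simp add: z)
    qed
    also have "\<dots> = ennreal B * ?a k" by (rule nn_integral_cmult) measurable
    finally show ?thesis .
  qed
  have "(\<lambda>k. ennreal B * ?a k) \<longlonglongrightarrow> ennreal B * 0"
    by (intro ennreal_tendsto_cmult local_L1_tendsto[OF p _ lim]) auto
  then have "(\<lambda>k. ennreal B * ?a k) \<longlonglongrightarrow> 0" by simp
  then have "(\<lambda>k. ennreal (norm ((\<integral>x. v k x \<bullet> \<psi> x \<partial>lborel) - (\<integral>x. u x \<bullet> \<psi> x \<partial>lborel)))) \<longlonglongrightarrow> ennreal 0"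
    using tendsto_0_ennreal_le[OF le] by simp
  then have "(\<lambda>k. norm ((\<integral>x. v k x \<bullet> \<psi> x \<partial>lborel) - (\<integral>x. u x \<bullet> \<psi> x \<partial>lborel))) \<longlonglongrightarrow> 0"
    by (subst (asm) tendsto_ennreal_iff) auto
  then show ?thesis by (simp only: tendsto_norm_zero_iff LIM_zero_iff)
qed

section \<open>Test functions and weak gradients of Borel functions\<close>

definition test_fun :: "('a::euclidean_space \<Rightarrow> real) \<Rightarrow> ('a \<Rightarrow> 'a) \<Rightarrow> bool" where
  "test_fun \<phi> E \<longleftrightarrow> C1_gradient \<phi> E \<and> (\<exists>R. \<forall>x. R < norm x \<longrightarrow> \<phi> x = 0)"

lemma test_funE:
  assumes "test_fun \<phi> E"
  obtains R B where "C1_gradient \<phi> E" "\<And>x. R < norm x \<Longrightarrow> \<phi> x = 0" "\<And>x. R < norm x \<Longrightarrow> E x = 0"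
    "\<And>x. norm (\<phi> x) \<le> B" "\<And>x. norm (E x) \<le> B"
proof -
  obtain R where c: "C1_gradient \<phi> E" and z: "\<And>x. R < norm x \<Longrightarrow> \<phi> x = 0"
    using assms by (auto simp: test_fun_def)
  note zE = C1_gradient_vanishes[where R=R, OF c z]
  obtain B1 where B1: "\<And>x. norm (\<phi> x) \<le> B1"
    using bounded_of_support[where R=R, OF C1_gradientD(3)[OF c] z] by metis
  obtain B2 where B2: "\<And>x. norm (E x) \<le> B2"
    using bounded_of_support[where R=R, OF C1_gradientD(2)[OF c] zE] by metis
  show ?thesis
    by (rule that[of R "max B1 B2"]) (use c z zE B1 B2 in \<open>auto intro: max.coboundedI1 max.coboundedI2\<close>)
qed

text \<open>The integral identity of \<open>has_weak_gradient\<close> for Lebesgue-Borel integrals,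
  with the gradient of the test function explicit; local integrability is kept as a separate
  hypothesis.\<close>

definition weak_grad :: "('a::euclidean_space \<Rightarrow> real) \<Rightarrow> ('a \<Rightarrow> 'a) \<Rightarrow> bool" where
  "weak_grad f G \<longleftrightarrow> (\<forall>\<phi> E. test_fun \<phi> E \<longrightarrow> (\<forall>b\<in>Basis.
     (\<integral>x. f x * (E x \<bullet> b) \<partial>lborel) = - (\<integral>x. (G x \<bullet> b) * \<phi> x \<partial>lborel)))"

lemma weak_grad_limit:
  fixes f :: "'a::euclidean_space \<Rightarrow> real"
  assumes p: "1 \<le> p" and meas: "f \<in> borel_measurable borel" "G \<in> borel_measurable borel"
    and loc: "loc_int f" "loc_int G" "\<And>k. loc_int (v k)" "\<And>k. loc_int (D k)"
    and v: "\<And>k. C1_gradient (v k) (D k)"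
    and lim: "(\<lambda>k. Ip p (\<lambda>x. v k x - f x)) \<longlonglongrightarrow> 0" "(\<lambda>k. Ip p (\<lambda>x. D k x - G x)) \<longlonglongrightarrow> 0"
  shows "weak_grad f G"
  unfolding weak_grad_def
proof safe
  fix \<phi> :: "'a \<Rightarrow> real" and E and b :: 'a assume "test_fun \<phi> E" and b: "b \<in> Basis"
  then obtain R B where c: "C1_gradient \<phi> E" and z: "\<And>x. R < norm x \<Longrightarrow> \<phi> x = 0" "\<And>x. R < norm x \<Longrightarrow> E x = 0"
    and B: "\<And>x. norm (\<phi> x) \<le> B" "\<And>x. norm (E x) \<le> B"
    using test_funE by blast
  note [measurable] = C1_gradientD(4,5)[OF c]
  have "(\<lambda>k. \<integral>x. v k x \<bullet> (E x \<bullet> b) \<partial>lborel) \<longlonglongrightarrow> (\<integral>x. f x \<bullet> (E x \<bullet> b) \<partial>lborel)"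
  proof (rule integral_inner_tendsto[where R=R, OF p meas(1) _ loc(1,3) lim(1)])
    show "norm (E x \<bullet> b) \<le> B" for x
      using Cauchy_Schwarz_ineq2[of "E x" b] B(2)[of x] b by simp
  qed (use C1_gradientD[OF v] z in auto)
  then have 1: "(\<lambda>k. \<integral>x. v k x * (E x \<bullet> b) \<partial>lborel) \<longlonglongrightarrow> (\<integral>x. f x * (E x \<bullet> b) \<partial>lborel)" by simp
  have "(\<lambda>k. \<integral>x. D k x \<bullet> (\<phi> x *\<^sub>R b) \<partial>lborel) \<longlonglongrightarrow> (\<integral>x. G x \<bullet> (\<phi> x *\<^sub>R b) \<partial>lborel)"
    by (rule integral_inner_tendsto[where R=R, OF p meas(2) _ loc(2,4) lim(2)])
       (use C1_gradientD[OF v] z B b in auto)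
  then have "(\<lambda>k. - (\<integral>x. (D k x \<bullet> b) * \<phi> x \<partial>lborel)) \<longlonglongrightarrow> - (\<integral>x. (G x \<bullet> b) * \<phi> x \<partial>lborel)"
    by (intro tendsto_minus) (simp add: mult.commute)
  then have 2: "(\<lambda>k. \<integral>x. v k x * (E x \<bullet> b) \<partial>lborel) \<longlonglongrightarrow> - (\<integral>x. (G x \<bullet> b) * \<phi> x \<partial>lborel)"
    by (simp only: C1_integration_by_parts[OF v c z(1)])
  show "(\<integral>x. f x * (E x \<bullet> b) \<partial>lborel) = - (\<integral>x. (G x \<bullet> b) * \<phi> x \<partial>lborel)"
    by (rule LIMSEQ_unique[OF 1 2])
qed

section \<open>Uniqueness of the weak gradient\<close>

lemma test_fun_moll:
  fixes x :: "'a::euclidean_space"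
  assumes e: "0 < e"
  shows "test_fun (\<lambda>y. moll e (x - y)) (\<lambda>y. - moll_grad e (x - y))"
proof -
  obtain K where K: "0 \<le> K" and taylor: "\<And>x h::'a. norm h \<le> 1 \<Longrightarrow>
      \<bar>moll e (x + h) - moll e x - moll_grad e x \<bullet> h\<bar> \<le> K * (norm h)\<^sup>2"
    using moll_taylor[OF e, where 'a='a] by blast
  have d: "(moll e has_derivative (\<lambda>h. moll_grad e z \<bullet> h)) (at z)" for z :: 'a
  proof (rule has_derivativeI_sandwich[of 1])
    show "bounded_linear (\<lambda>h. moll_grad e z \<bullet> h)" by (rule bounded_linear_inner_right)
    have "((\<lambda>y. K * norm (y - z)) \<longlongrightarrow> K * norm (z - z)) (at z)" by (intro tendsto_intros)
    then show "((\<lambda>y. K * norm (y - z)) \<longlongrightarrow> 0) (at z)" by simp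
    fix y assume y: "y \<noteq> z" "dist y z < 1"
    then have "norm (moll e y - moll e z - moll_grad e z \<bullet> (y - z)) \<le> K * (norm (y - z))\<^sup>2"
      using taylor[of "y - z" z] by (simp add: dist_norm)
    then show "norm (moll e y - moll e z - moll_grad e z \<bullet> (y - z)) / norm (y - z) \<le> K * norm (y - z)"
      using y by (simp add: divide_le_eq power2_eq_square mult.assoc)
  qed simp
  have "C1_gradient (\<lambda>y. moll e (x - y)) (\<lambda>y. - moll_grad e (x - y))"
    unfolding C1_gradient_def
  proof safe
    show "((\<lambda>y. moll e (x - y)) has_derivative (\<lambda>h. - moll_grad e (x - y) \<bullet> h)) (at y)" for y
      by (rule has_derivative_eq_rhs[OF has_derivative_compose[of "\<lambda>y. x - y", OF _ d]])
         (auto intro!: derivative_eq_intros)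
    show "continuous_on UNIV (\<lambda>y. - moll_grad e (x - y))"
      by (intro continuous_intros continuous_on_compose2[OF continuous_on_moll(2)]) auto
  qed
  moreover have "moll e (x - y) = 0" if "norm x + e < norm y" for y
    using norm_triangle_ineq2[of y x] that by (intro moll_eq_0[OF e]) (simp add: norm_minus_commute)
  ultimately show ?thesis unfolding test_fun_def by blast
qed

text \<open>Mollifications converge back to the function in L^1. As \<open>g\<close> is only locally
  integrable, this is applied to its truncations.\<close>

lemma AE_eq_0_of_conv_eq_0:
  fixes g :: "'a::euclidean_space \<Rightarrow> real"
  assumes g: "loc_int g" and gm[measurable]: "g \<in> borel_measurable borel"
    and 0: "\<And>e x. 0 < e \<Longrightarrow> conv e g x = 0"
  shows "AE x in lborel. g x = 0"
proof -
  define e where "e k = inverse (real (Suc k))" for k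
  have e: "0 < e k" "e k \<le> 1" for k by (simp_all add: e_def field_simps)
  have e0: "e \<longlonglongrightarrow> 0" unfolding e_def by (rule LIMSEQ_inverse_real_of_nat)
  have "AE x in lborel. norm x \<le> real n \<longrightarrow> g x = 0" for n
  proof -
    \<comment> \<open>As \<open>e k\<close> is at most 1, truncating at n + 1 leaves the
      mollifications on the ball of radius \<open>n\<close> unchanged.\<close>
    define R where "R = real n + 1"
    define gR where "gR x = indicator (cball 0 R) x * g x" for x
    have [measurable]: "gR \<in> borel_measurable borel" unfolding gR_def by measurable
    have fin: "Ip 1 gR < \<infinity>"
    proof -
      have "integrable lborel gR" using g unfolding loc_int_def gR_def by simp
      then show ?thesis by (simp add: Ip_def integrable_iff_bounded)
    qed
    have conv0: "conv (e k) gR x = 0" if x: "norm x \<le> real n" for k x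
    proof -
      have "moll (e k) (x - y) *\<^sub>R gR y = moll (e k) (x - y) *\<^sub>R g y" for y
      proof (cases "R < norm y")
        case True
        then have "e k \<le> norm (x - y)"
          using norm_triangle_ineq2[of y x] x e(2)[of k] by (simp add: R_def norm_minus_commute)
        then show ?thesis by (simp add: moll_eq_0[OF e(1)])
      qed (simp add: gR_def)
      then have "conv (e k) gR x = conv (e k) g x" by (simp only: conv_def)
      then show ?thesis using 0[OF e(1)] by simp
    qed
    let ?I = "\<integral>\<^sup>+x. indicator (cball 0 (real n)) x * ennreal (norm (g x)) \<partial>lborel"
    have "?I \<le> Ip 1 (\<lambda>x. conv (e k) gR x - gR x)" for k
      unfolding Ip_def
    proof (rule nn_integral_mono)
      fix x :: 'a
      show "indicator (cball 0 (real n)) x * ennreal (norm (g x)) \<le> ennreal (norm (conv (e k) gR x - gR x) powr 1)"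
      proof (cases "norm x \<le> real n")
        case True
        then have "gR x = g x" by (simp add: gR_def R_def)
        then show ?thesis using True conv0[OF True] by simp
      qed simp
    qed
    then have "?I \<le> 0"
      using LIMSEQ_le_const[OF conv_tendsto[OF _ _ fin e0 e(1)]] by auto
    then have "AE x in lborel. indicator (cball 0 (real n)) x * ennreal (norm (g x)) = 0"
      by (subst (asm) le_zero_eq, subst (asm) nn_integral_0_iff_AE) auto
    then show ?thesis by eventually_elim (auto simp: indicator_def split: if_splits)
  qed
  then have "AE x in lborel. \<forall>n. norm x \<le> real n \<longrightarrow> g x = 0"
    unfolding AE_all_countable by blast
  then show ?thesis by eventually_elim (meson real_arch_simple)
qed

text \<open>Testing with y \<mapsto> moll e (x - y) reads off the mollification of each weak
  gradient at \<open>x\<close>; all mollifications of G - H therefore vanish.\<close>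

lemma weak_grad_unique:
  fixes f :: "'a::euclidean_space \<Rightarrow> real"
  assumes G: "weak_grad f G" "loc_int G" and Gm[measurable]: "G \<in> borel_measurable borel"
    and H: "weak_grad f H" "loc_int H" and Hm[measurable]: "H \<in> borel_measurable borel"
  shows "AE x in lborel. G x = H x"
proof -
  have "AE x in lborel. (G x - H x) \<bullet> b = 0" if b: "b \<in> Basis" for b
  proof (rule AE_eq_0_of_conv_eq_0)
    have ib: "integrable lborel (\<lambda>x. indicator (cball 0 R) x *\<^sub>R (u x \<bullet> b))" if "loc_int u" for R and u :: "'a \<Rightarrow> 'a"
      using integrable_inner_left[of b lborel "\<lambda>x. indicator (cball 0 R) x *\<^sub>R u x"] that by (simp add: loc_int_def)
    have lG: "loc_int (\<lambda>x. G x \<bullet> b)" and lH: "loc_int (\<lambda>x. H x \<bullet> b)"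
      unfolding loc_int_def using ib[OF G(2)] ib[OF H(2)] by auto
    show "loc_int (\<lambda>x. (G x - H x) \<bullet> b)"
      using lG lH unfolding loc_int_def by (simp add: inner_diff_left right_diff_distrib)
    fix e :: real and x :: 'a assume e: "0 < e"
    have "(\<integral>y. (G y \<bullet> b) * moll e (x - y) \<partial>lborel) = (\<integral>y. (H y \<bullet> b) * moll e (x - y) \<partial>lborel)"
    proof -
      have "(\<integral>y. f y * (- moll_grad e (x - y) \<bullet> b) \<partial>lborel) = - (\<integral>y. (u y \<bullet> b) * moll e (x - y) \<partial>lborel)"
        if "weak_grad f u" for u
        using that test_fun_moll[OF e, of x] b unfolding weak_grad_def by blast
      from this[OF G(1)] this[OF H(1)] show ?thesis by (simp only: neg_equal_iff_equal)
    qed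
    moreover have "conv e (\<lambda>x. (G x - H x) \<bullet> b) x = conv e (\<lambda>x. G x \<bullet> b) x - conv e (\<lambda>x. H x \<bullet> b) x"
      unfolding conv_def inner_diff_left scaleR_diff_right
      by (intro Bochner_Integration.integral_diff integrable_conv[OF e] lG lH) measurable
    ultimately show "conv e (\<lambda>x. (G x - H x) \<bullet> b) x = 0"
      by (simp add: conv_def mult.commute)
  qed measurable
  then have "AE x in lborel. \<forall>b\<in>Basis. (G x - H x) \<bullet> b = 0"
    by (intro AE_finite_allI) auto
  then show ?thesis
    by eventually_elim (auto intro: euclidean_eqI simp: inner_diff_left)
qed

section \<open>Uniform convexity and completeness of \<open>L\<^sup>p\<close>\<close>

text \<open>The mean value theorem on the two halves of the interval, with the strictly increasing
  derivative p z^(p-1).\<close>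

lemma powr_midpoint_strict:
  fixes x y p :: real
  assumes p: "1 < p" and x: "0 \<le> x" and xy: "x < y"
  shows "((x + y) / 2) powr p < (x powr p + y powr p) / 2"
proof -
  let ?m = "(x + y) / 2"
  have mvt: "\<exists>z. a < z \<and> z < b \<and> b powr p - a powr p = (b - a) * (p * z powr (p - 1))" if "0 \<le> a" "a < b" for a b :: real
  proof -
    have "continuous_on {a..b} (\<lambda>t. t powr p)"
      using that p by (intro continuous_on_powr' continuous_intros) auto
    moreover have "(\<lambda>t. t powr p) differentiable (at t)" if "a < t" "t < b" for t
      using has_real_derivative_powr[of t p] that \<open>0 \<le> a\<close> by (auto simp: real_differentiable_def)
    ultimately obtain l z where z: "a < z" "z < b" "DERIV (\<lambda>t. t powr p) z :> l" "b powr p - a powr p = (b - a) * l"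
      using MVT[OF \<open>a < b\<close>, of "\<lambda>t. t powr p"] by blast
    have "DERIV (\<lambda>t. t powr p) z :> p * z powr (p - 1)"
      using z that by (intro has_real_derivative_powr) auto
    then have "l = p * z powr (p - 1)" using z(3) by (rule DERIV_unique[symmetric])
    with z show ?thesis by blast
  qed
  obtain z1 where z1: "x < z1" "z1 < ?m" "?m powr p - x powr p = (?m - x) * (p * z1 powr (p - 1))"
    using mvt[of x ?m] x xy by auto
  obtain z2 where z2: "?m < z2" "z2 < y" "y powr p - ?m powr p = (y - ?m) * (p * z2 powr (p - 1))"
    using mvt[of ?m y] x xy by auto
  have "z1 powr (p - 1) < z2 powr (p - 1)"
    using z1 z2 x p by (intro powr_less_mono2) auto
  moreover have e: "?m - x = (y - x) / 2" "y - ?m = (y - x) / 2" by (simp_all add: field_simps)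
  ultimately have "(?m - x) * (p * z1 powr (p - 1)) < (y - ?m) * (p * z2 powr (p - 1))"
    unfolding e using p xy by (intro mult_strict_left_mono) auto
  then show ?thesis using z1(3) z2(3) by simp
qed

lemma powr_midpoint_le:
  fixes x y p :: real
  assumes p: "1 < p" and x: "0 \<le> x" and y: "0 \<le> y"
  shows "((x + y) / 2) powr p \<le> (x powr p + y powr p) / 2"
  using powr_midpoint_strict[OF p x, of y] powr_midpoint_strict[OF p y, of x]
  by (cases x y rule: linorder_cases) (auto simp: add.commute)

text \<open>In the equality case strict convexity forces equal norms and strict monotonicity forces
  |a + b| = |a| + |b|. In an inner product space these two together give |a - b| = 0.\<close>

lemma norm_midpoint_powr:
  fixes a b :: "'b::euclidean_space"
  assumes p: "1 < p"
  shows "norm ((a + b) /\<^sub>R 2) powr p \<le> (norm a powr p + norm b powr p) / 2"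
    and "norm ((a + b) /\<^sub>R 2) powr p = (norm a powr p + norm b powr p) / 2 \<Longrightarrow> a = b"
proof -
  have n: "norm ((a + b) /\<^sub>R 2) = norm (a + b) / 2" by simp
  have 1: "norm ((a + b) /\<^sub>R 2) powr p \<le> ((norm a + norm b) / 2) powr p"
    unfolding n using p by (intro powr_mono2 divide_right_mono norm_triangle_ineq) auto
  have 2: "((norm a + norm b) / 2) powr p \<le> (norm a powr p + norm b powr p) / 2"
    by (rule powr_midpoint_le[OF p]) auto
  show "norm ((a + b) /\<^sub>R 2) powr p \<le> (norm a powr p + norm b powr p) / 2"
    using 1 2 by simp
  assume eq: "norm ((a + b) /\<^sub>R 2) powr p = (norm a powr p + norm b powr p) / 2"
  have ab: "norm a = norm b"
    using powr_midpoint_strict[OF p, of "norm a" "norm b"] powr_midpoint_strict[OF p, of "norm b" "norm a"] 1 2 eq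
    by (cases "norm a" "norm b" rule: linorder_cases) (auto simp: add.commute)
  have "norm (a + b) = norm a + norm b"
  proof (rule ccontr)
    assume "norm (a + b) \<noteq> norm a + norm b"
    then have "norm (a + b) / 2 < (norm a + norm b) / 2" using norm_triangle_ineq[of a b] by simp
    then have "(norm (a + b) / 2) powr p < ((norm a + norm b) / 2) powr p"
      using p by (intro powr_less_mono2) auto
    then show False using eq 2 unfolding n by simp
  qed
  then have "(norm (a + b))\<^sup>2 = (2 * norm a)\<^sup>2" using ab by simp
  then have "a \<bullet> b = a \<bullet> a" "b \<bullet> b = a \<bullet> a"
    using ab by (auto simp: power2_norm_eq_inner inner_add_left inner_add_right inner_commute power_mult_distrib norm_eq)
  then have "(a - b) \<bullet> (a - b) = 0"
    by (simp add: inner_diff_left inner_diff_right inner_commute)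
  then show "a = b" by simp
qed

text \<open>Uniform convexity of \<open>L\<^sup>p\<close> in pointwise form, by compactness of the unit sphere of pairs.\<close>

lemma uniform_convexity_pointwise:
  assumes p: "1 < p" and d: "0 < d"
  obtains K where "0 \<le> K" "\<And>a b :: 'b::euclidean_space.
    norm (a - b) powr p + K * norm ((a + b) /\<^sub>R 2) powr p \<le> (K / 2 + d) * (norm a powr p + norm b powr p)"
proof -
  define N where "N z = norm (fst z) powr p + norm (snd z) powr p" for z :: "'b \<times> 'b"
  define c where "c z = N z / 2 - norm ((fst z + snd z) /\<^sub>R 2) powr p" for z :: "'b \<times> 'b"
  define q where "q z = norm (fst z - snd z) powr p" for z :: "'b \<times> 'b"
  have contp: "continuous_on UNIV (\<lambda>z::'b \<times> 'b. norm (g z) powr p)" if "continuous_on UNIV g" for g :: "'b \<times> 'b \<Rightarrow> 'b"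
    using p by (intro continuous_on_powr' continuous_intros that) auto
  have cN: "continuous_on UNIV N"
    unfolding N_def by (rule continuous_on_add[OF contp contp]) (intro continuous_intros)+
  have cc: "continuous_on UNIV c"
    unfolding c_def
    by (rule continuous_on_diff[OF continuous_on_divide[OF cN] contp]) (auto intro!: continuous_intros)
  have cq: "continuous_on UNIV q"
    unfolding q_def by (rule contp) (intro continuous_intros)
  \<comment> \<open>On normalised pairs at distance bounded below, the convexity defect
    \<open>c\<close> has a positive minimum, so \<open>q\<close> is at most a multiple of
    \<open>c\<close>. On the other normalised pairs q \<le> d, which the summand \<open>d\<close> in
    the statement absorbs.\<close>
  define T where "T = {z. N z = 1 \<and> d \<le> q z}"
  have "closed T"
    unfolding T_def by (intro closed_Collect_conj closed_Collect_eq closed_Collect_le cN cq continuous_on_const)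
  moreover have "bounded T"
  proof -
    have le1: "s \<le> 1" if "0 \<le> s" "s powr p \<le> 1" for s :: real
    proof (rule ccontr)
      assume "\<not> s \<le> 1"
      then have "1 powr p < s powr p" using p by (intro powr_less_mono2) auto
      moreover have "1 powr p = (1::real)" by simp
      ultimately show False using that(2) by linarith
    qed
    have "T \<subseteq> cball 0 1 \<times> cball 0 1"
    proof
      fix z assume "z \<in> T"
      then have "norm (fst z) powr p + norm (snd z) powr p = 1" by (simp add: T_def N_def)
      moreover have "0 \<le> norm (fst z) powr p" "0 \<le> norm (snd z) powr p" by auto
      ultimately have "norm (fst z) powr p \<le> 1" "norm (snd z) powr p \<le> 1" by linarith+
      then show "z \<in> cball 0 1 \<times> cball 0 1" using le1 by (cases z) auto
    qed
    then show ?thesis by (rule bounded_subset[rotated]) (intro bounded_Times bounded_cball)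
  qed
  ultimately have T: "compact T" by (simp add: compact_eq_bounded_closed)
  have cpos: "0 < c z" if "z \<in> T" for z
  proof -
    have "fst z \<noteq> snd z" using that d by (auto simp: T_def q_def)
    then show ?thesis
      using norm_midpoint_powr[OF p, of "fst z" "snd z"] by (fastforce simp: c_def N_def)
  qed
  have c0: "0 \<le> c z" for z
    using norm_midpoint_powr(1)[OF p, of "fst z" "snd z"] by (simp add: c_def N_def)
  obtain K where K: "0 \<le> K" "\<And>z. z \<in> T \<Longrightarrow> q z \<le> K * c z"
  proof (cases "T = {}")
    case False
    obtain z0 where z0: "z0 \<in> T" "\<And>z. z \<in> T \<Longrightarrow> c z0 \<le> c z"
      using continuous_attains_inf[OF T False continuous_on_subset[OF cc]] by auto
    obtain z1 where z1: "z1 \<in> T" "\<And>z. z \<in> T \<Longrightarrow> q z \<le> q z1"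
      using continuous_attains_sup[OF T False continuous_on_subset[OF cq]] by auto
    have "q z \<le> (q z1 / c z0) * c z" if "z \<in> T" for z
    proof -
      have "q z \<le> q z1" by (rule z1(2)[OF that])
      also have "q z1 = (q z1 / c z0) * c z0" using cpos[OF z0(1)] by simp
      also have "\<dots> \<le> (q z1 / c z0) * c z"
        using cpos[OF z0(1)] z0(2)[OF that] by (intro mult_left_mono) (auto simp: q_def)
      finally show ?thesis .
    qed
    then show ?thesis using cpos[OF z0(1)] by (intro that[of "q z1 / c z0"]) (auto simp: q_def)
  qed (use that[of 0] in auto)
  have unit: "q z \<le> K * c z + d" if "N z = 1" for z
  proof (cases "z \<in> T")
    case True
    then show ?thesis using K(2)[OF True] d by simp
  next
    case False
    then have "q z \<le> d" using that by (auto simp: T_def)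
    moreover have "0 \<le> K * c z" using K(1) c0 by simp
    ultimately show ?thesis by simp
  qed
  have "norm (a - b) powr p + K * norm ((a + b) /\<^sub>R 2) powr p \<le> (K / 2 + d) * (norm a powr p + norm b powr p)" for a b :: 'b
  proof (cases "N (a, b) = 0")
    case True
    have "0 \<le> norm a powr p" "0 \<le> norm b powr p" by auto
    then have "norm a powr p = 0" "norm b powr p = 0" using True by (auto simp: N_def add_nonneg_eq_0_iff)
    then have "a = 0" "b = 0" by auto
    then show ?thesis by simp
  next
    case False
    define s where "s = N (a, b)"
    have s: "0 < s"
      using False by (auto simp: s_def N_def less_le)
    \<comment> \<open>All terms are homogeneous of degree p; scaling by \<open>t\<close> normalises
      the pair to N = 1.\<close>
    define t where "t = s powr (- (1 / p))"
    have t: "0 < t" "t powr p = 1 / s"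
  proof -
      show "0 < t" using s by (simp add: t_def)
      have "t powr p = s powr (- (1 / p) * p)" by (simp only: t_def powr_powr)
      also have "- (1 / p) * p = - 1" using p by simp
      finally show "t powr p = 1 / s" using s by (simp add: powr_minus_divide)
    qed
    have sc: "norm (t *\<^sub>R x) powr p = norm x powr p / s" for x :: 'b
      using t by (simp add: powr_mult)
    have "N (t *\<^sub>R a, t *\<^sub>R b) = 1"
      using s by (simp add: N_def sc add_divide_distrib[symmetric] del: norm_scaleR) (simp add: s_def N_def)
    from unit[OF this] have "norm (t *\<^sub>R (a - b)) powr p \<le> K * (1 / 2 - norm (t *\<^sub>R ((a + b) /\<^sub>R 2)) powr p) + d"
      using \<open>N (t *\<^sub>R a, t *\<^sub>R b) = 1\<close> by (simp add: q_def c_def algebra_simps)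
    then have "norm (a - b) powr p / s \<le> K * (1 / 2 - norm ((a + b) /\<^sub>R 2) powr p / s) + d"
      by (simp only: sc)
    then have "s * (norm (a - b) powr p / s) \<le> s * (K * (1 / 2 - norm ((a + b) /\<^sub>R 2) powr p / s) + d)"
      using s by (intro mult_left_mono) auto
    then have "norm (a - b) powr p \<le> s * K / 2 - K * norm ((a + b) /\<^sub>R 2) powr p + s * d"
      using s by (simp add: algebra_simps)
    then have "norm (a - b) powr p + K * norm ((a + b) /\<^sub>R 2) powr p \<le> (K / 2 + d) * s"
      by (simp only: distrib_right) (simp add: mult.commute)
    then show ?thesis by (simp only: s_def N_def fst_conv snd_conv)
  qed
  with K(1) show ?thesis by (rule that)
qed

text \<open>The pointwise inequality integrated. It is arranged without subtraction, so it remains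
  meaningful when some of the integrals are infinite.\<close>

lemma uniform_convexity_Ip:
  assumes p: "1 < p" and d: "0 < d"
  obtains K where "0 \<le> K" "\<And>u v :: 'a::euclidean_space \<Rightarrow> 'b::euclidean_space. u \<in> borel_measurable borel \<Longrightarrow> v \<in> borel_measurable borel \<Longrightarrow>
    Ip p (\<lambda>x. u x - v x) + ennreal K * Ip p (\<lambda>x. (u x + v x) /\<^sub>R 2) \<le> ennreal (K / 2 + d) * (Ip p u + Ip p v)"
proof -
  obtain K where K: "0 \<le> K" "\<And>a b :: 'b.
    norm (a - b) powr p + K * norm ((a + b) /\<^sub>R 2) powr p \<le> (K / 2 + d) * (norm a powr p + norm b powr p)"
    using uniform_convexity_pointwise[OF p d] by blast
  have "Ip p (\<lambda>x. u x - v x) + ennreal K * Ip p (\<lambda>x. (u x + v x) /\<^sub>R 2) \<le> ennreal (K / 2 + d) * (Ip p u + Ip p v)"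
    if [measurable]: "u \<in> borel_measurable borel" "v \<in> borel_measurable borel" for u v :: "'a \<Rightarrow> 'b"
  proof -
    have "Ip p (\<lambda>x. u x - v x) + ennreal K * Ip p (\<lambda>x. (u x + v x) /\<^sub>R 2) =
        (\<integral>\<^sup>+x. ennreal (norm (u x - v x) powr p) + ennreal K * ennreal (norm ((u x + v x) /\<^sub>R 2) powr p) \<partial>lborel)"
      unfolding Ip_def by (simp add: nn_integral_add nn_integral_cmult)
    also have "\<dots> \<le> (\<integral>\<^sup>+x. ennreal (K / 2 + d) * (ennreal (norm (u x) powr p) + ennreal (norm (v x) powr p)) \<partial>lborel)"
    proof (rule nn_integral_mono)
      fix x
      have "ennreal (norm (u x - v x) powr p + K * norm ((u x + v x) /\<^sub>R 2) powr p) \<le>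
          ennreal ((K / 2 + d) * (norm (u x) powr p + norm (v x) powr p))"
        by (intro ennreal_leI K)
      moreover have "ennreal (norm (u x - v x) powr p + K * norm ((u x + v x) /\<^sub>R 2) powr p) =
          ennreal (norm (u x - v x) powr p) + ennreal K * ennreal (norm ((u x + v x) /\<^sub>R 2) powr p)"
        using K(1) by (subst ennreal_plus; simp add: ennreal_mult del: norm_scaleR)
      moreover have "ennreal ((K / 2 + d) * (norm (u x) powr p + norm (v x) powr p)) =
          ennreal (K / 2 + d) * (ennreal (norm (u x) powr p) + ennreal (norm (v x) powr p))"
        using K(1) d by (subst ennreal_mult) auto
      ultimately show "ennreal (norm (u x - v x) powr p) + ennreal K * ennreal (norm ((u x + v x) /\<^sub>R 2) powr p) \<le>
          ennreal (K / 2 + d) * (ennreal (norm (u x) powr p) + ennreal (norm (v x) powr p))"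
        by (simp only:)
    qed
    also have "\<dots> = ennreal (K / 2 + d) * (Ip p u + Ip p v)"
      unfolding Ip_def by (simp add: nn_integral_add nn_integral_cmult)
    finally show ?thesis .
  qed
  with K(1) show ?thesis by (rule that)
qed

text \<open>The Riesz-Fischer argument, with weights in place of Minkowski's inequality for the sum
  of the increments: a rapidly converging subsequence converges almost everywhere, and Fatou's lemma
  upgrades this to convergence of the whole sequence.\<close>

lemma Ip_complete:
  fixes D :: "nat \<Rightarrow> 'a::euclidean_space \<Rightarrow> 'b::euclidean_space"
  assumes p: "1 \<le> p" and Dm[measurable]: "\<And>k. D k \<in> borel_measurable borel"
    and cauchy: "\<And>e. 0 < e \<Longrightarrow> \<exists>N. \<forall>k\<ge>N. \<forall>l\<ge>N. Ip p (\<lambda>x. D k x - D l x) \<le> ennreal e"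
  obtains G where "G \<in> borel_measurable borel" "(\<lambda>k. Ip p (\<lambda>x. D k x - G x)) \<longlonglongrightarrow> 0"
proof -
  \<comment> \<open>Increments of p-th power norm at most \<open>h j powr p\<close>, weighted by
    \<open>h j powr (1 - p)\<close>, have summable integrals \<open>h j\<close>; by
    \<open>le_add_powr\<close> with d = \<open>h j\<close> the weighted sum controls the increments
    themselves.\<close>
  define h where "h j = (1 / 2 :: real) ^ j" for j :: nat
  have h: "0 < h j" for j by (simp add: h_def)
  obtain N where N: "\<And>j k l. N j \<le> k \<Longrightarrow> N j \<le> l \<Longrightarrow> Ip p (\<lambda>x. D k x - D l x) \<le> ennreal (h j powr p)"
    using cauchy[of "h _ powr p"] h by (metis powr_gt_zero order_less_irrefl)
  \<comment> \<open>The partial sum makes both \<open>s j\<close> and \<open>s (Suc j)\<close> at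
    least \<open>N j\<close>; the summand \<open>j\<close> makes \<open>s\<close> tend to
    infinity.\<close>
  define s where "s j = (\<Sum>i\<le>j. N i) + j" for j
  have s: "N j \<le> s j" "N j \<le> s (Suc j)" "j \<le> s j" for j
    unfolding s_def using member_le_sum[of j "{..j}" N] by auto
  define d where "d j x = D (s (Suc j)) x - D (s j) x" for j x
  have dm[measurable]: "d j \<in> borel_measurable borel" for j unfolding d_def by measurable
  have Id: "Ip p (d j) \<le> ennreal (h j powr p)" for j
    unfolding d_def by (rule N[OF s(2) s(1)])
  let ?F = "\<lambda>x. \<Sum>j. ennreal (h j powr (1 - p) * norm (d j x) powr p)"
  have "(\<integral>\<^sup>+x. ?F x \<partial>lborel) = (\<Sum>j. \<integral>\<^sup>+x. ennreal (h j powr (1 - p) * norm (d j x) powr p) \<partial>lborel)"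
    by (rule nn_integral_suminf) measurable
  also have "\<dots> = (\<Sum>j. ennreal (h j powr (1 - p)) * Ip p (d j))"
    unfolding Ip_def by (simp add: ennreal_mult nn_integral_cmult)
  also have "\<dots> \<le> (\<Sum>j. ennreal (h j))"
  proof (rule suminf_le)
    fix j
    have "ennreal (h j powr (1 - p)) * Ip p (d j) \<le> ennreal (h j powr (1 - p)) * ennreal (h j powr p)"
      by (intro mult_left_mono Id) simp
    also have "\<dots> = ennreal (h j)"
      using h[of j] by (simp add: ennreal_mult[symmetric] powr_add[symmetric])
    finally show "ennreal (h j powr (1 - p)) * Ip p (d j) \<le> ennreal (h j)" .
  qed auto
  also have "\<dots> = ennreal (\<Sum>j. h j)"
    using h by (intro suminf_ennreal2) (auto simp: h_def less_imp_le intro!: summable_geometric)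
  also have "\<dots> < \<infinity>" by simp
  finally have "AE x in lborel. ?F x \<noteq> \<infinity>"
    by (intro nn_integral_noteq_infinite) auto
  then have ae: "AE x in lborel. convergent (\<lambda>j. D (s j) x)"
  proof eventually_elim
    case (elim x)
    have "summable (\<lambda>j. h j powr (1 - p) * norm (d j x) powr p)"
      using elim by (intro summable_suminf_not_top) auto
    then have "summable (\<lambda>j. h j + h j powr (1 - p) * norm (d j x) powr p)"
      by (intro summable_add) (auto simp: h_def intro!: summable_geometric)
    then have "summable (\<lambda>j. norm (d j x))"
      by (rule summable_comparison_test'[where N=0]) (use le_add_powr[OF p h] in auto)
    then have "summable (\<lambda>j. d j x)" by (rule summable_norm_cancel)
    then have "convergent (\<lambda>n. \<Sum>j<n. d j x)" by (simp add: summable_iff_convergent)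
    then have "convergent (\<lambda>n. D (s n) x - D (s 0) x)"
      unfolding d_def sum_lessThan_telescope[of "\<lambda>j. D (s j) x"] .
    then have "convergent (\<lambda>n. (D (s n) x - D (s 0) x) + D (s 0) x)"
      by (intro convergent_add convergent_const)
    then show ?case by simp
  qed
  define G where "G x = lim (\<lambda>j. D (s j) x)" for x
  have Gm[measurable]: "G \<in> borel_measurable borel"
    unfolding G_def by (rule borel_measurable_lim_metric) measurable
  have lim: "AE x in lborel. (\<lambda>j. D (s j) x) \<longlonglongrightarrow> G x"
    using ae by eventually_elim (simp add: G_def convergent_LIMSEQ_iff)
  have "(\<lambda>k. Ip p (\<lambda>x. D k x - G x)) \<longlonglongrightarrow> 0"
  proof (rule tendsto_0_ennrealI)
    fix e :: real assume "0 < e"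
    from cauchy[OF this] obtain M where M: "\<And>k l. M \<le> k \<Longrightarrow> M \<le> l \<Longrightarrow> Ip p (\<lambda>x. D k x - D l x) \<le> ennreal e" by blast
    have "Ip p (\<lambda>x. D k x - G x) \<le> ennreal e" if k: "M \<le> k" for k
    proof -
      have "Ip p (\<lambda>x. D k x - G x) = (\<integral>\<^sup>+x. liminf (\<lambda>j. ennreal (norm (D k x - D (s j) x) powr p)) \<partial>lborel)"
        unfolding Ip_def
      proof (rule nn_integral_cong_AE)
        show "AE x in lborel. ennreal (norm (D k x - G x) powr p) = liminf (\<lambda>j. ennreal (norm (D k x - D (s j) x) powr p))"
          using lim
        proof eventually_elim
          case (elim x)
          have "(\<lambda>j. norm (D k x - D (s j) x) powr p) \<longlonglongrightarrow> norm (D k x - G x) powr p"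
            using p by (intro tendsto_powr' tendsto_norm tendsto_diff tendsto_const elim) auto
          then show ?case by (intro lim_imp_Liminf[symmetric] tendsto_ennrealI) auto
        qed
      qed
      also have "\<dots> \<le> liminf (\<lambda>j. Ip p (\<lambda>x. D k x - D (s j) x))"
        unfolding Ip_def by (rule nn_integral_liminf) measurable
      also have "\<dots> \<le> limsup (\<lambda>j. Ip p (\<lambda>x. D k x - D (s j) x))"
        by (rule Liminf_le_Limsup) simp
      also have "\<dots> \<le> ennreal e"
      proof (rule Limsup_bounded)
        show "\<forall>\<^sub>F j in sequentially. Ip p (\<lambda>x. D k x - D (s j) x) \<le> ennreal e"
          using eventually_ge_at_top[of M]
          by eventually_elim (use M[OF k] s(3) order_trans in blast)
      qed
      finally show ?thesis .
    qed
    then show "\<forall>\<^sub>F k in sequentially. Ip p (\<lambda>x. D k x - G x) \<le> ennreal e"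
      using eventually_ge_at_top[of M] by (rule eventually_mono[rotated]) blast
  qed
  with Gm show ?thesis by (rule that)
qed

section \<open>The gradient for \<open>p > 1\<close>\<close>

text \<open>Reduces a statement about two large indices to pairs of sequences: if it failed, a bad
  pair beyond every N could be chosen.\<close>

lemma eventually_square_nat:
  assumes "\<And>k l. (\<And>N::nat. N \<le> k N) \<Longrightarrow> (\<And>N::nat. N \<le> l N) \<Longrightarrow> \<exists>N. Q (k N) (l N)"
  shows "\<exists>N. \<forall>k\<ge>N. \<forall>l\<ge>N. Q k l"
proof (rule ccontr)
  assume "\<not> ?thesis"
  then have "\<forall>N. \<exists>k l. N \<le> k \<and> N \<le> l \<and> \<not> Q k l" by blast
  then obtain k l where "\<And>N. N \<le> k N \<and> N \<le> l N \<and> \<not> Q (k N) (l N)" by metis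
  with assms[of k l] show False by blast
qed

lemma Ip_midpoint_le:
  fixes u w :: "'a::euclidean_space \<Rightarrow> 'b::euclidean_space"
  assumes p: "1 \<le> p" and [measurable]: "u \<in> borel_measurable borel" "w \<in> borel_measurable borel"
  shows "Ip p (\<lambda>x. (1 / 2) *\<^sub>R (u x + w x)) \<le> Ip p u + Ip p w"
proof -
  have "Ip p (\<lambda>x. (1 / 2) *\<^sub>R (u x + w x)) = ennreal (\<bar>1 / 2\<bar> powr p) * Ip p (\<lambda>x. u x + w x)"
    by (rule Ip_scaleR) measurable
  also have "\<dots> \<le> ennreal (\<bar>1 / 2\<bar> powr p) * (ennreal (2 powr p) * (Ip p u + Ip p w))"
    by (intro mult_left_mono Ip_add_le2 p) auto
  also have "\<dots> = Ip p u + Ip p w"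
    by (simp add: mult.assoc[symmetric] ennreal_mult[symmetric] powr_mult[symmetric])
  finally show ?thesis .
qed

locale finite_energy =
  fixes f :: "'a::euclidean_space \<Rightarrow> real" and p :: real
  assumes p: "1 \<le> p" and fm [measurable]: "f \<in> borel_measurable borel"
    and fin: "Ip p f < \<infinity>" and Lam_fin: "Lam p f < \<infinity>"
begin

definition eps :: "nat \<Rightarrow> real" where "eps k = inverse (real (Suc k))"
definition v :: "nat \<Rightarrow> 'a \<Rightarrow> real" where "v k = conv (eps k) f"
definition D :: "nat \<Rightarrow> 'a \<Rightarrow> 'a" where "D k = conv_grad (eps k) f"

lemma eps_pos: "0 < eps k" by (simp add: eps_def)

lemma eps_tendsto: "eps \<longlonglongrightarrow> 0" unfolding eps_def by (rule LIMSEQ_inverse_real_of_nat)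

lemma f_loc: "loc_int f" by (rule loc_int_of_Ip[OF p fm fin])

lemma C1_v: "C1_gradient (v k) (D k)"
  unfolding v_def D_def by (rule C1_gradient_conv[OF eps_pos f_loc fm])

lemma v_measurable [measurable]: "v k \<in> borel_measurable borel" and D_measurable [measurable]: "D k \<in> borel_measurable borel"
  using C1_gradientD(4,5)[OF C1_v] by auto

lemma v_tendsto: "(\<lambda>k. Ip p (\<lambda>x. v k x - f x)) \<longlonglongrightarrow> 0"
  unfolding v_def by (rule conv_tendsto[OF p fm fin eps_tendsto eps_pos])

lemma Ip_v_finite: "Ip p (v k) < \<infinity>"
  using Ip_conv_le[OF p eps_pos f_loc fm, of k] fin unfolding v_def by order

lemma Lam_v: "Lam p (v k) = ennreal (heat_const p) * Ip p (D k)"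
  by (rule Lam_C1[OF p C1_v])

lemma Lam_v_le: "Lam p (v k) \<le> Lam p f"
  unfolding v_def by (rule Lam_conv_le[OF p eps_pos f_loc fm])

lemma heat_const_mult_eq_top_iff: "ennreal (heat_const p) * a < \<infinity> \<longleftrightarrow> a < \<infinity>"
  using heat_const_pos[OF p] by (auto simp: ennreal_mult_less_top)

lemma Ip_D_finite: "Ip p (D k) < \<infinity>"
  using le_less_trans[OF Lam_v_le[of k] Lam_fin] unfolding Lam_v heat_const_mult_eq_top_iff .

text \<open>The value to be identified: the integral of |\<nabla>f|^p for p > 1, and the total
  variation for p = 1.\<close>

definition M :: real where "M = enn2real (Lam p f) / heat_const p"

lemma M_nonneg: "0 \<le> M" using heat_const_pos[OF p] by (simp add: M_def)

lemma Lam_eq_M: "Lam p f = ennreal (heat_const p) * ennreal M"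
  using Lam_fin heat_const_pos[OF p] by (simp add: M_def ennreal_mult[symmetric] less_top)

lemma heat_const_mult_le_iff: "ennreal (heat_const p) * a \<le> ennreal (heat_const p) * b \<longleftrightarrow> a \<le> b"
  using heat_const_pos[OF p] by (subst ennreal_mult_le_mult_iff) auto

lemma Ip_D_le: "Ip p (D k) \<le> ennreal M"
  using Lam_v_le[of k] unfolding Lam_v Lam_eq_M heat_const_mult_le_iff .

text \<open>If the bound failed along pairs with both indices growing, the midpoints of the
  mollifications would still converge to \<open>f\<close> in L^p while their energies stayed below
  that of \<open>f\<close> by a fixed amount, against lower semicontinuity.\<close>

lemma Ip_midpoint_lower:
  assumes e: "0 < e"
  shows "\<exists>N. \<forall>k\<ge>N. \<forall>l\<ge>N. ennreal M \<le> Ip p (\<lambda>x. (D k x + D l x) /\<^sub>R 2) + ennreal e"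
proof (rule eventually_square_nat)
  fix k l :: "nat \<Rightarrow> nat"
  assume kl: "\<And>N. N \<le> k N" "\<And>N. N \<le> l N"
  let ?a = "\<lambda>N. Ip p (\<lambda>x. (D (k N) x + D (l N) x) /\<^sub>R 2) + ennreal e"
  show "\<exists>N. ennreal M \<le> ?a N"
  proof (rule ccontr)
    assume "\<not> (\<exists>N. ennreal M \<le> ?a N)"
    then have kl3: "?a N < ennreal M" for N
      unfolding not_ex not_le by (rule spec)
    define w where "w N x = (1 / 2) *\<^sub>R (v (k N) x + v (l N) x)" for N x
    define A where "A N x = (D (k N) x + D (l N) x) /\<^sub>R 2" for N x
    have wm[measurable]: "w N \<in> borel_measurable borel" for N unfolding w_def by measurable
    have C1: "C1_gradient (w N) (A N)" for N
      unfolding C1_gradient_def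
    proof safe
      show "(w N has_derivative (\<lambda>h. A N x \<bullet> h)) (at x)" for x
        unfolding w_def
        by (rule has_derivative_eq_rhs[OF has_derivative_scaleR_right[OF has_derivative_add[OF C1_gradientD(1)[OF C1_v] C1_gradientD(1)[OF C1_v]]]])
           (auto simp: A_def inner_add_left field_simps)
      show "continuous_on UNIV (A N)"
        unfolding A_def by (intro continuous_intros C1_gradientD(2)[OF C1_v])
    qed
    have sub: "(\<lambda>N. Ip p (\<lambda>x. v (k N) x - f x)) \<longlonglongrightarrow> 0" "(\<lambda>N. Ip p (\<lambda>x. v (l N) x - f x)) \<longlonglongrightarrow> 0"
      by (rule filterlim_compose[OF v_tendsto filterlim_at_top_mono[OF filterlim_ident always_eventually]], simp add: kl)+
    have w: "(\<lambda>N. Ip p (\<lambda>x. w N x - f x)) \<longlonglongrightarrow> 0"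
    proof (rule tendsto_0_ennreal_le)
      fix N
      have "Ip p (\<lambda>x. w N x - f x) = Ip p (\<lambda>x. (1 / 2) *\<^sub>R ((v (k N) x - f x) + (v (l N) x - f x)))"
        unfolding w_def by (rule arg_cong[where f="Ip p"]) (auto simp: field_simps)
      also have "\<dots> \<le> Ip p (\<lambda>x. v (k N) x - f x) + Ip p (\<lambda>x. v (l N) x - f x)"
        by (rule Ip_midpoint_le[OF p]) measurable
      finally show "Ip p (\<lambda>x. w N x - f x) \<le> Ip p (\<lambda>x. v (k N) x - f x) + Ip p (\<lambda>x. v (l N) x - f x)" .
      show "(\<lambda>N. Ip p (\<lambda>x. v (k N) x - f x) + Ip p (\<lambda>x. v (l N) x - f x)) \<longlonglongrightarrow> 0"
        using tendsto_add[OF sub] by simp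
    qed
    have wfin: "Ip p (w N) < \<infinity>" for N
    proof -
      have "Ip p (w N) \<le> Ip p (v (k N)) + Ip p (v (l N))"
        unfolding w_def by (rule Ip_midpoint_le[OF p]) measurable
      also have "\<dots> < \<infinity>" using Ip_v_finite[of "k N"] Ip_v_finite[of "l N"] by simp
      finally show ?thesis .
    qed
    have Ab: "Ip p (A N) \<le> ennreal (M - e)" and eM: "e \<le> M" for N
    proof -
      have lt: "Ip p (A N) + ennreal e < ennreal M" using kl3[of N] unfolding A_def .
      then have "Ip p (A N) < \<infinity>" by (auto simp: less_top[symmetric])
      then obtain a where a: "0 \<le> a" "Ip p (A N) = ennreal a" by (cases "Ip p (A N)") auto
      then have "a + e < M" using lt e by (simp add: ennreal_plus[symmetric] ennreal_less_iff del: ennreal_plus)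
      then show "Ip p (A N) \<le> ennreal (M - e)" "e \<le> M" using a by (auto intro: ennreal_leI)
    qed
    have "Lam p f \<le> liminf (\<lambda>N. Lam p (w N))"
      by (rule Lam_le_liminf[OF p fm wm wfin w])
    also have "\<dots> \<le> limsup (\<lambda>N. Lam p (w N))" by (rule Liminf_le_Limsup) simp
    also have "\<dots> \<le> ennreal (heat_const p) * ennreal (M - e)"
      unfolding Lam_C1[OF p C1] by (intro Limsup_bounded always_eventually allI mult_left_mono Ab) simp
    finally have "ennreal M \<le> ennreal (M - e)" unfolding Lam_eq_M heat_const_mult_le_iff .
    then show False using e eM by (simp add: ennreal_le_iff2)
  qed
qed

text \<open>Two gradients of energy at most \<open>M\<close> whose midpoint has energy nearly
  \<open>M\<close> leave no room for their difference in the uniform convexity inequality.\<close>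

lemma D_cauchy:
  assumes p1: "1 < p" and e: "0 < e"
  shows "\<exists>N. \<forall>k\<ge>N. \<forall>l\<ge>N. Ip p (\<lambda>x. D k x - D l x) \<le> ennreal e"
proof -
  \<comment> \<open>\<open>d\<close> is fixed first, since \<open>K\<close> depends on it, and
    \<open>c\<close> only after \<open>K\<close>; the errors 2 d M and K c are then at most e/2
    each.\<close>
  define d where "d = e / (4 * (M + 1))"
  have d: "0 < d" using e M_nonneg by (simp add: d_def)
  have dM: "2 * d * M \<le> e / 2" using e M_nonneg by (simp add: d_def field_simps)
  obtain K where K: "0 \<le> K" and uc: "\<And>u w :: 'a \<Rightarrow> 'a. u \<in> borel_measurable borel \<Longrightarrow> w \<in> borel_measurable borel \<Longrightarrow>
    Ip p (\<lambda>x. u x - w x) + ennreal K * Ip p (\<lambda>x. (u x + w x) /\<^sub>R 2) \<le> ennreal (K / 2 + d) * (Ip p u + Ip p w)"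
    using uniform_convexity_Ip[OF p1 d, where 'a='a and 'b='a] by blast
  define c where "c = e / (2 * (K + 1))"
  have c: "0 < c" "K * c \<le> e / 2" using e K by (simp_all add: c_def field_simps)
  obtain N where N: "\<And>k l. N \<le> k \<Longrightarrow> N \<le> l \<Longrightarrow> ennreal M \<le> Ip p (\<lambda>x. (D k x + D l x) /\<^sub>R 2) + ennreal c"
    using Ip_midpoint_lower[OF c(1)] by blast
  have "Ip p (\<lambda>x. D k x - D l x) \<le> ennreal e" if "N \<le> k" "N \<le> l" for k l
  proof -
    let ?a = "Ip p (\<lambda>x. (D k x + D l x) /\<^sub>R 2)" and ?b = "Ip p (\<lambda>x. D k x - D l x)"
    have "?b + ennreal K * ?a \<le> ennreal (K / 2 + d) * (Ip p (D k) + Ip p (D l))"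
      by (rule uc) measurable
    also have "\<dots> \<le> ennreal (K / 2 + d) * (ennreal M + ennreal M)"
      by (intro mult_left_mono add_mono Ip_D_le) simp
    also have "\<dots> = ennreal (K * M + 2 * d * M)"
      using K d M_nonneg by (simp add: ennreal_mult[symmetric] ennreal_plus[symmetric] algebra_simps del: ennreal_plus)
    finally have 1: "?b + ennreal K * ?a \<le> ennreal (K * M + 2 * d * M)" .
    have afin: "?a < \<infinity>"
    proof -
      have "?a \<le> Ip p (D k) + Ip p (D l)"
        unfolding inverse_eq_divide by (rule Ip_midpoint_le[OF p]) measurable
      also have "\<dots> < \<infinity>" using Ip_D_finite[of k] Ip_D_finite[of l] by simp
      finally show ?thesis .
    qed
    obtain a where a: "0 \<le> a" "?a = ennreal a" using afin by (cases ?a) auto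
    have "?b < \<infinity>"
      by (rule le_less_trans[OF order_trans[OF _ 1]]) auto
    then obtain b where b: "0 \<le> b" "?b = ennreal b" by (cases ?b) auto
    have "b + K * a \<le> K * M + 2 * d * M"
      using 1 a b K d M_nonneg unfolding a(2) b(2)
      by (simp add: ennreal_mult[symmetric] ennreal_plus[symmetric] ennreal_le_iff del: ennreal_plus)
    moreover have "M \<le> a + c"
      using N[OF that] a c unfolding a(2)
      by (simp add: ennreal_plus[symmetric] ennreal_le_iff del: ennreal_plus)
    then have "K * M \<le> K * a + K * c" using mult_left_mono[OF _ K, of M "a + c"] by (simp add: distrib_left)
    ultimately have "b \<le> e" using dM c(2) by linarith
    then show ?thesis unfolding b(2) by (rule ennreal_leI)
  qed
  then show ?thesis by blast
qed

text \<open>The bound by \<open>M\<close> on all gradients passes to their L^p limit and gives one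
  inequality for the energy; lower semicontinuity along the mollifications gives the other.\<close>

lemma weak_grad_exists:
  assumes p1: "1 < p"
  obtains G where "G \<in> borel_measurable borel" "Ip p G < \<infinity>" "weak_grad f G" "Lam p f = ennreal (heat_const p) * Ip p G"
proof -
  obtain G where Gm[measurable]: "G \<in> borel_measurable borel" and G: "(\<lambda>k. Ip p (\<lambda>x. D k x - G x)) \<longlonglongrightarrow> 0"
    using Ip_complete[OF p D_measurable D_cauchy[OF p1]] by blast
  have lim: "(\<lambda>k. Ip p (D k)) \<longlonglongrightarrow> Ip p G" by (rule Ip_tendsto[OF p Gm D_measurable G])
  have le: "Ip p G \<le> ennreal M" by (rule LIMSEQ_le_const2[OF lim]) (use Ip_D_le in blast)
  then have Gfin: "Ip p G < \<infinity>" by (rule le_less_trans) simp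
  have "(\<lambda>k. Lam p (v k)) \<longlonglongrightarrow> ennreal (heat_const p) * Ip p G"
    unfolding Lam_v by (intro ennreal_tendsto_cmult lim) simp
  then have "liminf (\<lambda>k. Lam p (v k)) = ennreal (heat_const p) * Ip p G"
    by (intro lim_imp_Liminf) auto
  then have "Lam p f \<le> ennreal (heat_const p) * Ip p G"
    using Lam_le_liminf[OF p fm v_measurable Ip_v_finite v_tendsto] by simp
  moreover have "ennreal (heat_const p) * Ip p G \<le> Lam p f"
    unfolding Lam_eq_M by (intro mult_left_mono le) simp
  ultimately have eq: "Lam p f = ennreal (heat_const p) * Ip p G" by (rule antisym)
  have "weak_grad f G"
  proof (rule weak_grad_limit[OF p fm Gm f_loc _ _ _ C1_v v_tendsto G])
    show "loc_int G" by (rule loc_int_of_Ip[OF p Gm Gfin])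
    show "loc_int (v k)" for k by (rule loc_int_of_Ip[OF p v_measurable Ip_v_finite])
    show "loc_int (D k)" for k by (rule loc_int_of_Ip[OF p D_measurable Ip_D_finite])
  qed
  with Gm Gfin show ?thesis using eq by (rule that)
qed

end

section \<open>The total variation for \<open>p = 1\<close>\<close>

lemma integrable_continuous_supported:
  fixes g :: "'a::euclidean_space \<Rightarrow> 'b::euclidean_space"
  assumes g: "continuous_on UNIV g" and z: "\<And>x. R < norm x \<Longrightarrow> g x = 0"
  shows "integrable lborel g"
proof -
  obtain B where "\<And>x. norm (g x) \<le> B"
    using bounded_of_support[where R=R, OF g z] by metis
  then show ?thesis
    by (rule integrable_supported[where R=R, OF borel_measurable_continuous_onI[OF g] _ z])
qed

section \<open>Test fields and their divergence\<close>

lemma C1cD: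
  fixes \<phi> :: "'a::euclidean_space \<Rightarrow> 'b::euclidean_space"
  assumes "\<phi> \<in> C1c"
  shows "(\<phi> has_derivative frechet_derivative \<phi> (at x)) (at x)"
    "continuous_on UNIV (\<lambda>x. frechet_derivative \<phi> (at x) h)"
    "\<exists>R. \<forall>x. R < norm x \<longrightarrow> \<phi> x = 0"
proof -
  show "(\<phi> has_derivative frechet_derivative \<phi> (at x)) (at x)"
    using assms by (simp add: C1c_def frechet_derivative_works)
  show "continuous_on UNIV (\<lambda>x. frechet_derivative \<phi> (at x) h)"
    using assms by (simp add: C1c_def)
  have "bounded {x. \<phi> x \<noteq> 0}"
    using assms bounded_subset[OF compact_imp_bounded closure_subset] by (auto simp: C1c_def)
  then obtain R where "\<forall>x\<in>{x. \<phi> x \<noteq> 0}. norm x \<le> R" by (auto simp: bounded_iff)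
  then have "\<forall>x. R < norm x \<longrightarrow> \<phi> x = 0" by (auto simp: not_le[symmetric])
  then show "\<exists>R. \<forall>x. R < norm x \<longrightarrow> \<phi> x = 0" ..
qed

lemma C1cI:
  fixes \<phi> :: "'a::euclidean_space \<Rightarrow> 'b::euclidean_space"
  assumes d: "\<And>x. (\<phi> has_derivative \<phi>' x) (at x)" and c: "\<And>h. continuous_on UNIV (\<lambda>x. \<phi>' x h)"
    and z: "\<And>x. R < norm x \<Longrightarrow> \<phi> x = 0"
  shows "\<phi> \<in> C1c" and "frechet_derivative \<phi> (at x) = \<phi>' x"
proof -
  show fd: "frechet_derivative \<phi> (at x) = \<phi>' x" for x
    using frechet_derivative_at[OF d] by simp
  have "bounded {x. \<phi> x \<noteq> 0}"
    unfolding bounded_iff using z by (intro exI[of _ R]) (auto simp: not_le[symmetric])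
  then have "compact (closure {x. \<phi> x \<noteq> 0})" by (simp add: compact_closure)
  then show "\<phi> \<in> C1c"
    unfolding C1c_def mem_Collect_eq using differentiableI[OF d] c by (intro conjI allI) (simp_all only: fd)
qed

text \<open>The gradient of the scalar component x \<mapsto> \<phi> x \<bullet> b, which reduces
  vector fields to scalar test functions.\<close>

definition comp_grad :: "('a::euclidean_space \<Rightarrow> 'b::euclidean_space) \<Rightarrow> 'b \<Rightarrow> 'a \<Rightarrow> 'a" where
  "comp_grad \<phi> b x = (\<Sum>c\<in>Basis. (frechet_derivative \<phi> (at x) c \<bullet> b) *\<^sub>R c)"

lemma comp_grad_inner:
  fixes \<phi> :: "'a::euclidean_space \<Rightarrow> 'b::euclidean_space"
  assumes "\<phi> \<in> C1c"
  shows "comp_grad \<phi> b x \<bullet> h = frechet_derivative \<phi> (at x) h \<bullet> b"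
proof -
  have lin: "linear (frechet_derivative \<phi> (at x))"
    using C1cD(1)[OF assms] by (rule has_derivative_linear)
  have "frechet_derivative \<phi> (at x) h \<bullet> b = frechet_derivative \<phi> (at x) (\<Sum>c\<in>Basis. (h \<bullet> c) *\<^sub>R c) \<bullet> b"
    by (simp add: euclidean_representation)
  also have "\<dots> = (\<Sum>c\<in>Basis. (h \<bullet> c) * (frechet_derivative \<phi> (at x) c \<bullet> b))"
    by (simp add: linear_sum[OF lin] linear_scale[OF lin] inner_sum_left)
  also have "\<dots> = comp_grad \<phi> b x \<bullet> h"
    unfolding comp_grad_def inner_sum_left by (intro sum.cong) (auto simp: inner_commute)
  finally show ?thesis ..
qed

lemma test_fun_component:
  fixes \<phi> :: "'a::euclidean_space \<Rightarrow> 'b::euclidean_space"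
  assumes phi: "\<phi> \<in> C1c"
  shows "test_fun (\<lambda>x. \<phi> x \<bullet> b) (comp_grad \<phi> b)"
  unfolding test_fun_def C1_gradient_def
proof safe
  show "((\<lambda>x. \<phi> x \<bullet> b) has_derivative (\<lambda>h. comp_grad \<phi> b x \<bullet> h)) (at x)" for x
    unfolding comp_grad_inner[OF phi] by (rule has_derivative_inner_left[OF C1cD(1)[OF phi]])
  show "continuous_on UNIV (comp_grad \<phi> b)"
    unfolding comp_grad_def by (intro continuous_intros C1cD(2)[OF phi])
  show "\<exists>R. \<forall>x. R < norm x \<longrightarrow> \<phi> x \<bullet> b = 0"
    using C1cD(3)[OF phi] by (metis inner_zero_left)
qed

lemma C1c_of_test_fun:
  assumes "test_fun \<phi> E"
  shows "\<phi> \<in> C1c" "frechet_derivative \<phi> (at x) h = E x \<bullet> h"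
proof -
  obtain R where c: "C1_gradient \<phi> E" and z: "\<And>x. R < norm x \<Longrightarrow> \<phi> x = 0"
    using assms by (auto simp: test_fun_def)
  have cont: "continuous_on UNIV (\<lambda>x. E x \<bullet> h)" for h
    by (intro continuous_intros C1_gradientD(2)[OF c])
  show "\<phi> \<in> C1c" by (rule C1cI(1)[where R=R and \<phi>'="\<lambda>x h. E x \<bullet> h", OF C1_gradientD(1)[OF c] cont z])
  show "frechet_derivative \<phi> (at x) h = E x \<bullet> h"
    using C1cI(2)[where R=R and \<phi>'="\<lambda>x h. E x \<bullet> h", OF C1_gradientD(1)[OF c] cont z]
    by (rule fun_cong)
qed

lemma div_field_eq:
  assumes "\<phi> \<in> C1c"
  shows "div_field \<phi> x = (\<Sum>b\<in>Basis. comp_grad \<phi> b x \<bullet> b)"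
  by (simp add: div_field_def comp_grad_inner[OF assms])

lemma div_field_test:
  fixes \<phi> :: "'a::euclidean_space \<Rightarrow> 'a"
  assumes phi: "\<phi> \<in> C1c"
  obtains R where "continuous_on UNIV \<phi>" "continuous_on UNIV (div_field \<phi>)"
    "\<And>x. R < norm x \<Longrightarrow> \<phi> x = 0" "\<And>x b. R < norm x \<Longrightarrow> comp_grad \<phi> b x = 0" "\<And>x. R < norm x \<Longrightarrow> div_field \<phi> x = 0"
proof -
  obtain R where R: "\<And>x. R < norm x \<Longrightarrow> \<phi> x = 0" using C1cD(3)[OF phi] by blast
  have z: "comp_grad \<phi> b x = 0" if "R < norm x" for x b
  proof (rule C1_gradient_vanishes[where R=R, OF _ _ that])
    show "C1_gradient (\<lambda>x. \<phi> x \<bullet> b) (comp_grad \<phi> b)"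
      using test_fun_component[OF phi] by (simp add: test_fun_def)
  qed (simp add: R)
  show ?thesis
  proof (rule that[of R])
    show "continuous_on UNIV \<phi>"
      using has_derivative_continuous[OF C1cD(1)[OF phi]] by (simp add: continuous_at_imp_continuous_on)
    show "continuous_on UNIV (div_field \<phi>)"
      unfolding div_field_def by (intro continuous_intros C1cD(2)[OF phi])
  qed (auto simp: R z div_field_eq[OF phi])
qed

lemma integral_div_field_by_parts:
  fixes \<phi> :: "'a::euclidean_space \<Rightarrow> 'a"
  assumes phi: "\<phi> \<in> C1c" and v: "C1_gradient v D"
  shows "(\<integral>x. v x * div_field \<phi> x \<partial>lborel) = - (\<integral>x. D x \<bullet> \<phi> x \<partial>lborel)"
proof -
  obtain R where R: "\<And>x. R < norm x \<Longrightarrow> \<phi> x = 0"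
    "\<And>x b. R < norm x \<Longrightarrow> comp_grad \<phi> b x = 0"
    using div_field_test[OF phi] by metis
  have cg: "C1_gradient (\<lambda>x. \<phi> x \<bullet> b) (comp_grad \<phi> b)" for b
    using test_fun_component[OF phi] by (simp add: test_fun_def)
  note [continuous_intros] = C1_gradientD(2,3)[OF v] C1_gradientD(2,3)[OF cg]
  have i1: "integrable lborel (\<lambda>x. v x * (comp_grad \<phi> b x \<bullet> b))" for b
    by (rule integrable_continuous_supported[where R=R]) (auto intro!: continuous_intros simp: R)
  have i2: "integrable lborel (\<lambda>x. (D x \<bullet> b) * (\<phi> x \<bullet> b))" for b
    by (rule integrable_continuous_supported[where R=R]) (auto intro!: continuous_intros simp: R)
  have "(\<integral>x. v x * div_field \<phi> x \<partial>lborel) = (\<integral>x. (\<Sum>b\<in>Basis. v x * (comp_grad \<phi> b x \<bullet> b)) \<partial>lborel)"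
    by (simp add: div_field_eq[OF phi] sum_distrib_left)
  also have "\<dots> = (\<Sum>b\<in>Basis. \<integral>x. v x * (comp_grad \<phi> b x \<bullet> b) \<partial>lborel)"
    by (rule Bochner_Integration.integral_sum) (rule i1)
  also have "\<dots> = (\<Sum>b\<in>Basis. - (\<integral>x. (D x \<bullet> b) * (\<phi> x \<bullet> b) \<partial>lborel))"
    by (intro sum.cong refl C1_integration_by_parts[where R=R, OF v cg]) (simp add: R)
  also have "\<dots> = - (\<integral>x. (\<Sum>b\<in>Basis. (D x \<bullet> b) * (\<phi> x \<bullet> b)) \<partial>lborel)"
    by (simp add: Bochner_Integration.integral_sum[OF i2] sum_negf)
  also have "\<dots> = - (\<integral>x. D x \<bullet> \<phi> x \<partial>lborel)"
    by (simp only: euclidean_inner[of "D x" "\<phi> x" for x])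
  finally show ?thesis .
qed

lemma Var_eq_lborel:
  fixes f :: "'a::euclidean_space \<Rightarrow> real"
  assumes [measurable]: "f \<in> borel_measurable borel"
  shows "Var f = (SUP \<phi>\<in>{\<phi> \<in> C1c. \<forall>x. norm (\<phi> x) \<le> 1}. ennreal (\<integral>x. f x * div_field \<phi> x \<partial>lborel))"
  unfolding Var_def
proof (intro SUP_cong refl arg_cong[where f=ennreal])
  fix \<phi> :: "'a \<Rightarrow> 'a" assume "\<phi> \<in> {\<phi> \<in> C1c. \<forall>x. norm (\<phi> x) \<le> 1}"
  then have "continuous_on UNIV (div_field \<phi>)" using div_field_test by blast
  then have [measurable]: "div_field \<phi> \<in> borel_measurable borel" by (rule borel_measurable_continuous_onI)
  show "(\<integral>x. f x * div_field \<phi> x \<partial>lebesgue) = (\<integral>x. f x * div_field \<phi> x \<partial>lborel)"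
    by (rule integral_completion) measurable
qed

text \<open>The dual competitor is the mollification of the unit field \<open>- sgn (\<nabla>(f * \<rho>))\<close> cut off at radius \<open>R\<close>.\<close>

lemma Ip_conv_grad_le_Var:
  fixes f :: "'a::euclidean_space \<Rightarrow> real"
  assumes e: "0 < e" and fm[measurable]: "f \<in> borel_measurable borel" and fin: "Ip 1 f < \<infinity>"
    and Dfin: "Ip 1 (conv_grad e f) < \<infinity>"
  shows "Ip 1 (conv_grad e f) \<le> Var f"
proof -
  note f = loc_int_of_Ip[OF order_refl fm fin]
  define D where "D = conv_grad e f"
  have C1: "C1_gradient (conv e f) D" unfolding D_def by (rule C1_gradient_conv[OF e f fm])
  note Dm[measurable] = C1_gradientD(4)[OF C1]
  have iD: "integrable lborel (\<lambda>x. norm (D x))"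
    using Dfin unfolding Ip_def D_def[symmetric] by (intro integrableI_bounded) auto
  have main: "(\<integral>\<^sup>+x. ennreal (norm (D x)) * indicator (cball 0 R) x \<partial>lborel) \<le> Var f" for R
  proof -
    define \<phi> where "\<phi> y = - (indicator (cball 0 R) y *\<^sub>R sgn (D y))" for y
    have phm[measurable]: "\<phi> \<in> borel_measurable borel" unfolding \<phi>_def sgn_div_norm by measurable
    have ph1: "norm (\<phi> y) \<le> indicator (cball 0 R) y" for y
      by (auto simp: \<phi>_def norm_sgn indicator_def)
    have phz: "\<phi> y = 0" if "R < norm y" for y using that by (simp add: \<phi>_def)
    have ph1': "norm (\<phi> y) \<le> 1" for y by (rule order_trans[OF ph1]) (simp add: indicator_def)
    have phl: "loc_int \<phi>"
      unfolding loc_int_def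
    proof
      fix S
      show "integrable lborel (\<lambda>x. indicator (cball 0 S) x *\<^sub>R \<phi> x)"
        by (rule integrable_supported[where R=R and B=1]) (use ph1' phz in \<open>auto simp: indicator_def\<close>)
    qed
    define \<psi> where "\<psi> = conv e \<phi>"
    have psz: "\<psi> x = 0" if "R + e < norm x" for x
    proof -
      have "moll e (x - y) *\<^sub>R \<phi> y = 0" for y
      proof (cases "R < norm y")
        case False
        then have "e \<le> norm (x - y)" using norm_triangle_ineq2[of x y] that by simp
        then show ?thesis by (simp add: moll_eq_0[OF e])
      qed (simp add: phz)
      then show ?thesis by (simp only: \<psi>_def conv_def Bochner_Integration.integral_zero)
    qed
    have psC: "\<psi> \<in> C1c" and psd: "frechet_derivative \<psi> (at x) = conv_deriv e \<phi> x" for x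
      unfolding \<psi>_def
      using C1cI[where R="R + e" and \<phi>'="conv_deriv e \<phi>", OF has_derivative_conv[OF e phl phm] continuous_on_conv_deriv[OF e phl phm]] psz
      unfolding \<psi>_def by blast+
    have ps1: "norm (\<psi> x) \<le> 1" for x
    proof -
      interpret prob_space "mollM e :: 'a measure" by (rule prob_space_mollM[OF e])
      have "norm (\<psi> x) \<le> (\<integral>y. norm (\<phi> (x - y)) \<partial>mollM e)"
        unfolding \<psi>_def conv_eq_average(1)[OF e phl phm] by (rule integral_norm_bound)
      also have "\<dots> \<le> (\<integral>y. 1 \<partial>(mollM e :: 'a measure))"
        using conv_eq_average(2)[OF e phl phm] by (intro integral_mono ph1') auto
      also have "\<dots> = 1" using prob_space by simp
      finally show ?thesis .
    qed
    have divp: "div_field \<psi> x = (\<integral>y. moll_grad e (x - y) \<bullet> \<phi> y \<partial>lborel)" for x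
    proof -
      have "div_field \<psi> x = (\<Sum>b\<in>Basis. (\<integral>y. (moll_grad e (x - y) \<bullet> b) *\<^sub>R \<phi> y \<partial>lborel) \<bullet> b)"
        by (simp add: div_field_def psd conv_deriv_def)
      also have "\<dots> = (\<Sum>b\<in>Basis. \<integral>y. (moll_grad e (x - y) \<bullet> b) *\<^sub>R \<phi> y \<bullet> b \<partial>lborel)"
        by (intro sum.cong refl integral_inner_left[symmetric] integrable_conv(2)[OF e phl phm])
      also have "\<dots> = (\<integral>y. (\<Sum>b\<in>Basis. (moll_grad e (x - y) \<bullet> b) *\<^sub>R \<phi> y \<bullet> b) \<partial>lborel)"
        by (rule Bochner_Integration.integral_sum[symmetric])
           (intro integrable_inner_left integrable_conv(2)[OF e phl phm])
      also have "\<dots> = (\<integral>y. moll_grad e (x - y) \<bullet> \<phi> y \<partial>lborel)"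
        by (simp only: euclidean_inner[of "moll_grad e (x - y)" "\<phi> y" for y] inner_scaleR_left)
      finally show ?thesis .
    qed
    \<comment> \<open>The mollifier is even, so its gradient is odd; the sign produced here cancels
      the one in the unit field.\<close>
    have Dp: "D y \<bullet> \<phi> y = - (\<integral>x. f x * (moll_grad e (x - y) \<bullet> \<phi> y) \<partial>lborel)" for y
    proof -
      have "D y \<bullet> \<phi> y = (\<integral>x. (moll_grad e (y - x) \<bullet> \<phi> y) *\<^sub>R f x \<partial>lborel)"
        unfolding D_def conv_deriv_eq_inner[OF e f fm, symmetric] conv_deriv_def ..
      also have "\<dots> = (\<integral>x. - (f x * (moll_grad e (x - y) \<bullet> \<phi> y)) \<partial>lborel)"
      proof (rule Bochner_Integration.integral_cong)
        fix x
        have "moll_grad e (y - x) = - moll_grad e (x - y)" using moll_minus(2)[of e "x - y"] by simp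
        then show "(moll_grad e (y - x) \<bullet> \<phi> y) *\<^sub>R f x = - (f x * (moll_grad e (x - y) \<bullet> \<phi> y))" by simp
      qed simp
      finally show ?thesis by simp
    qed
    obtain B where B: "0 < B" "\<And>x::'a. norm (moll_grad e x) \<le> B"
      by (rule moll_bounded[OF e, where 'a='a]) blast
    \<comment> \<open>The cutoff at radius \<open>R\<close> confines \<open>y\<close> to a set of
      finite measure, where the integrand is at most B |f x|; this makes Fubini's theorem
      applicable.\<close>
    have iF: "integrable (lborel \<Otimes>\<^sub>M lborel) (\<lambda>(x, y). f x * (moll_grad e (x - y) \<bullet> \<phi> y))"
    proof (rule integrableI_bounded)
      have "(\<integral>\<^sup>+z. ennreal (norm (case z of (x, y) \<Rightarrow> f x * (moll_grad e (x - y) \<bullet> \<phi> y))) \<partial>(lborel \<Otimes>\<^sub>M lborel)) =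
          (\<integral>\<^sup>+x. \<integral>\<^sup>+y. ennreal (norm (f x * (moll_grad e (x - y) \<bullet> \<phi> y))) \<partial>lborel \<partial>lborel)"
        by (subst lborel.nn_integral_fst[symmetric]) auto
      also have "\<dots> \<le> (\<integral>\<^sup>+x. \<integral>\<^sup>+y. ennreal (norm (f x)) * (ennreal B * indicator (cball (0::'a) R) y) \<partial>lborel \<partial>lborel)"
      proof (rule nn_integral_mono, rule nn_integral_mono)
        fix x y :: 'a
        have "\<bar>moll_grad e (x - y) \<bullet> \<phi> y\<bar> \<le> norm (moll_grad e (x - y)) * norm (\<phi> y)"
          by (rule Cauchy_Schwarz_ineq2)
        also have "\<dots> \<le> B * indicator (cball 0 R) y"
          using B ph1[of y] by (intro mult_mono) auto
        finally have "norm (f x * (moll_grad e (x - y) \<bullet> \<phi> y)) \<le> norm (f x) * (B * indicator (cball 0 R) y)"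
          by (simp add: abs_mult mult_left_mono)
        then have "ennreal (norm (f x * (moll_grad e (x - y) \<bullet> \<phi> y))) \<le> ennreal (norm (f x) * (B * indicator (cball 0 R) y))"
          by (rule ennreal_leI)
        also have "\<dots> = ennreal (norm (f x)) * (ennreal B * indicator (cball 0 R) y)"
          using B(1) by (simp add: ennreal_mult ennreal_indicator)
        finally show "ennreal (norm (f x * (moll_grad e (x - y) \<bullet> \<phi> y))) \<le> ennreal (norm (f x)) * (ennreal B * indicator (cball 0 R) y)" .
      qed
      also have "\<dots> = (\<integral>\<^sup>+x. ennreal (norm (f x)) * (ennreal B * emeasure lborel (cball (0::'a) R)) \<partial>lborel)"
        by (simp add: nn_integral_cmult)
      also have "\<dots> = Ip 1 f * (ennreal B * emeasure lborel (cball (0::'a) R))"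
        unfolding Ip_def by (simp add: nn_integral_multc)
      also have "\<dots> < \<infinity>"
        using fin emeasure_bounded_finite[of "cball (0::'a) R"] by (simp add: ennreal_mult_less_top)
      finally show "(\<integral>\<^sup>+z. ennreal (norm (case z of (x, y) \<Rightarrow> f x * (moll_grad e (x - y) \<bullet> \<phi> y))) \<partial>(lborel \<Otimes>\<^sub>M lborel)) < \<infinity>" .
    qed measurable
    have "(\<integral>x. f x * div_field \<psi> x \<partial>lborel) = (\<integral>x. \<integral>y. f x * (moll_grad e (x - y) \<bullet> \<phi> y) \<partial>lborel \<partial>lborel)"
      by (simp add: divp)
    also have "\<dots> = (\<integral>y. \<integral>x. f x * (moll_grad e (x - y) \<bullet> \<phi> y) \<partial>lborel \<partial>lborel)"
      using lborel_pair.Fubini_integral[OF iF] by simp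
    also have "\<dots> = (\<integral>y. - (D y \<bullet> \<phi> y) \<partial>lborel)" by (simp add: Dp)
    also have "\<dots> = (\<integral>y. norm (D y) * indicator (cball 0 R) y \<partial>lborel)"
    proof (rule Bochner_Integration.integral_cong)
      fix y
      have "D y \<bullet> sgn (D y) = norm (D y)"
        by (cases "D y = 0") (simp_all add: sgn_div_norm dot_square_norm power2_eq_square)
      then show "- (D y \<bullet> \<phi> y) = norm (D y) * indicator (cball 0 R) y" by (simp add: \<phi>_def)
    qed simp
    finally have eq: "(\<integral>x. f x * div_field \<psi> x \<partial>lborel) = (\<integral>y. norm (D y) * indicator (cball 0 R) y \<partial>lborel)" .
    have "(\<integral>\<^sup>+x. ennreal (norm (D x)) * indicator (cball 0 R) x \<partial>lborel) = (\<integral>\<^sup>+x. ennreal (norm (D x) * indicator (cball 0 R) x) \<partial>lborel)"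
      by (intro nn_integral_cong) (auto simp: indicator_def)
    also have "\<dots> = ennreal (\<integral>y. norm (D y) * indicator (cball 0 R) y \<partial>lborel)"
      using integrable_mult_indicator[OF _ iD, of "cball 0 R"] by (intro nn_integral_eq_integral) (auto simp: mult.commute)
    also have "\<dots> \<le> Var f"
      unfolding eq[symmetric] Var_eq_lborel[OF fm] by (rule SUP_upper) (use psC ps1 in auto)
    finally show ?thesis .
  qed
  have "(\<lambda>n. \<integral>\<^sup>+x. ennreal (norm (D x)) * indicator (cball 0 (real n)) x \<partial>lborel) \<longlonglongrightarrow> (\<integral>\<^sup>+x. ennreal (norm (D x)) \<partial>lborel)"
  proof (rule nn_integral_LIMSEQ)
    show "mono (\<lambda>n x. ennreal (norm (D x)) * indicator (cball 0 (real n)) x)"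
      by (intro monoI le_funI mult_left_mono) (auto simp: indicator_def)
    show "(\<lambda>n. ennreal (norm (D x)) * indicator (cball 0 (real n)) x) \<longlonglongrightarrow> ennreal (norm (D x))" for x
    proof (rule tendsto_eventually)
      show "\<forall>\<^sub>F n in sequentially. ennreal (norm (D x)) * indicator (cball 0 (real n)) x = ennreal (norm (D x))"
        using eventually_ge_at_top[of "nat \<lceil>norm x\<rceil>"]
        by eventually_elim (auto simp: indicator_def; linarith)
    qed
  qed measurable
  then have "(\<integral>\<^sup>+x. ennreal (norm (D x)) \<partial>lborel) \<le> Var f"
    by (rule LIMSEQ_le_const2) (use main in blast)
  then show ?thesis by (simp add: Ip_def D_def)
qed

text \<open>Upper bound: against a field of norm at most 1 each mollification gives at most the
  integral of its gradient norm, hence at most \<open>M\<close>, and the pairings converge. Lower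
  bound: each of these gradient integrals is at most Var f, and lower semicontinuity turns this into
  a bound on \<open>M\<close>.\<close>

lemma (in finite_energy) Var_eq:
  assumes p1: "p = 1"
  shows "Var f = ennreal M"
proof (rule antisym)
  show "Var f \<le> ennreal M"
    unfolding Var_eq_lborel[OF fm]
  proof (intro SUP_least ennreal_leI)
    fix \<phi> :: "'a \<Rightarrow> 'a" assume "\<phi> \<in> {\<phi> \<in> C1c. \<forall>x. norm (\<phi> x) \<le> 1}"
    then have phi: "\<phi> \<in> C1c" and ph1: "\<And>x. norm (\<phi> x) \<le> 1" by auto
    obtain R where cph: "continuous_on UNIV \<phi>" and c: "continuous_on UNIV (div_field \<phi>)"
      and zp: "\<And>x. R < norm x \<Longrightarrow> \<phi> x = 0" and z: "\<And>x. R < norm x \<Longrightarrow> div_field \<phi> x = 0"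
      using div_field_test[OF phi] by metis
    obtain B where B: "\<And>x. norm (div_field \<phi> x) \<le> B"
      using bounded_of_support[where R=R, OF c z] by metis
    have "(\<lambda>k. \<integral>x. v k x \<bullet> div_field \<phi> x \<partial>lborel) \<longlonglongrightarrow> (\<integral>x. f x \<bullet> div_field \<phi> x \<partial>lborel)"
    proof (rule integral_inner_tendsto[where R=R, OF p fm _ f_loc _ v_tendsto _ B z])
      show "loc_int (v k)" for k by (rule loc_int_of_Ip[OF p v_measurable Ip_v_finite])
      show "div_field \<phi> \<in> borel_measurable borel" by (rule borel_measurable_continuous_onI[OF c])
    qed auto
    then have lim: "(\<lambda>k. \<integral>x. v k x * div_field \<phi> x \<partial>lborel) \<longlonglongrightarrow> (\<integral>x. f x * div_field \<phi> x \<partial>lborel)"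
      by simp
    have "(\<integral>x. v k x * div_field \<phi> x \<partial>lborel) \<le> M" for k
    proof -
      have iD: "integrable lborel (\<lambda>x. norm (D k x))"
        using Ip_D_finite[of k] by (intro integrableI_bounded) (auto simp: Ip_def p1)
      have i: "integrable lborel (\<lambda>x. - (D k x \<bullet> \<phi> x))"
        by (rule integrable_continuous_supported[where R=R])
           (auto intro!: continuous_intros cph C1_gradientD(2)[OF C1_v] simp: zp)
      have "(\<integral>x. v k x * div_field \<phi> x \<partial>lborel) = (\<integral>x. - (D k x \<bullet> \<phi> x) \<partial>lborel)"
        using integral_div_field_by_parts[OF phi C1_v] by simp
      also have "\<dots> \<le> (\<integral>x. norm (D k x) \<partial>lborel)"
      proof (rule integral_mono[OF i iD])
        fix x
        have "- (D k x \<bullet> \<phi> x) \<le> norm (D k x) * norm (\<phi> x)"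
          using Cauchy_Schwarz_ineq2[of "D k x" "\<phi> x"] by linarith
        also have "\<dots> \<le> norm (D k x) * 1" by (intro mult_left_mono ph1) simp
        finally show "- (D k x \<bullet> \<phi> x) \<le> norm (D k x)" by simp
      qed
      also have "\<dots> \<le> M"
      proof -
        have "ennreal (\<integral>x. norm (D k x) \<partial>lborel) = Ip p (D k)"
          unfolding Ip_def p1 using iD by (simp add: nn_integral_eq_integral)
        then show ?thesis using Ip_D_le[of k] ennreal_le_iff[OF M_nonneg] by metis
      qed
      finally show ?thesis .
    qed
    then show "(\<integral>x. f x * div_field \<phi> x \<partial>lborel) \<le> M"
      by (intro LIMSEQ_le_const2[OF lim]) blast
  qed
  have "Lam p f \<le> liminf (\<lambda>k. Lam p (v k))"
    by (rule Lam_le_liminf[OF p fm v_measurable Ip_v_finite v_tendsto])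
  also have "\<dots> \<le> limsup (\<lambda>k. Lam p (v k))" by (rule Liminf_le_Limsup) simp
  also have "\<dots> \<le> ennreal (heat_const p) * Var f"
    unfolding Lam_v
  proof (intro Limsup_bounded always_eventually allI mult_left_mono)
    show "Ip p (D k) \<le> Var f" for k
      using Ip_conv_grad_le_Var[OF eps_pos fm, of k] fin Ip_D_finite[of k] unfolding p1 D_def by simp
  qed simp
  finally show "ennreal M \<le> Var f" unfolding Lam_eq_M heat_const_mult_le_iff .
qed

section \<open>Passage to Lebesgue measurable functions\<close>

text \<open>The analysis above is for Borel functions, where product measurability is automatic. All
  notions in the theorem are insensitive to null sets, so a Borel representative decides
  them.\<close>

lemma lebesgue_ae_borel:
  fixes f :: "'a::euclidean_space \<Rightarrow> 'b::euclidean_space"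
  assumes "f \<in> borel_measurable lebesgue"
  obtains g where "g \<in> borel_measurable borel" "AE x in lborel. f x = g x"
proof -
  have "\<exists>g\<in>borel_measurable lborel. AE x in lborel. f x \<bullet> b = g x" for b
    by (rule completion_ex_borel_measurable_real) (use assms in measurable)
  then obtain g where g: "\<And>b. g b \<in> borel_measurable lborel" "\<And>b. AE x in lborel. f x \<bullet> b = g b x"
    by metis
  have [measurable]: "g b \<in> borel_measurable borel" for b using g(1)[of b] by simp
  have "AE x in lborel. \<forall>b\<in>Basis. f x \<bullet> b = g b x"
    using g(2) by (intro AE_finite_allI) auto
  then have "AE x in lborel. f x = (\<Sum>b\<in>Basis. g b x *\<^sub>R b)"
  proof eventually_elim
    case (elim x)
    have "f x = (\<Sum>b\<in>Basis. (f x \<bullet> b) *\<^sub>R b)" by (rule euclidean_representation[symmetric])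
    also have "\<dots> = (\<Sum>b\<in>Basis. g b x *\<^sub>R b)" using elim by (intro sum.cong) auto
    finally show ?case .
  qed
  moreover have "(\<lambda>x. \<Sum>b\<in>Basis. g b x *\<^sub>R b) \<in> borel_measurable borel" by measurable
  ultimately show ?thesis by (intro that)
qed

lemma borel_imp_lebesgue_measurable: "g \<in> borel_measurable borel \<Longrightarrow> g \<in> borel_measurable lebesgue"
  by (rule measurable_completion) simp

lemma integral_lebesgue_eq_lborel:
  fixes u :: "'a::euclidean_space \<Rightarrow> 'b::euclidean_space"
  assumes u: "u \<in> borel_measurable lebesgue" and w: "w \<in> borel_measurable borel" and ae: "AE x in lborel. u x = w x"
  shows "(\<integral>x. u x \<partial>lebesgue) = (\<integral>x. w x \<partial>lborel)" "integrable lebesgue u \<longleftrightarrow> integrable lborel w"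
proof -
  have wl: "w \<in> borel_measurable lebesgue" by (rule borel_imp_lebesgue_measurable[OF w])
  have ael: "AE x in lebesgue. u x = w x" using ae by (rule AE_completion)
  have "(\<integral>x. u x \<partial>lebesgue) = (\<integral>x. w x \<partial>lebesgue)" by (rule integral_cong_AE[OF u wl ael])
  also have "\<dots> = (\<integral>x. w x \<partial>lborel)" by (rule integral_completion) (use w in simp)
  finally show "(\<integral>x. u x \<partial>lebesgue) = (\<integral>x. w x \<partial>lborel)" .
  have "integrable lebesgue u \<longleftrightarrow> integrable lebesgue w" by (rule integrable_cong_AE[OF u wl ael])
  also have "\<dots> \<longleftrightarrow> integrable lborel w"
    using w wl by (simp add: integrable_iff_bounded nn_integral_completion)
  finally show "integrable lebesgue u \<longleftrightarrow> integrable lborel w" .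
qed

section \<open>The notions of the theorem in terms of a Borel representative\<close>

lemma nn_integral_powr_eq_Ip:
  assumes "AE x in lborel. u x = w x"
  shows "(\<integral>\<^sup>+x. ennreal (norm (u x) powr p) \<partial>lebesgue) = Ip p w"
  unfolding nn_integral_completion Ip_def
  by (rule nn_integral_cong_AE) (use assms in \<open>eventually_elim, simp\<close>)

lemma Lp_iff_Ip:
  fixes u :: "'a::euclidean_space \<Rightarrow> 'b::euclidean_space"
  assumes u: "u \<in> borel_measurable lebesgue" and ae: "AE x in lborel. u x = w x"
  shows "u \<in> Lp p \<longleftrightarrow> Ip p w < \<infinity>"
proof -
  have [measurable]: "u \<in> borel_measurable lebesgue" by (rule u)
  have m: "(\<lambda>x. norm (u x) powr p) \<in> borel_measurable lebesgue" by measurable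
  show ?thesis
    unfolding Lp_def mem_Collect_eq integrable_iff_bounded nn_integral_powr_eq_Ip[OF ae, symmetric]
    using u m by simp
qed

text \<open>The function enters at two points: the exceptional set is discarded in \<open>y\<close>
  inside the inner integral, and in \<open>x\<close> outside it.\<close>

lemma heat_energy_cong_AE:
  fixes f g :: "'a::euclidean_space \<Rightarrow> real"
  assumes ae: "AE x in lborel. f x = g x"
  shows "heat_energy p f t = heat_energy p g t"
  unfolding heat_energy_def nn_integral_completion
proof (rule nn_integral_cong_AE)
  show "AE x in lborel. heat_semigroup t (\<lambda>y. ennreal (\<bar>f y - f x\<bar> powr p)) x =
      heat_semigroup t (\<lambda>y. ennreal (\<bar>g y - g x\<bar> powr p)) x"
    using ae
  proof eventually_elim
    case (elim x)
    have "(\<integral>\<^sup>+y. ennreal (exp (- (norm (x - y))\<^sup>2 / (4 * t))) * ennreal (\<bar>f y - f x\<bar> powr p) \<partial>lborel) =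
        (\<integral>\<^sup>+y. ennreal (exp (- (norm (x - y))\<^sup>2 / (4 * t))) * ennreal (\<bar>g y - g x\<bar> powr p) \<partial>lborel)"
      by (rule nn_integral_cong_AE) (use ae in \<open>eventually_elim, simp add: elim\<close>)
    then show ?case unfolding heat_semigroup_def nn_integral_completion by (rule arg_cong)
  qed
qed

lemma heat_energy_quotient_tendsto:
  fixes f :: "'a::euclidean_space \<Rightarrow> real"
  assumes p: "1 \<le> p" and g: "g \<in> borel_measurable borel" "Ip p g < \<infinity>" and ae: "AE x in lborel. f x = g x"
  shows "((\<lambda>t. heat_energy p f t / ennreal (t powr (p / 2))) \<longlongrightarrow> Lam p g) (at_right 0)"
proof (rule tendsto_at_right_sequentially[of 0 1])
  fix S :: "nat \<Rightarrow> real" assume S: "\<And>n. 0 < S n" "S \<longlonglongrightarrow> 0"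
  have "heat_energy p f (S n) / ennreal (S n powr (p / 2)) = LamE p g (sqrt (S n))" for n
  proof -
    have "heat_energy p f (S n) / ennreal (S n powr (p / 2)) = ennreal (S n powr - (p / 2)) * heat_energy p g (S n)"
      using S(1)[of n] unfolding heat_energy_cong_AE[OF ae]
      by (simp add: divide_ennreal_def inverse_ennreal powr_minus mult.commute)
    also have "\<dots> = LamE p g (sqrt (S n))" by (rule heat_energy_eq_LamE[OF g(1) S(1)])
    finally show ?thesis .
  qed
  moreover have "(\<lambda>n. LamE p g (sqrt (S n))) \<longlonglongrightarrow> Lam p g"
  proof (rule LamE_tendsto[OF p g])
    show "(\<lambda>n. sqrt (S n)) \<longlonglongrightarrow> 0" using tendsto_real_sqrt[OF S(2)] by simp
  qed (use S(1) in simp)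
  ultimately show "(\<lambda>n. heat_energy p f (S n) / ennreal (S n powr (p / 2))) \<longlonglongrightarrow> Lam p g" by simp
qed simp

lemma Var_cong_AE:
  fixes f g :: "'a::euclidean_space \<Rightarrow> real"
  assumes f: "f \<in> borel_measurable lebesgue" and g[measurable]: "g \<in> borel_measurable borel" and ae: "AE x in lborel. f x = g x"
  shows "Var f = Var g"
  unfolding Var_eq_lborel[OF g] unfolding Var_def
proof (intro SUP_cong refl arg_cong[where f=ennreal])
  fix \<phi> :: "'a \<Rightarrow> 'a" assume "\<phi> \<in> {\<phi> \<in> C1c. \<forall>x. norm (\<phi> x) \<le> 1}"
  then have "continuous_on UNIV (div_field \<phi>)" using div_field_test by blast
  then have d[measurable]: "div_field \<phi> \<in> borel_measurable borel" by (rule borel_measurable_continuous_onI)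
  show "(\<integral>x. f x * div_field \<phi> x \<partial>lebesgue) = (\<integral>x. g x * div_field \<phi> x \<partial>lborel)"
  proof (rule integral_lebesgue_eq_lborel(1))
    show "(\<lambda>x. f x * div_field \<phi> x) \<in> borel_measurable lebesgue"
      by (intro borel_measurable_times f borel_imp_lebesgue_measurable d)
    show "AE x in lborel. f x * div_field \<phi> x = g x * div_field \<phi> x"
      using ae by eventually_elim simp
  qed measurable
qed

lemma locally_integrable_iff_loc_int:
  fixes f g :: "'a::euclidean_space \<Rightarrow> 'b::euclidean_space"
  assumes f: "f \<in> borel_measurable lebesgue" and g[measurable]: "g \<in> borel_measurable borel" and ae: "AE x in lborel. f x = g x"
  shows "locally_integrable f \<longleftrightarrow> loc_int g"
proof -
  have eq: "f absolutely_integrable_on K \<longleftrightarrow> integrable lborel (\<lambda>x. indicator K x *\<^sub>R g x)" if K: "compact K" for K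
  proof -
    have Kb[measurable]: "K \<in> sets borel" using K by (simp add: borel_compact)
    show ?thesis
      unfolding set_integrable_def
    proof (rule integral_lebesgue_eq_lborel(2))
      show "(\<lambda>x. indicator K x *\<^sub>R f x) \<in> borel_measurable lebesgue"
        by (intro borel_measurable_scaleR f borel_imp_lebesgue_measurable borel_measurable_indicator Kb)
      show "AE x in lborel. indicator K x *\<^sub>R f x = indicator K x *\<^sub>R g x"
        using ae by eventually_elim simp
    qed measurable
  qed
  show ?thesis
  proof
    assume l: "locally_integrable f"
    show "loc_int g"
      unfolding loc_int_def
    proof
      fix R
      have "f absolutely_integrable_on cball 0 R"
        using l compact_cball unfolding locally_integrable_def by blast
      then show "integrable lborel (\<lambda>x. indicator (cball 0 R) x *\<^sub>R g x)"
        using eq[OF compact_cball] by blast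
    qed
  next
    assume g: "loc_int g"
    show "locally_integrable f"
      unfolding locally_integrable_def
    proof safe
      fix K :: "'a set" assume K: "compact K"
      then have Kb[measurable]: "K \<in> sets borel" by (simp add: borel_compact)
      obtain R where R: "\<And>x. x \<in> K \<Longrightarrow> norm x \<le> R"
        using compact_imp_bounded[OF K] by (auto simp: bounded_iff)
      have "integrable lborel (\<lambda>x. indicator K x *\<^sub>R (indicator (cball 0 R) x *\<^sub>R g x))"
        by (rule integrable_mult_indicator) (use g Kb in \<open>simp_all add: loc_int_def\<close>)
      also have "(\<lambda>x. indicator K x *\<^sub>R (indicator (cball 0 R) x *\<^sub>R g x)) = (\<lambda>x. indicator K x *\<^sub>R g x)"
        using R by (auto simp: indicator_def fun_eq_iff)
      finally show "f absolutely_integrable_on K" unfolding eq[OF K] .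
    qed
  qed
qed

text \<open>Supplies measurability of the weak gradient picked by \<open>SOME\<close>, of which only
  the defining properties are known.\<close>

lemma locally_integrable_measurable:
  fixes f :: "'a::euclidean_space \<Rightarrow> 'b::euclidean_space"
  assumes "locally_integrable f"
  shows "f \<in> borel_measurable lebesgue"
proof (rule borel_measurable_LIMSEQ_metric)
  show "(\<lambda>x. indicator (cball 0 (real n)) x *\<^sub>R f x) \<in> borel_measurable lebesgue" for n
  proof -
    have "set_integrable lebesgue (cball 0 (real n)) f"
      using assms compact_cball unfolding locally_integrable_def by blast
    then show ?thesis unfolding set_integrable_def by (rule borel_measurable_integrable)
  qed
  show "(\<lambda>n. indicator (cball 0 (real n)) x *\<^sub>R f x) \<longlonglongrightarrow> f x" for x
  proof (rule tendsto_eventually)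
    show "\<forall>\<^sub>F n in sequentially. indicator (cball 0 (real n)) x *\<^sub>R f x = f x"
      using eventually_ge_at_top[of "nat \<lceil>norm x\<rceil>"]
      by eventually_elim (auto simp: indicator_def; linarith)
  qed
qed

lemma has_weak_gradient_iff:
  fixes f :: "'a::euclidean_space \<Rightarrow> real" and G :: "'a \<Rightarrow> 'a"
  assumes f: "f \<in> borel_measurable lebesgue" and g[measurable]: "g \<in> borel_measurable borel" and ae: "AE x in lborel. f x = g x"
    and G: "G \<in> borel_measurable lebesgue" and H[measurable]: "H \<in> borel_measurable borel" and aeG: "AE x in lborel. G x = H x"
  shows "has_weak_gradient f G \<longleftrightarrow> loc_int g \<and> loc_int H \<and> weak_grad g H"
proof -
  have int: "(\<integral>x. f x * frechet_derivative \<phi> (at x) b \<partial>lebesgue) = (\<integral>x. g x * (E x \<bullet> b) \<partial>lborel)"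
    "(\<integral>x. (G x \<bullet> b) * \<phi> x \<partial>lebesgue) = (\<integral>x. (H x \<bullet> b) * \<phi> x \<partial>lborel)"
    if t: "test_fun \<phi> E" for \<phi> :: "'a \<Rightarrow> real" and E b
  proof -
    have c: "C1_gradient \<phi> E" using t by (simp add: test_fun_def)
    note [measurable] = C1_gradientD(4,5)[OF c]
    note ml = borel_imp_lebesgue_measurable
    show "(\<integral>x. f x * frechet_derivative \<phi> (at x) b \<partial>lebesgue) = (\<integral>x. g x * (E x \<bullet> b) \<partial>lborel)"
      unfolding C1c_of_test_fun(2)[OF t]
    proof (rule integral_lebesgue_eq_lborel(1))
      show "(\<lambda>x. f x * (E x \<bullet> b)) \<in> borel_measurable lebesgue"
        by (intro borel_measurable_times f ml) measurable
      show "AE x in lborel. f x * (E x \<bullet> b) = g x * (E x \<bullet> b)" using ae by eventually_elim simp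
    qed measurable
    show "(\<integral>x. (G x \<bullet> b) * \<phi> x \<partial>lebesgue) = (\<integral>x. (H x \<bullet> b) * \<phi> x \<partial>lborel)"
    proof (rule integral_lebesgue_eq_lborel(1))
      show "(\<lambda>x. (G x \<bullet> b) * \<phi> x) \<in> borel_measurable lebesgue"
        by (intro borel_measurable_times borel_measurable_inner G ml) measurable
      show "AE x in lborel. (G x \<bullet> b) * \<phi> x = (H x \<bullet> b) * \<phi> x" using aeG by eventually_elim simp
    qed measurable
  qed
  have "(\<forall>\<phi>\<in>C1c. \<forall>b\<in>Basis. (\<integral>x. f x * frechet_derivative \<phi> (at x) b \<partial>lebesgue) = - (\<integral>x. (G x \<bullet> b) * \<phi> x \<partial>lebesgue))
      \<longleftrightarrow> weak_grad g H"
  proof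
    assume *: "\<forall>\<phi>\<in>C1c. \<forall>b\<in>Basis. (\<integral>x. f x * frechet_derivative \<phi> (at x) b \<partial>lebesgue) = - (\<integral>x. (G x \<bullet> b) * \<phi> x \<partial>lebesgue)"
    show "weak_grad g H"
      unfolding weak_grad_def
    proof safe
      fix \<phi> :: "'a \<Rightarrow> real" and E and b :: 'a assume t: "test_fun \<phi> E" and b: "b \<in> Basis"
      show "(\<integral>x. g x * (E x \<bullet> b) \<partial>lborel) = - (\<integral>x. (H x \<bullet> b) * \<phi> x \<partial>lborel)"
        unfolding int[OF t, symmetric] using * C1c_of_test_fun(1)[OF t] b by blast
    qed
  next
    assume w: "weak_grad g H"
    show "\<forall>\<phi>\<in>C1c. \<forall>b\<in>Basis. (\<integral>x. f x * frechet_derivative \<phi> (at x) b \<partial>lebesgue) = - (\<integral>x. (G x \<bullet> b) * \<phi> x \<partial>lebesgue)"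
    proof safe
      fix \<phi> :: "'a \<Rightarrow> real" and b :: 'a assume phi: "\<phi> \<in> C1c" and b: "b \<in> Basis"
      \<comment> \<open>For real-valued \<phi> the component along 1 is \<phi> itself.\<close>
      have t: "test_fun \<phi> (comp_grad \<phi> 1)" using test_fun_component[OF phi, of 1] by simp
      show "(\<integral>x. f x * frechet_derivative \<phi> (at x) b \<partial>lebesgue) = - (\<integral>x. (G x \<bullet> b) * \<phi> x \<partial>lebesgue)"
        unfolding int[OF t] using w t b unfolding weak_grad_def by blast
    qed
  qed
  then show ?thesis
    unfolding has_weak_gradient_def locally_integrable_iff_loc_int[OF f g ae] locally_integrable_iff_loc_int[OF G H aeG] by simp
qed

text \<open>Existence of one weak gradient makes the choice by \<open>SOME\<close> a weak gradient
  too, and uniqueness identifies the two almost everywhere.\<close>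

lemma weak_gradient_eq_AE:
  fixes f :: "'a::euclidean_space \<Rightarrow> real"
  assumes f: "f \<in> borel_measurable lebesgue" and g: "g \<in> borel_measurable borel" and ae: "AE x in lborel. f x = g x"
    and G: "G \<in> borel_measurable borel" "loc_int g" "loc_int G" "weak_grad g G"
  shows "has_weak_gradient f G" "AE x in lborel. weak_gradient f x = G x"
proof -
  show wG: "has_weak_gradient f G"
    using has_weak_gradient_iff[OF f g ae borel_imp_lebesgue_measurable[OF G(1)] G(1)] G by simp
  have wH: "has_weak_gradient f (weak_gradient f)"
    unfolding weak_gradient_def by (rule someI[of "has_weak_gradient f", OF wG])
  then have H: "weak_gradient f \<in> borel_measurable lebesgue"
    by (intro locally_integrable_measurable) (simp add: has_weak_gradient_def)
  obtain H' where H': "H' \<in> borel_measurable borel" "AE x in lborel. weak_gradient f x = H' x"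
    using lebesgue_ae_borel[OF H] by blast
  have "loc_int H'" "weak_grad g H'"
    using has_weak_gradient_iff[OF f g ae H H'] wH by auto
  then have "AE x in lborel. H' x = G x"
    using weak_grad_unique[of g H' G] G H'(1) by blast
  with H'(2) show "AE x in lborel. weak_gradient f x = G x" by eventually_elim simp
qed

theorem theoremB:
  fixes f :: "real ^ 'n \<Rightarrow> real" and p :: real
  assumes "1 \<le> p"
    and "f \<in> Lp p"
    and "Liminf (at_right 0) (\<lambda>t. heat_energy p f t / ennreal (t powr (p / 2))) < \<infinity>"
  shows "(p > 1 \<longrightarrow>
            f \<in> W1p p \<and>
            ((\<lambda>t. heat_energy p f t / ennreal (t powr (p / 2))) \<longlongrightarrow>
               ennreal (2 * Gamma p / Gamma (p / 2)) *
                 (\<integral>\<^sup>+x. ennreal (norm (weak_gradient f x) powr p) \<partial>lebesgue)) (at_right 0)) \<and>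
         (p = 1 \<longrightarrow>
            f \<in> BV \<and>
            ((\<lambda>t. heat_energy 1 f t / ennreal (sqrt t)) \<longlongrightarrow>
               ennreal (2 / sqrt pi) * Var f) (at_right 0))"
proof -
  have p: "1 \<le> p" and fL: "f \<in> Lp p" by (fact assms)+
  have f: "f \<in> borel_measurable lebesgue" using fL by (simp add: Lp_def)
  obtain g where g: "g \<in> borel_measurable borel" and ae: "AE x in lborel. f x = g x"
    using lebesgue_ae_borel[OF f] by blast
  have fin: "Ip p g < \<infinity>" using fL Lp_iff_Ip[OF f ae] by blast
  have lim: "((\<lambda>t. heat_energy p f t / ennreal (t powr (p / 2))) \<longlongrightarrow> Lam p g) (at_right 0)"
    by (rule heat_energy_quotient_tendsto[OF p g fin ae])
  \<comment> \<open>The full limit exists already, so the lower limit in the hypothesis is its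
    value.\<close>
  have "Lam p g < \<infinity>"
    using assms(3) lim_imp_Liminf[OF _ lim] by (simp add: trivial_limit_at_right_real)
  then interpret finite_energy g p
    by unfold_locales (use p g fin in auto)
  show ?thesis
  proof (intro conjI impI)
    assume p1: "1 < p"
    obtain G where G: "G \<in> borel_measurable borel" "Ip p G < \<infinity>" "weak_grad g G"
      and Lam: "Lam p g = ennreal (heat_const p) * Ip p G"
      using weak_grad_exists[OF p1] by blast
    note wG = weak_gradient_eq_AE[OF f g ae G(1) f_loc loc_int_of_Ip[OF p G(1,2)] G(3)]
    have "G \<in> Lp p"
      using Lp_iff_Ip[OF borel_imp_lebesgue_measurable[OF G(1)], of G p] G(2) by simp
    with wG(1) fL show "f \<in> W1p p" by (auto simp: W1p_def)
    show "((\<lambda>t. heat_energy p f t / ennreal (t powr (p / 2))) \<longlongrightarrow>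
        ennreal (2 * Gamma p / Gamma (p / 2)) *
          (\<integral>\<^sup>+x. ennreal (norm (weak_gradient f x) powr p) \<partial>lebesgue)) (at_right 0)"
      using lim unfolding Lam nn_integral_powr_eq_Ip[OF wG(2)] heat_const_def .
  next
    assume p1: "p = 1"
    have Var: "Var f = ennreal M" using Var_cong_AE[OF f g ae] Var_eq[OF p1] by simp
    then show "f \<in> BV" using fL by (simp add: BV_def p1)
    \<comment> \<open>Gamma 1 = 1 and Gamma (1/2) = sqrt pi.\<close>
    have "heat_const p = 2 / sqrt pi" by (simp add: heat_const_def p1 Gamma_one_half_real)
    then have "((\<lambda>t. heat_energy 1 f t / ennreal (t powr (1 / 2))) \<longlongrightarrow> ennreal (2 / sqrt pi) * Var f) (at_right 0)"
      using lim unfolding Lam_eq_M Var by (simp add: p1)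
    moreover have "\<forall>\<^sub>F t in at_right 0. heat_energy 1 f t / ennreal (t powr (1 / 2)) = heat_energy 1 f t / ennreal (sqrt t)"
      using eventually_at_right_less[of "0::real"] by (rule eventually_mono) (simp add: powr_half_sqrt)
    ultimately show "((\<lambda>t. heat_energy 1 f t / ennreal (sqrt t)) \<longlongrightarrow> ennreal (2 / sqrt pi) * Var f) (at_right 0)"
      by (rule Lim_transform_eventually)
  qed
qed

end
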